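(* Consider the network Poisson model with $\mu=0$ and $\beta_n=0$, with true parameter $(\boldsymbol{\theta}^*,\boldsymbol{\gamma}^* )$ (which may depend on $n$), and let $\rho_n$, $\kappa_n$ and the $(2n-1)\times(2n-1)$ matrix $S$ be as defined in the context. If $$\kappa_n e^{23\rho_n}=o\left(\frac{n^{1/2}}{\log n}\right)\quad(n\to\infty),$$ then for any fixed $k\ge1$, as $n\to\infty$, the vector consisting of the first $k$ elements of $\widehat{\boldsymbol{\theta}}-\boldsymbol{\theta}^*$ is asymptotically multivariate normal with mean $\mathbf{0}$ and covariance matrix given by the upper left $k\times k$ block of $S$, where $(\widehat{\boldsymbol{\theta}},\widehat{\boldsymbol{\gamma}})$ is the maximum likelihood estimator.
   Context: Network Poisson model. For each $n\ge 2$ there are nodes $1,\dots,n$ and a random weight matrix $A=(a_{ij})$ with $a_{ii}=0$ and, for $i\ne j$, $a_{ij}\in\{0,1,2,\dots\}$ independent Poisson random variables with mean $\lambda_{ij}(\boldsymbol{\theta}^*,\boldsymbol{\gamma}^* )$, where $$\lambda_{ij}(\boldsymbol{\theta},\boldsymbol{\gamma})=e^{\alpha_i+\beta_j+Z_{ij}^\top\boldsymbol{\gamma}},\quad \boldsymbol{\theta}=(\alpha_1,\dots,\alpha_n,\beta_1,\dots,\beta_{n-1})^\top\in\mathbb{R}^{2n-1},\quad \beta_n=0,\quad \boldsymbol{\gamma}\in\mathbb{R}^p.$$ (The general model has an extra additive parameter $\mu$ in the exponent, which is set to $0$ along with $\beta_n=0$ for identifiability.) The superscript $*$ denotes true values.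 The covariates $Z_{ij}\in\mathbb{R}^p$ are treated as given; $p$ is fixed and $Z_{ij}\in\mathcal{Z}^p$ for a fixed compact set $\mathcal{Z}\subset\mathbb{R}$; $q:=\max_{i,j}\|Z_{ij}\|_\infty$ is a constant. Degrees: $d_i=\sum_{j\ne i}a_{ij}$, $b_j=\sum_{i\neq j}a_{ij}$. Score functions: $F_i(\boldsymbol{\theta},\boldsymbol{\gamma})=\sum_{j\ne i}\lambda_{ij}(\boldsymbol{\theta},\boldsymbol{\gamma})-d_i$ for $i=1,\dots,n$; $F_{n+j}(\boldsymbol{\theta},\boldsymbol{\gamma})=\sum_{i\ne j}\lambda_{ij}(\boldsymbol{\theta},\boldsymbol{\gamma})-b_j$ for $j=1,\dots,n-1$; $F=(F_1,\dots,F_{2n-1})^\top$; and $Q(\boldsymbol{\theta},\boldsymbol{\gamma})=\sum_{i\ne j}Z_{ij}(\lambda_{ij}(\boldsymbol{\theta},\boldsymbol{\gamma})-a_{ij})\in\mathbb{R}^p$. The maximum likelihood estimator (MLE) $(\widehat{\boldsymbol{\theta}},\widehat{\boldsymbol{\gamma}})$ is the solution of $F(\boldsymbol{\theta},\boldsymbol{\gamma})=0$, $Q(\boldsymbol{\theta},\boldsymbol{\gamma})=0$, if it exists. Let $B(\mathbf{x},\epsilon)=\{\mathbf{y}:\|\mathbf{x}-\mathbf{y}\|_\infty\le\epsilon\}$. Let $\epsilon_{n1},\epsilon_{n2}>0$ be small positive numbers, and set $$\rho_n:=\max_{i\ne j}|\alpha_i^*+\beta_j^*|+2\epsilon_{n1}+pq\|\boldsymbol{\gamma}^*\|_\infty+pq\,\epsilon_{n2}.$$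 Define $$H(\boldsymbol{\theta},\boldsymbol{\gamma})=\frac{\partial Q}{\partial\boldsymbol{\gamma}^\top}-\frac{\partial Q}{\partial\boldsymbol{\theta}^\top}\left[\frac{\partial F}{\partial\boldsymbol{\theta}^\top}\right]^{-1}\frac{\partial F}{\partial\boldsymbol{\gamma}^\top}$$ (all evaluated at $(\boldsymbol{\theta},\boldsymbol{\gamma})$). It is assumed that $H$ is positive definite and that $\kappa_n$ is a number such that $\sup_{\boldsymbol{\theta}\in B(\boldsymbol{\theta}^*,\epsilon_{n1})}\|H^{-1}(\boldsymbol{\theta},\boldsymbol{\gamma}^* )\|_\infty\le\kappa_n/n^2$, where $\|\cdot\|_\infty$ of a matrix is the maximum absolute row sum. Matrix $S$. Let $u_{ij}=\lambda_{ij}(\boldsymbol{\theta}^*,\boldsymbol{\gamma}^* )$ for $i\ne j$, $u_{ii}=0$, $u_{i\cdot}=\sum_{j=1}^n u_{ij}$, $u_{\cdot j}=\sum_{i=1}^n u_{ij}$, and let $\delta_{i,j}$ be the Kronecker delta. The symmetric matrix $S=(s_{i,j})_{1\le i,j\le 2n-1}$ is $$s_{i,j}=\begin{cases}\dfrac{\delta_{i,j}}{u_{i\cdot}}+\dfrac1{u_{\cdot n}}, & i,j=1,\dots,n,\\[4pt] -\dfrac1{u_{\cdot n}}, & i=1,\dots,n,\ j=n+1,\dots,2n-1,\\[4pt] -\dfrac1{u_{\cdot n}}, & i=n+1,\dots,2n-1,\ j=1,\dots,n,\\[4pt] \dfrac{\delta_{i,j}}{u_{\cdot (j-n)}}+\dfrac1{u_{\cdot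 n}}, & i,j=n+1,\dots,2n-1.\end{cases}$$ Random $k$-vectors $X_n$ are asymptotically multivariate normal with mean $\mathbf{0}$ and ($n$-dependent, positive definite) covariance matrix $\Sigma_n$ when $\Sigma_n^{-1/2}X_n$ converges in distribution to $N(\mathbf{0},I_k)$. *)

theory Defs
  imports "HOL-Probability.Probability"
begin

text \<open>
  The number \<open>n\<close> of nodes varies, so vectors in \<open>\<real>\<^sup>2\<^sup>n\<^sup>-\<^sup>1\<close> and matrices of that size are
  functions on \<open>nat\<close>, with indices running from \<open>1\<close> to \<open>2 * n - 1\<close>; only these entries are
  ever used. The dimension of the covariates is fixed, so \<open>\<real>\<^sup>p\<close> is the type \<open>real ^ 'p\<close>.
  A vector \<open>\<theta>\<close> stands for \<open>(\<alpha>\<^sub>1, \<dots>, \<alpha>\<^sub>n, \<beta>\<^sub>1, \<dots>, \<beta>\<^sub>n\<^sub>-\<^sub>1)\<close>.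
\<close>

definition alpha_of :: "(nat \<Rightarrow> real) \<Rightarrow> nat \<Rightarrow> real" where
  "alpha_of \<theta> i = \<theta> i"

definition beta_of :: "nat \<Rightarrow> (nat \<Rightarrow> real) \<Rightarrow> nat \<Rightarrow> real" where
  "beta_of n \<theta> j = (if j = n then 0 else \<theta> (n + j))"

definition rate ::
  "nat \<Rightarrow> (nat \<Rightarrow> nat \<Rightarrow> real ^ 'p) \<Rightarrow> (nat \<Rightarrow> real) \<Rightarrow> real ^ 'p \<Rightarrow> nat \<Rightarrow> nat \<Rightarrow> real" where
  "rate n Z \<theta> \<gamma> i j = exp (alpha_of \<theta> i + beta_of n \<theta> j + Z i j \<bullet> \<gamma>)"

definition off_diag :: "nat \<Rightarrow> (nat \<times> nat) set" where
  "off_diag n = {(i, j). i \<in> {1..n} \<and> j \<in> {1..n} \<and> i \<noteq> j}"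

definition poisson_network ::
  "nat \<Rightarrow> (nat \<Rightarrow> nat \<Rightarrow> real ^ 'p) \<Rightarrow> (nat \<Rightarrow> real) \<Rightarrow> real ^ 'p \<Rightarrow>
    'w measure \<Rightarrow> (nat \<Rightarrow> nat \<Rightarrow> 'w \<Rightarrow> nat) \<Rightarrow> bool" where
  "poisson_network n Z \<theta> \<gamma> M a \<longleftrightarrow>
     prob_space M \<and>
     (\<forall>i\<in>{1..n}. \<forall>\<omega>\<in>space M. a i i \<omega> = 0) \<and>
     prob_space.indep_vars M (\<lambda>_. count_space UNIV) (\<lambda>(i, j). a i j) (off_diag n) \<and>
     (\<forall>(i, j)\<in>off_diag n.
        distr M (count_space UNIV) (a i j) = measure_pmf (poisson_pmf (rate n Z \<theta> \<gamma> i j)))"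

definition out_degree :: "nat \<Rightarrow> (nat \<Rightarrow> nat \<Rightarrow> nat) \<Rightarrow> nat \<Rightarrow> nat" where
  "out_degree n A i = (\<Sum>j\<in>{1..n} - {i}. A i j)"

definition in_degree :: "nat \<Rightarrow> (nat \<Rightarrow> nat \<Rightarrow> nat) \<Rightarrow> nat \<Rightarrow> nat" where
  "in_degree n A j = (\<Sum>i\<in>{1..n} - {j}. A i j)"

definition score_F ::
  "nat \<Rightarrow> (nat \<Rightarrow> nat \<Rightarrow> real ^ 'p) \<Rightarrow> (nat \<Rightarrow> nat \<Rightarrow> nat) \<Rightarrow>
    (nat \<Rightarrow> real) \<Rightarrow> real ^ 'p \<Rightarrow> nat \<Rightarrow> real" where
  "score_F n Z A \<theta> \<gamma> r =
     (if r \<le> n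
      then (\<Sum>j\<in>{1..n} - {r}. rate n Z \<theta> \<gamma> r j) - real (out_degree n A r)
      else (\<Sum>i\<in>{1..n} - {r - n}. rate n Z \<theta> \<gamma> i (r - n)) - real (in_degree n A (r - n)))"

definition score_Q ::
  "nat \<Rightarrow> (nat \<Rightarrow> nat \<Rightarrow> real ^ 'p) \<Rightarrow> (nat \<Rightarrow> nat \<Rightarrow> nat) \<Rightarrow>
    (nat \<Rightarrow> real) \<Rightarrow> real ^ 'p \<Rightarrow> real ^ 'p" where
  "score_Q n Z A \<theta> \<gamma> = (\<Sum>(i, j)\<in>off_diag n. (rate n Z \<theta> \<gamma> i j - real (A i j)) *\<^sub>R Z i j)"

definition is_mle ::
  "nat \<Rightarrow> (nat \<Rightarrow> nat \<Rightarrow> real ^ 'p) \<Rightarrow> (nat \<Rightarrow> nat \<Rightarrow> nat) \<Rightarrow>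
    (nat \<Rightarrow> real) \<Rightarrow> real ^ 'p \<Rightarrow> bool" where
  "is_mle n Z A \<theta> \<gamma> \<longleftrightarrow> (\<forall>r\<in>{1..2 * n - 1}. score_F n Z A \<theta> \<gamma> r = 0) \<and> score_Q n Z A \<theta> \<gamma> = 0"

definition partial_theta :: "((nat \<Rightarrow> real) \<Rightarrow> real) \<Rightarrow> (nat \<Rightarrow> real) \<Rightarrow> nat \<Rightarrow> real" where
  "partial_theta f \<theta> s = deriv (\<lambda>t. f (\<theta>(s := t))) (\<theta> s)"

definition partial_gamma :: "(real ^ 'p \<Rightarrow> real) \<Rightarrow> real ^ 'p \<Rightarrow> 'p \<Rightarrow> real" where
  "partial_gamma f \<gamma> l = deriv (\<lambda>t. f (\<gamma> + t *\<^sub>R axis l 1)) 0"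

definition is_inverse_upto ::
  "nat \<Rightarrow> (nat \<Rightarrow> nat \<Rightarrow> real) \<Rightarrow> (nat \<Rightarrow> nat \<Rightarrow> real) \<Rightarrow> bool" where
  "is_inverse_upto N A B \<longleftrightarrow>
     (\<forall>i\<in>{1..N}. \<forall>j\<in>{1..N}.
        (\<Sum>k=1..N. A i k * B k j) = of_bool (i = j) \<and>
        (\<Sum>k=1..N. B i k * A k j) = of_bool (i = j))"

text \<open>The entries with both indices in \<open>{1..N}\<close> are uniquely determined if \<open>A\<close> is invertible.\<close>

definition inverse_upto :: "nat \<Rightarrow> (nat \<Rightarrow> nat \<Rightarrow> real) \<Rightarrow> nat \<Rightarrow> nat \<Rightarrow> real" where
  "inverse_upto N A = (SOME B. is_inverse_upto N A B)"

text \<open>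
  \<open>H = \<partial>Q/\<partial>\<gamma>\<^sup>T - \<partial>Q/\<partial>\<theta>\<^sup>T (\<partial>F/\<partial>\<theta>\<^sup>T)\<^sup>-\<^sup>1 \<partial>F/\<partial>\<gamma>\<^sup>T\<close>. The data \<open>A\<close> enter the scores only additively, so
  \<open>H\<close> does not depend on them.
\<close>

definition H_mat ::
  "nat \<Rightarrow> (nat \<Rightarrow> nat \<Rightarrow> real ^ 'p) \<Rightarrow> (nat \<Rightarrow> nat \<Rightarrow> nat) \<Rightarrow>
    (nat \<Rightarrow> real) \<Rightarrow> real ^ 'p \<Rightarrow> real ^ 'p ^ 'p" where
  "H_mat n Z A \<theta> \<gamma> =
     (let W = inverse_upto (2 * n - 1)
                (\<lambda>r s. partial_theta (\<lambda>\<theta>'. score_F n Z A \<theta>' \<gamma> r) \<theta> s)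
      in \<chi> k l.
           partial_gamma (\<lambda>\<gamma>'. score_Q n Z A \<theta> \<gamma>' $ k) \<gamma> l
           - (\<Sum>r=1..2 * n - 1. \<Sum>s=1..2 * n - 1.
                partial_theta (\<lambda>\<theta>'. score_Q n Z A \<theta>' \<gamma> $ k) \<theta> r * W r s *
                partial_gamma (\<lambda>\<gamma>'. score_F n Z A \<theta> \<gamma>' s) \<gamma> l))"

definition pos_def_mat :: "real ^ 'm ^ 'm \<Rightarrow> bool" where
  "pos_def_mat A \<longleftrightarrow> transpose A = A \<and> (\<forall>x. x \<noteq> 0 \<longrightarrow> x \<bullet> (A *v x) > 0)"

definition row_sum_norm :: "real ^ 'm ^ 'm \<Rightarrow> real" where
  "row_sum_norm A = (MAX i. \<Sum>j\<in>UNIV. \<bar>A $ i $ j\<bar>)"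

definition sup_ball :: "nat \<Rightarrow> (nat \<Rightarrow> real) \<Rightarrow> real \<Rightarrow> (nat \<Rightarrow> real) set" where
  "sup_ball N x e = {y. \<forall>i\<in>{1..N}. \<bar>x i - y i\<bar> \<le> e}"

definition covariate_bound :: "nat \<Rightarrow> (nat \<Rightarrow> nat \<Rightarrow> real ^ 'p) \<Rightarrow> real" where
  "covariate_bound n Z = (MAX (i, j)\<in>off_diag n. infnorm (Z i j))"

definition rho ::
  "nat \<Rightarrow> (nat \<Rightarrow> nat \<Rightarrow> real ^ 'p) \<Rightarrow> (nat \<Rightarrow> real) \<Rightarrow> real ^ 'p \<Rightarrow> real \<Rightarrow> real \<Rightarrow> real" where
  "rho n Z \<theta> \<gamma> e1 e2 =
     (MAX (i, j)\<in>off_diag n. \<bar>alpha_of \<theta> i + beta_of n \<theta> j\<bar>) + 2 * e1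
     + real CARD('p) * covariate_bound n Z * infnorm \<gamma>
     + real CARD('p) * covariate_bound n Z * e2"

definition u_entry ::
  "nat \<Rightarrow> (nat \<Rightarrow> nat \<Rightarrow> real ^ 'p) \<Rightarrow> (nat \<Rightarrow> real) \<Rightarrow> real ^ 'p \<Rightarrow> nat \<Rightarrow> nat \<Rightarrow> real" where
  "u_entry n Z \<theta> \<gamma> i j = (if i = j then 0 else rate n Z \<theta> \<gamma> i j)"

definition S_entry ::
  "nat \<Rightarrow> (nat \<Rightarrow> nat \<Rightarrow> real ^ 'p) \<Rightarrow> (nat \<Rightarrow> real) \<Rightarrow> real ^ 'p \<Rightarrow> nat \<Rightarrow> nat \<Rightarrow> real" where
  "S_entry n Z \<theta> \<gamma> i j =
     (let row = (\<lambda>r. \<Sum>c=1..n. u_entry n Z \<theta> \<gamma> r c);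
          col = (\<lambda>c. \<Sum>r=1..n. u_entry n Z \<theta> \<gamma> r c)
      in if i \<le> n \<and> j \<le> n then of_bool (i = j) / row i + 1 / col n
         else if i \<le> n \<or> j \<le> n then - 1 / col n
         else of_bool (i = j) / col (j - n) + 1 / col n)"

text \<open>\<open>A\<^sup>-\<^sup>1\<^sup>/\<^sup>2\<close>: the positive definite square root of \<open>A\<^sup>-\<^sup>1\<close>, which exists and is unique for positive
  definite \<open>A\<close>.\<close>

definition inv_sqrt_mat :: "real ^ 'm ^ 'm \<Rightarrow> real ^ 'm ^ 'm" where
  "inv_sqrt_mat A = (SOME R. pos_def_mat R \<and> R ** R = matrix_inv A)"

definition std_normal_vec :: "(real ^ 'm) measure" where
  "std_normal_vec = density lborel (\<lambda>x. ennreal (\<Prod>i\<in>UNIV. std_normal_density (x $ i)))"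

text \<open>Convergence in distribution, tested against bounded continuous functions; the random
  vectors may live on different probability spaces.\<close>

definition converges_in_distribution ::
  "(nat \<Rightarrow> 'w measure) \<Rightarrow> (nat \<Rightarrow> 'w \<Rightarrow> real ^ 'm) \<Rightarrow> (real ^ 'm) measure \<Rightarrow> bool" where
  "converges_in_distribution M X \<nu> \<longleftrightarrow>
     (\<forall>f :: real ^ 'm \<Rightarrow> real. continuous_on UNIV f \<and> bounded (range f) \<longrightarrow>
        (\<lambda>n. integral\<^sup>L (distr (M n) borel (X n)) f) \<longlonglongrightarrow> integral\<^sup>L \<nu> f)"

definition asymptotically_normal ::
  "(nat \<Rightarrow> 'w measure) \<Rightarrow> (nat \<Rightarrow> 'w \<Rightarrow> real ^ 'm) \<Rightarrow> (nat \<Rightarrow> real ^ 'm ^ 'm) \<Rightarrow> bool" where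
  "asymptotically_normal M X \<Sigma> \<longleftrightarrow>
     (\<forall>\<^sub>F n in sequentially. pos_def_mat (\<Sigma> n)) \<and>
     converges_in_distribution M (\<lambda>n \<omega>. inv_sqrt_mat (\<Sigma> n) *v X n \<omega>) std_normal_vec"

end

theory Submission
  imports Defs "HOL-Real_Asymp.Real_Asymp"
begin

text \<open>
  Let \<open>w\<^sub>i\<^sub>j\<close> be the true rates, which lie between \<open>e\<^sup>-\<^sup>\<rho>\<close> and \<open>e\<^sup>\<rho>\<close>, and let
  \<open>\<xi>\<^sub>i\<^sub>j = a\<^sub>i\<^sub>j - w\<^sub>i\<^sub>j\<close> be the noise. A change of parameters moves the linear predictors by
  \<open>t\<^sub>i\<^sub>j = x\<^sub>i + y\<^sub>j + Z\<^sub>i\<^sub>j \<bullet> g\<close>, and the scores vanish iff \<open>w e\<^sup>t - w - \<xi>\<close> is orthogonal to the design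
  and to the covariates. As \<open>e\<^sup>t = 1 + t + O(t\<^sup>2)\<close>, the MLE is a perturbation of a weighted
  least squares problem, and its errors are Gaussian because the leading term is linear in the
  independent Poisson noise.

  The linear problem is solved by block elimination (\<open>linear_solution\<close>). The covariates are replaced
  by their residuals after weighted regression on the design, and the equation for \<open>g\<close> has the matrix
  \<open>H\<close>, whose inverse is controlled by \<open>\<kappa> / n\<^sup>2\<close>. For the equations in \<open>(x, y)\<close> the key is a maximum
  principle (\<open>bipartite_max_principle\<close>): if all row and column sums of \<open>w\<^sub>i\<^sub>j (x\<^sub>i + y\<^sub>j)\<close> are at most
  \<open>B\<close>, then all \<open>\<bar>x\<^sub>i + y\<^sub>j\<bar>\<close> are at most a constant times \<open>e\<^sup>3\<^sup>\<rho> B / n\<close>. Both bounds together make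
  \<open>t \<mapsto> L (\<xi> - w (e\<^sup>t - 1 - t))\<close>, with \<open>L\<close> the linear solution operator, a contraction on a small
  sup-norm ball (\<open>score_solution\<close>). So the MLE exists on an event of probability tending to \<open>1\<close>
  (\<open>good_event\<close>), and by convexity it is unique (\<open>mle_unique\<close>).

  The same estimates give the expansion \<open>\<alpha>\<^sub>i - \<alpha>\<^sub>i\<^sup>* = \<xi>\<^sub>i\<^sub>. / u\<^sub>i\<^sub>. + \<xi>\<^sub>.\<^sub>n / u\<^sub>.\<^sub>n +\<close> error, where
  \<open>\<xi>\<^sub>i\<^sub>.\<close> and \<open>\<xi>\<^sub>.\<^sub>n\<close> are row and column sums of the noise. Inserting the leading term, which is \<open>S\<close>
  applied to the noise of the degrees, into the normal equations leaves averages of the noise over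
  \<open>n\<close> rows or columns, and these are negligible. So are the quadratic remainder and the contribution of \<open>g\<close>:
  after normalisation every error is at most a constant times \<open>\<kappa> e\<^sup>2\<^sup>3\<^sup>\<rho> log n / n\<^sup>1\<^sup>/\<^sup>2\<close>
  (\<open>rate_bounds\<close>). To turn a power of \<open>e\<^sup>\<rho>\<close> without the factor \<open>\<kappa>\<close> into such a bound, it is used that
  \<open>\<kappa> e\<^sup>\<rho>\<close> is bounded below (\<open>inverse_bound_lower\<close>).

  The characteristic function of a weighted sum of independent centred Poisson variables is explicit
  and tends to the Gaussian one when the weights are small (\<open>poisson_family_char_approx\<close>). With the
  direction \<open>s = \<Sigma>\<^sup>-\<^sup>1\<^sup>/\<^sup>2 t\<close>, where \<open>\<Sigma>\<close> is the leading block of \<open>S\<close>, the limiting variance is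
  \<open>s \<bullet> \<Sigma> s = t \<bullet> t\<close>. A continuity theorem in several dimensions
  (\<open>levy_continuity_std_normal_vec\<close>) concludes.
\<close>

section \<open>A continuity theorem for Gaussian limits in several dimensions\<close>

inductive trig_polynomial :: "('a::real_inner \<Rightarrow> complex) \<Rightarrow> bool" where
  monomial: "trig_polynomial (\<lambda>x. c * iexp (t \<bullet> x))"
| add: "trig_polynomial f \<Longrightarrow> trig_polynomial g \<Longrightarrow> trig_polynomial (\<lambda>x. f x + g x)"

lemma trig_polynomial_const: "trig_polynomial (\<lambda>x. c)"
  using trig_polynomial.monomial[of c 0] by simp

lemma trig_polynomial_mult:
  assumes "trig_polynomial f" "trig_polynomial g"
  shows "trig_polynomial (\<lambda>x. f x * g x)"
  using assms(1)
proof induction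
  case (monomial c s)
  show ?case
    using assms(2)
  proof induction
    case (monomial d t)
    have "(\<lambda>x. c * iexp (s \<bullet> x) * (d * iexp (t \<bullet> x))) = (\<lambda>x. (c * d) * iexp ((s + t) \<bullet> x))"
      by (auto simp: fun_eq_iff inner_add_left exp_add algebra_simps)
    then show ?case using trig_polynomial.monomial[of "c * d" "s + t"] by simp
  next
    case (add f g)
    then show ?case using trig_polynomial.add by (simp add: distrib_left)
  qed
next
  case (add f g)
  then show ?case using trig_polynomial.add by (simp add: distrib_right)
qed

lemma trig_polynomial_sum:
  assumes "finite I" "\<And>i. i \<in> I \<Longrightarrow> trig_polynomial (f i)"
  shows "trig_polynomial (\<lambda>x. \<Sum>i\<in>I. f i x)"
  using assms
  by (induction I rule: finite_induct) (auto intro: trig_polynomial_const trig_polynomial.add)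

lemma trig_polynomial_sin:
  "trig_polynomial (\<lambda>x::real^'m. complex_of_real (sin (a * x $ i)))"
proof -
  have "trig_polynomial (\<lambda>x::real^'m. (1 / (2 * \<i>)) * iexp (axis i a \<bullet> x)
          + (- 1 / (2 * \<i>)) * iexp (axis i (- a) \<bullet> x))"
    by (intro trig_polynomial.intros)
  moreover have "(1 / (2 * \<i>)) * iexp (axis i a \<bullet> x) + (- 1 / (2 * \<i>)) * iexp (axis i (- a) \<bullet> x)
      = complex_of_real (sin (a * x $ i))" for x :: "real^'m"
    unfolding sin_of_real[symmetric] sin_exp_eq
    by (simp add: inner_axis' field_simps)
  ultimately show ?thesis by simp
qed

text \<open>
  Substituting \<open>sin (a x\<^sub>i)\<close> for the variables turns polynomials into trigonometric polynomials. It
  links polynomial approximation on a cube with characteristic functions.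
\<close>
lemma trig_polynomial_of_polynomial:
  fixes p :: "real^'m \<Rightarrow> real"
  assumes "real_polynomial_function p"
  shows "trig_polynomial (\<lambda>x. complex_of_real (p (\<chi> i. sin (a * x $ i))))"
  using assms
proof induction
  case (linear f)
  have eq: "f y = (\<Sum>i\<in>UNIV. f (axis i 1) * y $ i)" for y
  proof -
    have "f y = f (\<Sum>i\<in>UNIV. y $ i *\<^sub>R axis i 1)"
      by (simp add: basis_expansion flip: scalar_mult_eq_scaleR)
    also have "\<dots> = (\<Sum>i\<in>UNIV. y $ i * f (axis i 1))"
      by (simp add: linear_sum linear_scale bounded_linear.linear[OF linear])
    finally show ?thesis by (simp add: mult.commute)
  qed
  show ?case
    by (subst eq) (auto intro!: trig_polynomial_sum trig_polynomial_mult trig_polynomial_const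
        trig_polynomial_sin simp del: sin_of_real)
next
  case (const c)
  show ?case by (rule trig_polynomial_const)
next
  case (add f g)
  then show ?case using trig_polynomial.add by simp
next
  case (mult f g)
  then show ?case using trig_polynomial_mult by simp
qed

lemma trig_polynomial_bounded_continuous:
  assumes "trig_polynomial (g :: 'a::euclidean_space \<Rightarrow> complex)"
  shows "continuous_on UNIV g" "\<exists>B. \<forall>x. norm (g x) \<le> B"
proof -
  show "continuous_on UNIV g"
    using assms by induction (auto intro!: continuous_intros)
  show "\<exists>B. \<forall>x. norm (g x) \<le> B"
    using assms
  proof induction
    case (monomial c t)
    show ?case by (rule exI[of _ "norm c"]) (simp add: norm_mult)
  next
    case (add f g)
    then show ?case by (meson norm_triangle_mono)
  qed
qed

lemma integrable_bounded_continuous: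
  fixes f :: "'a::euclidean_space \<Rightarrow> 'b::{banach,second_countable_topology}"
  assumes "prob_space \<mu>" "sets \<mu> = sets borel" "continuous_on UNIV f" "\<And>x. norm (f x) \<le> B"
  shows "integrable \<mu> f"
proof -
  interpret prob_space \<mu> by fact
  have "f \<in> borel_measurable \<mu>"
    using borel_measurable_continuous_onI[OF assms(3)] assms(2) by (simp cong: measurable_cong_sets)
  then show ?thesis
    by (intro integrable_const_bound[of _ B]) (use assms(4) in auto)
qed

text \<open>
  Characteristic functions integrate the monomials, so their convergence passes to all
  trigonometric polynomials by linearity.
\<close>
lemma integral_trig_polynomial_tendsto:
  fixes \<mu> :: "nat \<Rightarrow> ('a::euclidean_space) measure"
  assumes \<mu>: "\<And>n. prob_space (\<mu> n)" "\<And>n. sets (\<mu> n) = sets borel"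
    and \<nu>: "prob_space \<nu>" "sets \<nu> = sets borel"
    and conv: "\<And>t. (\<lambda>n. \<integral>x. iexp (t \<bullet> x) \<partial>\<mu> n) \<longlonglongrightarrow> (\<integral>x. iexp (t \<bullet> x) \<partial>\<nu>)"
    and "trig_polynomial g"
  shows "(\<lambda>n. \<integral>x. g x \<partial>\<mu> n) \<longlonglongrightarrow> (\<integral>x. g x \<partial>\<nu>)"
  using assms(6)
proof induction
  case (monomial c t)
  show ?case using tendsto_mult_left[OF conv[of t], of c] by simp
next
  case (add f g)
  have int: "integrable \<mu>' h" if "trig_polynomial h" "prob_space \<mu>'" "sets \<mu>' = sets borel" for h :: "'a \<Rightarrow> complex" and \<mu>'
    using trig_polynomial_bounded_continuous[OF that(1)] integrable_bounded_continuous[OF that(2,3)]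
    by blast
  show ?case
    using tendsto_add[OF add.IH] by (simp add: int add.hyps \<mu> \<nu>)
qed

lemma integral_lborel_prod_vec:
  fixes f :: "'m::finite \<Rightarrow> real \<Rightarrow> complex"
  assumes "\<And>i. integrable lborel (f i)"
  shows "(LINT x|(lborel :: (real^'m) measure). (\<Prod>i\<in>UNIV. f i (x $ i))) = (\<Prod>i\<in>UNIV. LINT x|lborel. f i x)"
proof -
  interpret product_sigma_finite "\<lambda>_::real^'m. lborel :: real measure"
    by standard
  define ix where "ix b = (SOME i. b = axis i (1::real))" for b :: "real^'m"
  have ix[simp]: "ix (axis i 1) = i" for i :: 'm
    unfolding ix_def by (rule some_equality) (auto simp: axis_eq_axis)
  have bij: "bij_betw (\<lambda>i::'m. axis i (1::real)) UNIV Basis"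
    by (auto simp: bij_betw_def inj_on_def axis_eq_axis Basis_vec_def)
  have meas[measurable]: "f i \<in> borel_measurable borel" for i
    using borel_measurable_integrable[OF assms[of i]] by simp
  have comp: "(\<Sum>b\<in>Basis. h b *\<^sub>R b) $ i = h (axis i 1)" for h :: "real^'m \<Rightarrow> real" and i
    using inner_sum_left_Basis[of "axis i 1" h] by (simp add: cart_eq_inner_axis)
  have "(LINT x|(lborel :: (real^'m) measure). (\<Prod>i\<in>UNIV. f i (x $ i)))
      = (\<integral>h. (\<Prod>i\<in>UNIV. f i ((\<Sum>b\<in>Basis. h b *\<^sub>R b) $ i)) \<partial>(\<Pi>\<^sub>M b\<in>(Basis::(real^'m) set). lborel))"
    by (subst lborel_eq) (rule integral_distr; measurable)
  also have "\<dots> = (\<integral>h. (\<Prod>b\<in>(Basis::(real^'m) set). f (ix b) (h b)) \<partial>(\<Pi>\<^sub>M b\<in>(Basis::(real^'m) set). lborel))"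
    unfolding comp by (subst prod.reindex_bij_betw[OF bij, symmetric]) simp
  also have "\<dots> = (\<Prod>b\<in>(Basis::(real^'m) set). \<integral>x. f (ix b) x \<partial>lborel)"
    by (rule product_integral_prod) (use assms in auto)
  also have "\<dots> = (\<Prod>i\<in>UNIV. \<integral>x. f i x \<partial>lborel)"
    by (subst prod.reindex_bij_betw[OF bij, symmetric]) simp
  finally show ?thesis .
qed

lemma std_normal_vec_integral:
  fixes t :: "real^'m"
  shows "(\<integral>x. iexp (t \<bullet> x) \<partial>std_normal_vec) = complex_of_real (exp (- (t \<bullet> t) / 2))"
proof -
  have char: "(\<integral>x. std_normal_density x *\<^sub>R iexp (s * x) \<partial>lborel) = complex_of_real (exp (- s\<^sup>2 / 2))" for s
    using fun_cong[OF char_std_normal_distribution, of s] unfolding char_def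
    by (subst (asm) integral_density) (auto simp: normal_density_nonneg)
  have int: "integrable lborel (\<lambda>x. std_normal_density x *\<^sub>R iexp (s * x))" for s
  proof -
    interpret prob_space std_normal_distribution by (rule prob_space_normal_density) simp
    have "integrable std_normal_distribution (\<lambda>x. iexp (s * x))"
      by (rule integrable_const_bound[of _ 1]) auto
    then show ?thesis
      by (subst (asm) integrable_density) (auto simp: normal_density_nonneg)
  qed
  have "(\<integral>x. iexp (t \<bullet> x) \<partial>std_normal_vec)
      = (LINT x|(lborel :: (real^'m) measure). (\<Prod>i\<in>UNIV. std_normal_density (x $ i)) *\<^sub>R iexp (t \<bullet> x))"
    unfolding std_normal_vec_def
    by (rule integral_density) (auto intro!: prod_nonneg simp: normal_density_nonneg)
  also have "\<dots> = (LINT x|(lborel :: (real^'m) measure). (\<Prod>i\<in>UNIV. std_normal_density (x $ i) *\<^sub>R iexp (t $ i * x $ i)))"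
    by (simp add: inner_vec_def exp_sum sum_distrib_left prod.distrib scaleR_conv_of_real)
  also have "\<dots> = (\<Prod>i\<in>UNIV. complex_of_real (exp (- (t $ i)\<^sup>2 / 2)))"
    by (subst integral_lborel_prod_vec[OF int]) (simp only: char)
  also have "\<dots> = complex_of_real (exp (\<Sum>i\<in>UNIV. - (t $ i)\<^sup>2 / 2))"
    by (simp add: exp_sum)
  also have "(\<Sum>i\<in>UNIV. - (t $ i)\<^sup>2 / 2) = - (t \<bullet> t) / 2"
    by (simp add: inner_vec_def power2_eq_square sum_negf sum_divide_distrib)
  finally show ?thesis .
qed

lemma prob_space_std_normal_vec: "prob_space (std_normal_vec :: (real^'m) measure)"
proof
  have "emeasure (std_normal_vec :: (real^'m) measure) (space std_normal_vec)
     = (\<integral>\<^sup>+x. ennreal (\<Prod>i\<in>UNIV. std_normal_density ((x::real^'m) $ i)) \<partial>lborel)"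
    by (simp add: std_normal_vec_def emeasure_density)
  also have "\<dots> = (\<integral>\<^sup>+x. (\<Prod>b\<in>Basis. ennreal (std_normal_density ((x::real^'m) \<bullet> b))) \<partial>lborel)"
  proof -
    have bij: "bij_betw (\<lambda>i::'m. axis i (1::real)) UNIV Basis"
      by (auto simp: bij_betw_def inj_on_def axis_eq_axis Basis_vec_def)
    show ?thesis
      by (simp add: prod_ennreal normal_density_nonneg cart_eq_inner_axis
          flip: prod.reindex_bij_betw[OF bij])
  qed
  also have "\<dots> = (\<Prod>b\<in>(Basis::(real^'m) set). \<integral>\<^sup>+x. ennreal (std_normal_density x) \<partial>lborel)"
    by (rule nn_integral_lborel_prod) auto
  also have "(\<integral>\<^sup>+x. ennreal (std_normal_density x) \<partial>lborel) = 1"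
    using prob_space.emeasure_space_1[OF prob_space_normal_density[of 1 0]]
    by (simp add: emeasure_density)
  finally show "emeasure (std_normal_vec :: (real^'m) measure) (space std_normal_vec) = 1" by simp
qed

text \<open>
  Tightness comes for free: on the multiples of a basis vector the characteristic function is that
  of the coordinate, and the one-dimensional continuity theorem applies to it.
\<close>
lemma coordinate_tail_tendsto:
  fixes \<mu> :: "nat \<Rightarrow> (real^'m) measure" and h :: "real \<Rightarrow> real"
  assumes \<mu>: "\<And>n. prob_space (\<mu> n)" "\<And>n. sets (\<mu> n) = sets borel"
    and conv: "\<And>t. (\<lambda>n. \<integral>x. iexp (t \<bullet> x) \<partial>\<mu> n) \<longlonglongrightarrow> complex_of_real (exp (- (t \<bullet> t) / 2))"
    and h: "continuous_on UNIV h" "\<And>x. \<bar>h x\<bar> \<le> B"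
  shows "(\<lambda>n. \<integral>x. h (x $ i) \<partial>\<mu> n) \<longlonglongrightarrow> integral\<^sup>L std_normal_distribution h"
proof -
  have [measurable]: "(\<lambda>x. x $ i) \<in> borel_measurable (\<mu> n)" for n
    using \<mu>(2)[of n] by (simp cong: measurable_cong_sets)
  have hm[measurable]: "h \<in> borel_measurable borel"
    by (rule borel_measurable_continuous_onI[OF h(1)])
  define D where "D n = distr (\<mu> n) borel (\<lambda>x. x $ i)" for n
  have D: "real_distribution (D n)" for n
    unfolding D_def by (intro prob_space.real_distribution_distr \<mu>) simp
  have "char (D n) s = (\<integral>x. iexp (axis i s \<bullet> x) \<partial>\<mu> n)" for n s
    unfolding char_def D_def by (subst integral_distr) (auto simp: inner_axis')
  then have "(\<lambda>n. char (D n) s) \<longlonglongrightarrow> char std_normal_distribution s" for s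
    using conv[of "axis i s"]
    by (simp add: char_std_normal_distribution inner_axis_axis power2_eq_square)
  then have "weak_conv_m D std_normal_distribution"
    by (intro levy_continuity D real_dist_normal_dist)
  then have "(\<lambda>n. integral\<^sup>L (D n) h) \<longlonglongrightarrow> integral\<^sup>L std_normal_distribution h"
    by (rule weak_conv_imp_integral_bdd_continuous_conv[OF D real_dist_normal_dist, where B = B])
      (use h in \<open>auto simp: continuous_on_eq_continuous_at\<close>)
  then show ?thesis
    unfolding D_def by (subst (asm) integral_distr) auto
qed

text \<open>
  A continuous substitute for the indicator of \<open>{x. L < \<bar>x\<bar>}\<close>, so that weak convergence of the
  coordinates applies to it directly.
\<close>
definition tail_bump :: "real \<Rightarrow> real \<Rightarrow> real" where
  "tail_bump L x = min 1 (max 0 (\<bar>x\<bar> - L))"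

lemma tail_bump_bounds: "0 \<le> tail_bump L x" "tail_bump L x \<le> 1" "\<bar>tail_bump L x\<bar> \<le> 1"
  by (auto simp: tail_bump_def)

lemma continuous_tail_bump: "continuous_on S (tail_bump L)"
  unfolding tail_bump_def by (intro continuous_intros)

lemma tail_bump_eq_1: "L + 1 \<le> \<bar>x\<bar> \<Longrightarrow> tail_bump L x = 1"
  by (auto simp: tail_bump_def)

lemma std_normal_tail_bump_tendsto:
  "(\<lambda>L. integral\<^sup>L std_normal_distribution (tail_bump (real L))) \<longlonglongrightarrow> 0"
proof -
  interpret prob_space std_normal_distribution by (rule prob_space_normal_density) simp
  have [measurable]: "tail_bump L \<in> borel_measurable borel" for L
    by (rule borel_measurable_continuous_onI[OF continuous_tail_bump])
  have "(\<lambda>L. integral\<^sup>L std_normal_distribution (tail_bump (real L)))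
      \<longlonglongrightarrow> integral\<^sup>L std_normal_distribution (\<lambda>_. 0)"
  proof (rule integral_dominated_convergence[where w = "\<lambda>_. 1"])
    show "AE x in std_normal_distribution. (\<lambda>L. tail_bump (real L) x) \<longlonglongrightarrow> 0"
    proof (rule AE_I2)
      fix x :: real
      have "\<forall>\<^sub>F L in sequentially. tail_bump (real L) x = 0"
        using eventually_ge_at_top[of "nat \<lceil>\<bar>x\<bar>\<rceil>"]
        by eventually_elim (auto simp: tail_bump_def)
      then show "(\<lambda>L. tail_bump (real L) x) \<longlonglongrightarrow> 0" by (rule tendsto_eventually)
    qed
  qed (auto simp: tail_bump_bounds)
  then show ?thesis by simp
qed

text \<open>
  Why a trigonometric polynomial can be close to \<open>f\<close> on a box and still bounded everywhere: it is
  built as a polynomial in the values \<open>sin (a x\<^sub>i)\<close>. These always lie in a cube, so the polynomial has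
  to be controlled only there, and on the box the sines are inverted by \<open>arcsin\<close>.
\<close>
lemma trig_polynomial_approximation:
  fixes f :: "real^'m \<Rightarrow> real"
  assumes f: "continuous_on UNIV f" "\<And>x. \<bar>f x\<bar> \<le> B" and "0 < e" "0 < K"
  obtains g where "trig_polynomial (\<lambda>x. complex_of_real (g x))" "\<And>x. \<bar>g x\<bar> \<le> B + e"
    "\<And>x. (\<And>i. \<bar>x $ i\<bar> \<le> K) \<Longrightarrow> \<bar>f x - g x\<bar> \<le> e"
proof -
  define a where "a = pi / (2 * K)"
  have a: "0 < a" "a * K = pi / 2" using \<open>0 < K\<close> by (auto simp: a_def)
  define C :: "(real^'m) set" where "C = cbox (\<chi> i. -1) (\<chi> i. 1)"
  have C: "y \<in> C \<longleftrightarrow> (\<forall>i. \<bar>y $ i\<bar> \<le> 1)" for y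
    by (auto simp: C_def mem_box_cart abs_le_iff minus_le_iff)
  \<comment> \<open>\<open>f\<close> in the coordinates \<open>y\<^sub>i = sin (a x\<^sub>i)\<close>, where \<open>\<bar>a x\<^sub>i\<bar> \<le> pi / 2\<close>\<close>
  define F where "F y = f (\<chi> i. arcsin (y $ i) / a)" for y :: "real^'m"
  have "continuous_on C F"
    unfolding F_def
  proof (rule continuous_on_compose2[OF f(1)])
    show "continuous_on C (\<lambda>y. \<chi> i. arcsin (y $ i) / a)"
      using a by (intro continuous_on_vec_lambda continuous_intros continuous_on_arcsin')
        (auto simp: C abs_le_iff minus_le_iff)
  qed auto
  then obtain p where p: "real_polynomial_function p" "\<And>y. y \<in> C \<Longrightarrow> \<bar>F y - p y\<bar> < e"
    using Stone_Weierstrass_real_polynomial_function[of C F e] \<open>0 < e\<close> by (auto simp: C_def)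
  define g where "g x = p (\<chi> i. sin (a * x $ i))" for x
  have inC: "(\<chi> i. sin (a * x $ i)) \<in> C" for x :: "real^'m"
    by (auto simp: C)
  show thesis
  proof (rule that[of g])
    show "trig_polynomial (\<lambda>x. complex_of_real (g x))"
      unfolding g_def by (rule trig_polynomial_of_polynomial[OF p(1)])
    show "\<bar>g x\<bar> \<le> B + e" for x
      using p(2)[OF inC[of x]] f(2)[of "\<chi> i. arcsin ((\<chi> i. sin (a * x $ i)) $ i) / a"]
      unfolding g_def F_def by linarith
    show "\<bar>f x - g x\<bar> \<le> e" if "\<And>i. \<bar>x $ i\<bar> \<le> K" for x
    proof -
      have "arcsin (sin (a * x $ i)) / a = x $ i" for i
      proof -
        have "\<bar>a * x $ i\<bar> \<le> pi / 2"
          using that[of i] a by (metis abs_mult abs_of_pos mult_le_cancel_left_pos)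
        then have "arcsin (sin (a * x $ i)) = a * x $ i"
          by (intro arcsin_sin) auto
        then show ?thesis using a by simp
      qed
      then have "F (\<chi> i. sin (a * x $ i)) = f x"
        unfolding F_def by simp
      then show ?thesis using p(2)[OF inC[of x]] unfolding g_def by simp
    qed
  qed
qed

text \<open>
  The continuity theorem in several dimensions for the Gaussian limit. A bounded continuous \<open>f\<close>
  differs from a suitable trigonometric polynomial by little on a large box and by a bounded amount
  off the box. The tail functions of the coordinates dominate the second error, uniformly in \<open>n\<close>, by
  convergence of the marginals.
\<close>
theorem levy_continuity_std_normal_vec:
  fixes \<mu> :: "nat \<Rightarrow> (real^'m) measure" and f :: "real^'m \<Rightarrow> real"
  assumes \<mu>: "\<And>n. prob_space (\<mu> n)" "\<And>n. sets (\<mu> n) = sets borel"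
    and conv: "\<And>t. (\<lambda>n. \<integral>x. iexp (t \<bullet> x) \<partial>\<mu> n) \<longlonglongrightarrow> complex_of_real (exp (- (t \<bullet> t) / 2))"
    and f: "continuous_on UNIV f" "bounded (range f)"
  shows "(\<lambda>n. integral\<^sup>L (\<mu> n) f) \<longlonglongrightarrow> integral\<^sup>L std_normal_vec f"
proof (rule LIMSEQ_I)
  fix r :: real assume "0 < r"
  let ?\<nu> = "std_normal_vec :: (real^'m) measure"
  have \<nu>: "prob_space ?\<nu>" "sets ?\<nu> = sets borel"
    by (rule prob_space_std_normal_vec) (simp add: std_normal_vec_def)
  obtain B where "\<And>x. norm (f x) \<le> B" using f(2) by (auto simp: bounded_iff)
  then have B: "\<bar>f x\<bar> \<le> B" for x by simp
  have "0 \<le> B" using B[of 0] by linarith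
  define e where "e = min 1 (r / 8)"
  have e: "0 < e" "e \<le> 1" "8 * e \<le> r" using \<open>0 < r\<close> by (auto simp: e_def)
  define d where "d = e / (real CARD('m) * (2 * B + 1))"
  have d: "0 < d" "real CARD('m) * (2 * B + 1) * d = e"
    using e \<open>0 \<le> B\<close> by (auto simp: d_def add_nonneg_pos)
  obtain L where L: "integral\<^sup>L std_normal_distribution (tail_bump (real L)) < d"
    using order_tendstoD(2)[OF std_normal_tail_bump_tendsto d(1)]
    by (auto simp: eventually_sequentially)
  obtain g where g: "trig_polynomial (\<lambda>x. complex_of_real (g x))" "\<And>x. \<bar>g x\<bar> \<le> B + e"
    "\<And>x. (\<And>i. \<bar>x $ i\<bar> \<le> real L + 1) \<Longrightarrow> \<bar>f x - g x\<bar> \<le> e"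
    using trig_polynomial_approximation[OF f(1) B e(1), of "real L + 1"] by (metis add_nonneg_pos of_nat_0_le_iff zero_less_one)
  have g_cont: "continuous_on UNIV g"
    using continuous_on_Re[OF trig_polynomial_bounded_continuous(1)[OF g(1)]] by simp
  define T where "T x = (\<Sum>i\<in>UNIV. tail_bump (real L) (x $ i))" for x :: "real^'m"
  have T_cont: "continuous_on UNIV (\<lambda>x::real^'m. tail_bump (real L) (x $ i))" for i
    by (rule continuous_on_compose2[OF continuous_tail_bump[of UNIV]]) (auto intro!: continuous_intros)
  have pointwise: "\<bar>f x - g x\<bar> \<le> e + (2 * B + 1) * T x" for x
  proof (cases "\<forall>i. \<bar>x $ i\<bar> \<le> real L + 1")
    case True
    then show ?thesis using g(3)[of x] \<open>0 \<le> B\<close>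
      by (auto simp: T_def intro!: add_increasing2 mult_nonneg_nonneg sum_nonneg tail_bump_bounds)
  next
    case False
    then obtain i where "real L + 1 \<le> \<bar>x $ i\<bar>" by (metis linear)
    then have "tail_bump (real L) (x $ i) = 1" by (rule tail_bump_eq_1)
    then have "1 \<le> T x"
      unfolding T_def using member_le_sum[of i UNIV "\<lambda>i. tail_bump (real L) (x $ i)"]
      by (auto simp: tail_bump_bounds)
    then have "2 * B + 1 \<le> (2 * B + 1) * T x" using \<open>0 \<le> B\<close> by (simp add: mult_le_cancel_left1)
    moreover have "\<bar>f x - g x\<bar> \<le> 2 * B + e" using B[of x] g(2)[of x] by linarith
    ultimately show ?thesis using e by linarith
  qed
  \<comment> \<open>the same estimate serves the approximating measures and, as a constant sequence, the limit\<close>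
  have approx: "\<bar>integral\<^sup>L M f - integral\<^sup>L M g\<bar>
      \<le> e + (2 * B + 1) * (\<Sum>i\<in>UNIV. \<integral>x. tail_bump (real L) (x $ i) \<partial>M)"
    if M: "prob_space M" "sets M = sets borel" for M
  proof -
    interpret prob_space M by fact
    note [simp] = integrable_bounded_continuous[OF M f(1), of B] integrable_bounded_continuous[OF M g_cont, of "B + e"]
      integrable_bounded_continuous[OF M T_cont, where B = 1]
    have [simp]: "integrable M f" "integrable M g" "integrable M (\<lambda>x. tail_bump (real L) (x $ i))" for i
      using B g(2) by (auto simp: tail_bump_bounds)
    have [simp]: "integrable M T" unfolding T_def by simp
    have "\<bar>integral\<^sup>L M f - integral\<^sup>L M g\<bar> = \<bar>\<integral>x. f x - g x \<partial>M\<bar>" by simp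
    also have "\<dots> \<le> (\<integral>x. \<bar>f x - g x\<bar> \<partial>M)" by (rule integral_abs_bound)
    also have "\<dots> \<le> (\<integral>x. e + (2 * B + 1) * T x \<partial>M)"
      by (rule integral_mono) (use pointwise in auto)
    also have "\<dots> = e + (2 * B + 1) * (\<integral>x. T x \<partial>M)" by (simp add: prob_space)
    also have "(\<integral>x. T x \<partial>M) = (\<Sum>i\<in>UNIV. \<integral>x. tail_bump (real L) (x $ i) \<partial>M)"
      unfolding T_def by (simp add: integral_sum)
    finally show ?thesis .
  qed
  have small: "(\<lambda>n. e + (2 * B + 1) * (\<Sum>i\<in>UNIV. \<integral>x. tail_bump (real L) (x $ i) \<partial>\<mu>' n))
      \<longlonglongrightarrow> e + (2 * B + 1) * (\<Sum>i\<in>(UNIV::'m set). integral\<^sup>L std_normal_distribution (tail_bump (real L)))"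
    if "\<And>n. prob_space (\<mu>' n)" "\<And>n. sets (\<mu>' n) = sets borel"
      "\<And>t. (\<lambda>n. \<integral>x. iexp (t \<bullet> x) \<partial>\<mu>' n) \<longlonglongrightarrow> complex_of_real (exp (- (t \<bullet> t) / 2))"
    for \<mu>' :: "nat \<Rightarrow> (real^'m) measure"
    by (intro tendsto_intros coordinate_tail_tendsto[OF that continuous_tail_bump]) (rule tail_bump_bounds)
  have lim_small: "e + (2 * B + 1) * (\<Sum>i\<in>(UNIV::'m set). integral\<^sup>L std_normal_distribution (tail_bump (real L))) < 2 * e"
  proof -
    have "(2 * B + 1) * (\<Sum>i\<in>(UNIV::'m set). integral\<^sup>L std_normal_distribution (tail_bump (real L)))
        < (2 * B + 1) * (\<Sum>i\<in>(UNIV::'m set). d)"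
      using L \<open>0 \<le> B\<close> by (intro mult_strict_left_mono) auto
    also have "\<dots> = e" using d by (simp add: algebra_simps)
    finally show ?thesis by simp
  qed
  have ev: "\<forall>\<^sub>F n in sequentially. \<bar>integral\<^sup>L (\<mu>' n) f - integral\<^sup>L (\<mu>' n) g\<bar> < 2 * e"
    if "\<And>n. prob_space (\<mu>' n)" "\<And>n. sets (\<mu>' n) = sets borel"
      "\<And>t. (\<lambda>n. \<integral>x. iexp (t \<bullet> x) \<partial>\<mu>' n) \<longlonglongrightarrow> complex_of_real (exp (- (t \<bullet> t) / 2))"
    for \<mu>' :: "nat \<Rightarrow> (real^'m) measure"
    using order_tendstoD(2)[OF small[OF that] lim_small]
    by eventually_elim (rule le_less_trans[OF approx[OF that(1,2)]])
  have 1: "\<forall>\<^sub>F n in sequentially. \<bar>integral\<^sup>L (\<mu> n) f - integral\<^sup>L (\<mu> n) g\<bar> < 2 * e"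
    by (rule ev[OF \<mu> conv])
  have 2: "\<bar>integral\<^sup>L ?\<nu> f - integral\<^sup>L ?\<nu> g\<bar> < 2 * e"
    using ev[of "\<lambda>_. ?\<nu>"] \<nu> by (simp add: std_normal_vec_integral)
  have "(\<lambda>n. \<integral>x. complex_of_real (g x) \<partial>\<mu> n) \<longlonglongrightarrow> (\<integral>x. complex_of_real (g x) \<partial>?\<nu>)"
    by (rule integral_trig_polynomial_tendsto[OF \<mu> \<nu> _ g(1)]) (use conv in \<open>simp add: std_normal_vec_integral\<close>)
  then have "(\<lambda>n. integral\<^sup>L (\<mu> n) g) \<longlonglongrightarrow> integral\<^sup>L ?\<nu> g"
    by (simp add: tendsto_of_real_iff)
  then have 3: "\<forall>\<^sub>F n in sequentially. \<bar>integral\<^sup>L (\<mu> n) g - integral\<^sup>L ?\<nu> g\<bar> < e"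
    by (auto dest!: tendstoD[OF _ e(1)] simp: dist_real_def)
  have "\<forall>\<^sub>F n in sequentially. norm (integral\<^sup>L (\<mu> n) f - integral\<^sup>L ?\<nu> f) < r"
    using 1 3 by eventually_elim (use 2 e in \<open>simp add: real_norm_def\<close>)
  then show "\<exists>no. \<forall>n\<ge>no. norm (integral\<^sup>L (\<mu> n) f - integral\<^sup>L ?\<nu> f) < r"
    by (simp add: eventually_sequentially)
qed

section \<open>Inverse square roots of positive definite matrices\<close>

lemma linear_below_quadratic_imp_zero:
  fixes b c :: real
  assumes "\<And>t. 2 * t * b \<le> t\<^sup>2 * c"
  shows "b = 0"
proof -
  define k where "k = \<bar>c\<bar> + 1"
  have k: "0 < k" "c < 2 * k" by (auto simp: k_def abs_if)
  have "2 * (b / k) * b \<le> (b / k)\<^sup>2 * c" by (rule assms)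
  then have "b\<^sup>2 * (2 * k) \<le> b\<^sup>2 * c" using k by (simp add: field_simps power2_eq_square)
  show ?thesis
  proof (rule ccontr)
    assume "b \<noteq> 0"
    then have "b\<^sup>2 * c < b\<^sup>2 * (2 * k)" using k by simp
    with \<open>b\<^sup>2 * (2 * k) \<le> b\<^sup>2 * c\<close> show False by simp
  qed
qed

text \<open>
  A maximiser of the Rayleigh quotient on the unit sphere of an invariant subspace is an
  eigenvector: perturbing it by \<open>t *\<^sub>R w\<close> with \<open>w\<close> orthogonal to it gives a linear term in \<open>t\<close> that is
  at most quadratic in \<open>t\<close>, so the linear term vanishes.
\<close>
lemma self_adjoint_eigenvector:
  fixes f :: "'a::euclidean_space \<Rightarrow> 'a"
  assumes f: "linear f" "\<And>x y. f x \<bullet> y = x \<bullet> f y"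
    and S: "subspace S" "\<And>x. x \<in> S \<Longrightarrow> f x \<in> S" "\<exists>x\<in>S. x \<noteq> 0"
  obtains v \<mu> where "v \<in> S" "norm v = 1" "f v = \<mu> *\<^sub>R v"
proof -
  interpret linear f by fact
  let ?K = "sphere 0 1 \<inter> S"
  have "compact ?K" by (intro compact_Int_closed closed_subspace S) simp
  moreover have "?K \<noteq> {}"
  proof -
    obtain x where "x \<in> S" "x \<noteq> 0" using S by blast
    then have "(1 / norm x) *\<^sub>R x \<in> ?K" using S(1) by (auto simp: subspace_scale)
    then show ?thesis by blast
  qed
  moreover have "continuous_on ?K (\<lambda>x. x \<bullet> f x)"
    by (intro continuous_on_inner continuous_on_id linear_continuous_on
        f(1)[unfolded linear_conv_bounded_linear])
  ultimately have "\<exists>v\<in>?K. \<forall>x\<in>?K. x \<bullet> f x \<le> v \<bullet> f v"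
    by (rule continuous_attains_sup)
  then obtain v where v: "v \<in> ?K" and max: "\<And>x. x \<in> ?K \<Longrightarrow> x \<bullet> f x \<le> v \<bullet> f v"
    by blast
  define \<mu> where "\<mu> = v \<bullet> f v"
  have vv: "v \<bullet> v = 1" using v by (simp add: dot_square_norm)
  have quad: "x \<bullet> f x \<le> \<mu> * (x \<bullet> x)" if "x \<in> S" for x
  proof (cases "x = 0")
    case False
    then have "(1 / norm x) *\<^sub>R x \<in> ?K" using that S(1) by (auto simp: subspace_scale)
    from max[OF this] have "(x \<bullet> f x) / (norm x)\<^sup>2 \<le> \<mu>"
      by (simp add: \<mu>_def scale power2_eq_square)
    moreover have "0 < (norm x)\<^sup>2" using False by simp
    ultimately show ?thesis by (simp only: pos_divide_le_eq dot_square_norm)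
  qed (simp add: zero)
  have orth: "w \<bullet> f v = 0" if w: "w \<in> S" "w \<bullet> v = 0" for w
  proof (rule linear_below_quadratic_imp_zero)
    fix t :: real
    have "v + t *\<^sub>R w \<in> S" using v w S(1) by (auto intro: subspace_add subspace_scale)
    note q = quad[OF this]
    have "v \<bullet> f w = w \<bullet> f v" using f(2)[of w v] by (simp only: inner_commute[of v "f w"])
    moreover have "v \<bullet> w = 0" using w(2) by (simp only: inner_commute[of v w])
    ultimately have "(v + t *\<^sub>R w) \<bullet> f (v + t *\<^sub>R w) = \<mu> + 2 * t * (w \<bullet> f v) + t\<^sup>2 * (w \<bullet> f w)"
      and "(v + t *\<^sub>R w) \<bullet> (v + t *\<^sub>R w) = 1 + t\<^sup>2 * (w \<bullet> w)"
      using w(2) vv by (simp_all add: add scale inner_add_left inner_add_right \<mu>_def power2_eq_square algebra_simps)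
    with q have "\<mu> + 2 * t * (w \<bullet> f v) + t\<^sup>2 * (w \<bullet> f w) \<le> \<mu> * (1 + t\<^sup>2 * (w \<bullet> w))"
      by simp
    then show "2 * t * (w \<bullet> f v) \<le> t\<^sup>2 * (\<mu> * (w \<bullet> w) - w \<bullet> f w)"
      by (simp add: algebra_simps)
  qed
  define w where "w = f v - \<mu> *\<^sub>R v"
  have "w \<in> S" "w \<bullet> v = 0"
    using v S(1,2) vv by (auto simp: w_def \<mu>_def subspace_diff subspace_scale inner_diff_left inner_commute[of "f v"])
  with orth[of w] have "w \<bullet> w = 0" by (simp add: w_def inner_diff_right)
  then have "f v = \<mu> *\<^sub>R v" by (simp add: w_def)
  with v show thesis by (intro that[of v \<mu>]) auto
qed

text \<open>
  An orthonormal family of eigenvectors of maximal size spans the space: its orthogonal complement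
  is invariant and would contain a further eigenvector.
\<close>
lemma self_adjoint_eigenbasis:
  fixes f :: "'a::euclidean_space \<Rightarrow> 'a"
  assumes f: "linear f" "\<And>x y. f x \<bullet> y = x \<bullet> f y"
  obtains B \<mu> where "finite B" "\<And>u v. u \<in> B \<Longrightarrow> v \<in> B \<Longrightarrow> u \<bullet> v = of_bool (u = v)"
    "\<And>v. v \<in> B \<Longrightarrow> f v = \<mu> v *\<^sub>R v" "\<And>x. (\<Sum>v\<in>B. (v \<bullet> x) *\<^sub>R v) = x"
proof -
  define P where "P B \<longleftrightarrow> finite B \<and> (\<forall>u\<in>B. \<forall>v\<in>B. u \<bullet> v = of_bool (u = v)) \<and> (\<forall>v\<in>B. \<exists>\<mu>. f v = \<mu> *\<^sub>R v)" for B
  have bound: "card B \<le> DIM('a)" if "P B" for B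
  proof -
    have "pairwise orthogonal B" using that by (auto simp: P_def pairwise_def orthogonal_def)
    moreover have "0 \<notin> B"
    proof
      assume "0 \<in> B"
      then have "(0::'a) \<bullet> 0 = of_bool ((0::'a) = 0)" using that unfolding P_def by blast
      then show False by simp
    qed
    ultimately have "independent B" by (rule pairwise_orthogonal_independent)
    then show ?thesis using independent_bound by blast
  qed
  have "P {}" by (simp add: P_def)
  then obtain B where B: "P B" "\<And>C. P C \<Longrightarrow> card C \<le> card B"
    using ex_has_greatest_nat[of P "{}" card "DIM('a) + 1"] bound by (auto simp: less_Suc_eq_le)
  have ortho: "u \<bullet> v = of_bool (u = v)" if "u \<in> B" "v \<in> B" for u v using B that by (auto simp: P_def)
  have fin: "finite B" using B by (simp add: P_def)
  obtain \<mu> where \<mu>: "\<And>v. v \<in> B \<Longrightarrow> f v = \<mu> v *\<^sub>R v" using B unfolding P_def by metis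
  define S where "S = {x. \<forall>v\<in>B. v \<bullet> x = 0}"
  have sub: "subspace S" by (auto simp: S_def subspace_def inner_add_right)
  have inv: "f x \<in> S" if "x \<in> S" for x
    using that \<mu> by (auto simp: S_def f(2)[symmetric])
  have S0: "x = 0" if xS: "x \<in> S" for x
  proof (rule ccontr)
    assume "x \<noteq> 0"
    then obtain v m where v: "v \<in> S" "norm v = 1" "f v = m *\<^sub>R v"
      using self_adjoint_eigenvector[OF f sub inv] xS by blast
    have vv: "v \<bullet> v = 1" using v by (simp add: dot_square_norm)
    have "v \<notin> B" using v vv by (auto simp: S_def)
    moreover have "P (insert v B)"
      using B(1) v vv by (auto simp: P_def S_def inner_commute)
    ultimately show False using B(2)[of "insert v B"] fin by simp
  qed
  have exp: "(\<Sum>v\<in>B. (v \<bullet> x) *\<^sub>R v) = x" for x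
  proof -
    have "x - (\<Sum>v\<in>B. (v \<bullet> x) *\<^sub>R v) \<in> S"
      by (auto simp: S_def inner_diff_right inner_sum_right ortho fin of_bool_def if_distrib sum.delta cong: if_cong)
    from S0[OF this] show ?thesis by simp
  qed
  show thesis by (rule that[OF fin ortho \<mu> exp])
qed

lemma transpose_adjoint:
  fixes A :: "real^'m^'m"
  assumes "transpose A = A"
  shows "(A *v x) \<bullet> y = x \<bullet> (A *v y)"
  using dot_lmul_matrix[of x "transpose A" y] unfolding vector_transpose_matrix unfolding assms .

lemma matrix_inv_works:
  fixes A :: "real^'m^'m"
  assumes "invertible A"
  shows "A ** matrix_inv A = mat 1" "matrix_inv A ** A = mat 1"
  using someI_ex[OF assms[unfolded invertible_def]] by (auto simp: matrix_inv_def)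

lemma pos_def_mat_invertible:
  assumes "pos_def_mat A"
  shows "invertible A"
proof -
  have "x = 0" if "A *v x = 0" for x
    using assms that unfolding pos_def_mat_def by (metis inner_zero_right less_irrefl)
  then show ?thesis
    by (simp add: invertible_left_inverse matrix_left_invertible_ker)
qed

text \<open>
  The quadratic form is nonnegative at the sum and at the difference of two basis vectors.
\<close>
lemma pos_def_mat_entry_le:
  assumes "pos_def_mat A"
  shows "2 * \<bar>A $ k $ l\<bar> \<le> A $ k $ k + A $ l $ l"
proof -
  have sym: "A $ k $ l = A $ l $ k"
    using assms unfolding pos_def_mat_def by (metis transpose_def vec_lambda_beta)
  have nonneg: "0 \<le> x \<bullet> (A *v x)" for x
    using assms unfolding pos_def_mat_def by (cases "x = 0") (auto intro: less_imp_le)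
  have expand: "(axis k 1 + c *\<^sub>R axis l 1) \<bullet> (A *v (axis k 1 + c *\<^sub>R axis l 1))
      = A $ k $ k + c * (A $ k $ l + A $ l $ k) + c * c * A $ l $ l" for c
    by (simp add: matrix_vector_right_distrib matrix_vector_mult_scaleR matrix_vector_mult_basis
        inner_add_left inner_add_right inner_axis' column_def algebra_simps)
  show ?thesis
    using nonneg[of "axis k 1 + 1 *\<^sub>R axis l 1"] nonneg[of "axis k 1 + (- 1) *\<^sub>R axis l 1"]
    unfolding expand using sym by (simp add: abs_if)
qed

lemma pos_def_inverse_square_root_exists:
  fixes A :: "real^'m^'m"
  assumes "pos_def_mat A"
  shows "\<exists>R. pos_def_mat R \<and> R ** R = matrix_inv A"
proof -
  have A: "transpose A = A" "\<And>x. x \<noteq> 0 \<Longrightarrow> 0 < x \<bullet> (A *v x)" using assms by (auto simp: pos_def_mat_def)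
  have adj: "(A *v x) \<bullet> y = x \<bullet> (A *v y)" for x y
    by (rule transpose_adjoint[OF A(1)])
  obtain B \<mu> where B: "finite B" "\<And>u v. u \<in> B \<Longrightarrow> v \<in> B \<Longrightarrow> u \<bullet> v = of_bool (u = v)"
    "\<And>v. v \<in> B \<Longrightarrow> A *v v = \<mu> v *\<^sub>R v" "\<And>x. (\<Sum>v\<in>B. (v \<bullet> x) *\<^sub>R v) = x"
    using self_adjoint_eigenbasis[OF matrix_vector_mul_linear[of A] adj] by blast
  have \<mu>: "0 < \<mu> v" if "v \<in> B" for v
  proof -
    have "v \<noteq> 0" using B(2)[OF that that] by auto
    from A(2)[OF this] show ?thesis using B(2)[OF that that] B(3)[OF that] by simp
  qed
  define r where "r x = (\<Sum>v\<in>B. ((v \<bullet> x) / sqrt (\<mu> v)) *\<^sub>R v)" for x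
  have lin: "linear r"
    by (rule linearI) (auto simp: r_def inner_add_right add_divide_distrib scaleR_left_distrib sum.distrib scaleR_sum_right)
  define R where "R = matrix r"
  have R: "R *v x = r x" for x unfolding R_def by (rule fun_cong[OF matrix_vector_mul(2)[OF lin]])
  have vr: "v \<bullet> r x = (v \<bullet> x) / sqrt (\<mu> v)" if "v \<in> B" for v x
    using that by (simp add: r_def inner_sum_right B of_bool_def if_distrib sum.delta cong: if_cong)
  have sym: "x \<bullet> r y = r x \<bullet> y" for x y
    by (simp add: r_def inner_sum_right inner_sum_left inner_commute mult.commute)
  have "transpose R = R"
  proof -
    have "x \<bullet> (transpose R *v y) = x \<bullet> (R *v y)" for x y
      using dot_lmul_matrix[of x "transpose R" y] sym[of x y] by (simp add: vector_transpose_matrix R)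
    then have "transpose R *v y = R *v y" for y
      using vector_eq_ldot[of "transpose R *v y" "R *v y"] by blast
    then show ?thesis unfolding matrix_eq by blast
  qed
  moreover have "0 < x \<bullet> (R *v x)" if "x \<noteq> 0" for x
  proof -
    have "\<exists>v\<in>B. v \<bullet> x \<noteq> 0"
      using B(4)[of x] that by (metis (no_types, lifting) scale_eq_0_iff sum.neutral)
    then obtain v where v: "v \<in> B" "v \<bullet> x \<noteq> 0" by blast
    have eq: "x \<bullet> (R *v x) = (\<Sum>v\<in>B. (v \<bullet> x)\<^sup>2 / sqrt (\<mu> v))"
      by (simp add: R r_def inner_sum_right power2_eq_square inner_commute)
    have "0 < (v \<bullet> x)\<^sup>2 / sqrt (\<mu> v)" using v \<mu> by simp
    then show ?thesis unfolding eq using B(1) v(1) \<mu>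
      by (intro sum_pos2[of B v]) (auto simp: less_imp_le)
  qed
  moreover have "R ** R = matrix_inv A"
  proof -
    have "A *v (R *v (R *v x)) = x" for x
    proof -
      have "A *v (r (r x)) = (\<Sum>v\<in>B. ((v \<bullet> r x) / sqrt (\<mu> v)) *\<^sub>R (A *v v))"
        unfolding r_def[of "r x"] by (simp add: linear_sum linear_scale matrix_vector_mul_linear)
      also have "\<dots> = (\<Sum>v\<in>B. (v \<bullet> x) *\<^sub>R v)"
      proof (rule sum.cong[OF refl])
        fix v assume "v \<in> B"
        then show "((v \<bullet> r x) / sqrt (\<mu> v)) *\<^sub>R (A *v v) = (v \<bullet> x) *\<^sub>R v"
          using \<mu>[of v] by (simp add: vr B(3))
      qed
      finally show ?thesis by (simp add: R B(4))
    qed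
    then have "A ** (R ** R) = mat 1"
      by (simp add: matrix_eq flip: matrix_vector_mul_assoc)
    then have "(matrix_inv A ** A) ** (R ** R) = matrix_inv A"
      by (simp flip: matrix_mul_assoc)
    then show ?thesis by (simp add: matrix_inv_works(2)[OF pos_def_mat_invertible[OF assms]])
  qed
  ultimately show ?thesis unfolding pos_def_mat_def by blast
qed

text \<open>
  The two properties of \<open>A\<^sup>-\<^sup>1\<^sup>/\<^sup>2\<close> that enter the limit theorem. The second one turns the direction
  \<open>t\<close> of a characteristic function into a direction \<open>s\<close> in which the form of \<open>A\<close> has the fixed value
  \<open>t \<bullet> t\<close>.
\<close>
lemma inv_sqrt_mat_normalizes:
  assumes "pos_def_mat A"
  shows "transpose (inv_sqrt_mat A) = inv_sqrt_mat A"
    and "(inv_sqrt_mat A *v t) \<bullet> (A *v (inv_sqrt_mat A *v t)) = t \<bullet> t"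
proof -
  define R where "R = inv_sqrt_mat A"
  have R: "pos_def_mat R" "R ** R = matrix_inv A"
    using someI_ex[OF pos_def_inverse_square_root_exists[OF assms]] by (auto simp: R_def inv_sqrt_mat_def)
  show sym: "transpose (inv_sqrt_mat A) = inv_sqrt_mat A" using R(1) by (simp add: R_def pos_def_mat_def)
  have "A ** (R ** R) = mat 1"
    using matrix_inv_works(1)[OF pos_def_mat_invertible[OF assms]] R by simp
  then have "(A ** R) ** R = mat 1" by (simp add: matrix_mul_assoc)
  then have "R ** (A ** R) = mat 1" by (simp add: matrix_left_right_inverse)
  then have "R *v (A *v (R *v t)) = t"
    by (simp add: matrix_vector_mul_assoc)
  then show "(inv_sqrt_mat A *v t) \<bullet> (A *v (inv_sqrt_mat A *v t)) = t \<bullet> t"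
    using transpose_adjoint[OF sym, of t] unfolding R_def[symmetric] by simp
qed

section \<open>Weighted sums of independent Poisson variables\<close>

lemma abs_exp_taylor_le:
  fixes x :: real
  assumes "\<bar>x\<bar> \<le> 1"
  shows "\<bar>exp x - 1 - x\<bar> \<le> x\<^sup>2"
proof -
  have "exp x \<le> 1 + x + x\<^sup>2"
  proof (cases "0 \<le> x")
    case False
    define y where "y = - x"
    have y: "0 < y" "y \<le> 1" "x = - y" using False assms by (auto simp: y_def)
    have "exp (- y) * (1 + y + y\<^sup>2 / 2) \<le> exp (- y) * exp y"
      using exp_lower_Taylor_quadratic[of y] y by (intro mult_left_mono) auto
    also have "\<dots> \<le> (1 - y + y\<^sup>2) * (1 + y + y\<^sup>2 / 2)"
    proof -
      have "(1 - y + y\<^sup>2) * (1 + y + y\<^sup>2 / 2) = 1 + (y\<^sup>2 / 2 + y ^ 3 / 2 + y ^ 4 / 2)"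
        by (simp add: field_simps power2_eq_square power3_eq_cube power4_eq_xxxx)
      moreover have "0 \<le> y\<^sup>2 / 2 + y ^ 3 / 2 + y ^ 4 / 2" using y by simp
      ultimately show ?thesis by (simp flip: exp_add)
    qed
    finally have "exp (- y) \<le> 1 - y + y\<^sup>2"
      by (rule mult_right_le_imp_le) (use y in \<open>auto intro: add_pos_nonneg\<close>)
    then show ?thesis using y by simp
  qed (use assms exp_bound in auto)
  moreover have "1 + x \<le> exp x" by (rule exp_ge_add_one_self)
  ultimately show ?thesis by linarith
qed

lemma exp_taylor_lipschitz:
  fixes s t \<tau> :: real
  assumes "\<bar>s\<bar> \<le> \<tau>" "\<bar>t\<bar> \<le> \<tau>" "\<tau> \<le> 1"
  shows "\<bar>(exp s - 1 - s) - (exp t - 1 - t)\<bar> \<le> 2 * \<tau> * \<bar>s - t\<bar>"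
proof -
  have "norm ((exp s - 1 - s) - (exp t - 1 - t)) \<le> 2 * \<tau> * norm (s - t)"
  proof (rule field_differentiable_bound[of "{-\<tau>..\<tau>}" _ "\<lambda>x. exp x - 1"])
    fix x assume "x \<in> {-\<tau>..\<tau>}"
    then have x: "\<bar>x\<bar> \<le> \<tau>" by auto
    have "\<bar>x\<bar> * \<bar>x\<bar> \<le> \<tau> * 1" using x assms(3) by (intro mult_mono) auto
    then have "x\<^sup>2 \<le> \<tau>" by (simp add: power2_eq_square)
    then show "norm (exp x - 1) \<le> 2 * \<tau>"
      using abs_exp_taylor_le[of x] x assms(3) by auto
    show "((\<lambda>x. exp x - 1 - x) has_field_derivative exp x - 1) (at x within {-\<tau>..\<tau>})"
      by (auto intro!: derivative_eq_intros)
  qed (use assms in auto)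
  then show ?thesis by simp
qed

text \<open>
  With a complex exponent this covers the moment generating function and the characteristic function
  at once: the series is \<open>e\<^sup>-\<^sup>\<nu>\<close> times the exponential series at \<open>\<nu> e\<^sup>z\<close>.
\<close>
lemma poisson_exp_moment:
  assumes "0 < \<nu>"
  shows "integrable (measure_pmf (poisson_pmf \<nu>)) (\<lambda>k. exp (z * of_nat k) :: complex)"
    and "(\<integral>k. exp (z * of_nat k) \<partial>measure_pmf (poisson_pmf \<nu>)) = exp (complex_of_real \<nu> * (exp z - 1))"
proof -
  define g where "g k = complex_of_real (exp (- \<nu>)) * ((complex_of_real \<nu> * exp z) ^ k /\<^sub>R fact k)" for k
  have eq: "pmf (poisson_pmf \<nu>) k *\<^sub>R exp (z * of_nat k) = g k" for k
    using assms by (simp add: g_def exp_of_nat2_mult scaleR_conv_of_real power_mult_distrib field_simps)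
  have summ: "summable (\<lambda>k. norm (g k))"
    unfolding g_def norm_mult by (intro summable_mult summable_norm_exp)
  have "g sums (complex_of_real (exp (- \<nu>)) * exp (complex_of_real \<nu> * exp z))"
    unfolding g_def by (intro sums_mult exp_converges)
  also have "complex_of_real (exp (- \<nu>)) * exp (complex_of_real \<nu> * exp z) = exp (complex_of_real \<nu> * (exp z - 1))"
    unfolding exp_of_real[symmetric] exp_add[symmetric] by (simp add: algebra_simps)
  finally have sums: "g sums exp (complex_of_real \<nu> * (exp z - 1))" .
  have int: "integrable (count_space UNIV) g"
    using summ by (simp add: integrable_count_space_nat_iff)
  show "integrable (measure_pmf (poisson_pmf \<nu>)) (\<lambda>k. exp (z * of_nat k) :: complex)"
    unfolding measure_pmf_eq_density by (subst integrable_density) (use int eq in auto)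
  show "(\<integral>k. exp (z * of_nat k) \<partial>measure_pmf (poisson_pmf \<nu>)) = exp (complex_of_real \<nu> * (exp z - 1))"
    unfolding measure_pmf_eq_density
    by (subst integral_density) (use int eq sums in \<open>auto simp: integral_count_space_nat sums_iff\<close>)
qed

definition poisson_family :: "'w measure \<Rightarrow> 'i set \<Rightarrow> ('i \<Rightarrow> 'w \<Rightarrow> nat) \<Rightarrow> ('i \<Rightarrow> real) \<Rightarrow> bool" where
  "poisson_family M I X \<nu> \<longleftrightarrow> prob_space M \<and> finite I \<and>
     prob_space.indep_vars M (\<lambda>_. count_space UNIV) X I \<and>
     (\<forall>i\<in>I. 0 < \<nu> i \<and> distr M (count_space UNIV) (X i) = measure_pmf (poisson_pmf (\<nu> i)))"

lemma poisson_family_measurable: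
  assumes "poisson_family M I X \<nu>" "i \<in> I"
  shows "X i \<in> measurable M (count_space UNIV)"
proof -
  interpret prob_space M using assms by (simp add: poisson_family_def)
  have "indep_vars (\<lambda>_. count_space UNIV) X I" using assms by (simp add: poisson_family_def)
  then show ?thesis unfolding indep_vars_def using assms(2) by blast
qed

lemma poisson_family_sum_measurable:
  assumes "poisson_family M I X \<nu>"
  shows "(\<lambda>\<omega>. \<Sum>i\<in>I. c i * (real (X i \<omega>) - \<nu> i)) \<in> borel_measurable M"
proof (rule borel_measurable_sum)
  fix i assume "i \<in> I"
  note [measurable] = poisson_family_measurable[OF assms this]
  show "(\<lambda>\<omega>. c i * (real (X i \<omega>) - \<nu> i)) \<in> borel_measurable M" by measurable
qed

lemma poisson_family_exp_moment:
  assumes "poisson_family M I X \<nu>"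
  shows "integrable M (\<lambda>\<omega>. exp (\<Sum>i\<in>I. z i * complex_of_real (real (X i \<omega>) - \<nu> i)))"
    and "(\<integral>\<omega>. exp (\<Sum>i\<in>I. z i * complex_of_real (real (X i \<omega>) - \<nu> i)) \<partial>M)
      = exp (\<Sum>i\<in>I. complex_of_real (\<nu> i) * (exp (z i) - 1 - z i))"
proof -
  interpret prob_space M using assms by (simp add: poisson_family_def)
  have I: "finite I" "indep_vars (\<lambda>_. count_space UNIV) X I" "\<And>i. i \<in> I \<Longrightarrow> 0 < \<nu> i"
    "\<And>i. i \<in> I \<Longrightarrow> distr M (count_space UNIV) (X i) = measure_pmf (poisson_pmf (\<nu> i))"
    using assms by (auto simp: poisson_family_def)
  note [measurable] = poisson_family_measurable[OF assms]
  define Y where "Y i \<omega> = exp (z i * complex_of_real (real (X i \<omega>) - \<nu> i))" for i \<omega>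
  have Y: "Y i \<omega> = exp (- z i * complex_of_real (\<nu> i)) * exp (z i * of_nat (X i \<omega>))" for i \<omega>
    unfolding Y_def exp_add[symmetric] by (simp add: algebra_simps)
  have int0: "integrable M (\<lambda>\<omega>. exp (z i * of_nat (X i \<omega>)))"
    and E0: "(\<integral>\<omega>. exp (z i * of_nat (X i \<omega>)) \<partial>M) = exp (complex_of_real (\<nu> i) * (exp (z i) - 1))"
    if "i \<in> I" for i
  proof -
    have "integrable (distr M (count_space UNIV) (X i)) (\<lambda>k. exp (z i * of_nat k))"
      unfolding I(4)[OF that] by (rule poisson_exp_moment(1)[OF I(3)[OF that]])
    then show "integrable M (\<lambda>\<omega>. exp (z i * of_nat (X i \<omega>)))"
      by (subst (asm) integrable_distr_eq) (use that in auto)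
    have "(\<integral>k. exp (z i * of_nat k) \<partial>distr M (count_space UNIV) (X i)) = exp (complex_of_real (\<nu> i) * (exp (z i) - 1))"
      unfolding I(4)[OF that] by (rule poisson_exp_moment(2)[OF I(3)[OF that]])
    then show "(\<integral>\<omega>. exp (z i * of_nat (X i \<omega>)) \<partial>M) = exp (complex_of_real (\<nu> i) * (exp (z i) - 1))"
      by (subst (asm) integral_distr) (use that in auto)
  qed
  have int: "integrable M (Y i)" if "i \<in> I" for i
    using int0[OF that] unfolding Y by (intro integrable_mult_right)
  have E: "(\<integral>\<omega>. Y i \<omega> \<partial>M) = exp (complex_of_real (\<nu> i) * (exp (z i) - 1 - z i))" if "i \<in> I" for i
  proof -
    have "(\<integral>\<omega>. Y i \<omega> \<partial>M)
        = exp (- z i * complex_of_real (\<nu> i)) * (\<integral>\<omega>. exp (z i * of_nat (X i \<omega>)) \<partial>M)"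
      by (subst integral_mult_right_zero[symmetric]) (rule Bochner_Integration.integral_cong[OF refl Y])
    then show ?thesis
      unfolding E0[OF that] exp_add[symmetric] by (simp add: algebra_simps)
  qed
  have "indep_vars (\<lambda>_. borel) Y I"
    unfolding Y_def
    by (rule indep_vars_compose2[OF I(2), of "\<lambda>i k. exp (z i * complex_of_real (real k - \<nu> i))"]) auto
  note * = indep_vars_lebesgue_integral[OF I(1) this int] indep_vars_integrable[OF I(1) this int]
  have prod: "exp (\<Sum>i\<in>I. z i * complex_of_real (real (X i \<omega>) - \<nu> i)) = (\<Prod>i\<in>I. Y i \<omega>)" for \<omega>
    unfolding Y_def by (rule exp_sum[OF I(1)])
  show "integrable M (\<lambda>\<omega>. exp (\<Sum>i\<in>I. z i * complex_of_real (real (X i \<omega>) - \<nu> i)))"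
    unfolding prod by (rule *(2))
  show "(\<integral>\<omega>. exp (\<Sum>i\<in>I. z i * complex_of_real (real (X i \<omega>) - \<nu> i)) \<partial>M)
      = exp (\<Sum>i\<in>I. complex_of_real (\<nu> i) * (exp (z i) - 1 - z i))"
    unfolding prod by (simp add: *(1) E exp_sum I(1))
qed

text \<open>
  Chernoff bound with exponent \<open>2 r / \<sigma>\<close>. The condition \<open>2 r C \<le> \<sigma>\<close> keeps all arguments
  of the cumulant generating function in \<open>[-1, 1]\<close>, where \<open>e\<^sup>x - 1 - x \<le> x\<^sup>2\<close>, so the sum behaves
  like a Gaussian one.
\<close>
lemma poisson_family_tail:
  assumes fam: "poisson_family M I X \<nu>"
    and c: "\<And>i. i \<in> I \<Longrightarrow> \<bar>c i\<bar> \<le> C" "(\<Sum>i\<in>I. (c i)\<^sup>2 * \<nu> i) \<le> \<sigma>\<^sup>2"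
    and "0 < \<sigma>" "0 < r" "2 * r * C \<le> \<sigma>"
  shows "measure M {\<omega>\<in>space M. 4 * r * \<sigma> \<le> (\<Sum>i\<in>I. c i * (real (X i \<omega>) - \<nu> i))} \<le> exp (- 4 * r\<^sup>2)"
proof -
  interpret prob_space M using fam by (simp add: poisson_family_def)
  have pos: "\<And>i. i \<in> I \<Longrightarrow> 0 < \<nu> i" using fam by (auto simp: poisson_family_def)
  define s where "s = 2 * r / \<sigma>"
  have s: "0 < s" using assms by (simp add: s_def)
  let ?S = "\<lambda>\<omega>. \<Sum>i\<in>I. c i * (real (X i \<omega>) - \<nu> i)"
  have eq: "complex_of_real (exp (s * ?S \<omega>))
      = exp (\<Sum>i\<in>I. complex_of_real (s * c i) * complex_of_real (real (X i \<omega>) - \<nu> i))" for \<omega>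
    by (simp add: sum_distrib_left mult.assoc flip: exp_of_real)
  have int: "integrable M (\<lambda>\<omega>. exp (s * ?S \<omega>))"
    using poisson_family_exp_moment(1)[OF fam, of "\<lambda>i. complex_of_real (s * c i)"]
    unfolding eq[symmetric] by (simp add: complex_of_real_integrable_eq)
  have "complex_of_real (\<integral>\<omega>. exp (s * ?S \<omega>) \<partial>M)
      = exp (\<Sum>i\<in>I. complex_of_real (\<nu> i) * (exp (complex_of_real (s * c i)) - 1 - complex_of_real (s * c i)))"
    using poisson_family_exp_moment(2)[OF fam, of "\<lambda>i. complex_of_real (s * c i)"]
    unfolding eq[symmetric] by simp
  also have "\<dots> = complex_of_real (exp (\<Sum>i\<in>I. \<nu> i * (exp (s * c i) - 1 - s * c i)))"
    by (simp flip: exp_of_real)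
  finally have E: "(\<integral>\<omega>. exp (s * ?S \<omega>) \<partial>M) = exp (\<Sum>i\<in>I. \<nu> i * (exp (s * c i) - 1 - s * c i))"
    by (simp only: of_real_eq_iff)
  have "(\<Sum>i\<in>I. \<nu> i * (exp (s * c i) - 1 - s * c i)) \<le> (\<Sum>i\<in>I. \<nu> i * (s * c i)\<^sup>2)"
  proof (intro sum_mono mult_left_mono)
    fix i assume i: "i \<in> I"
    have "\<bar>s * c i\<bar> \<le> s * C" using c(1)[OF i] s by (simp add: abs_mult)
    also have "s * C \<le> 1" using assms by (simp add: s_def field_simps)
    finally show "exp (s * c i) - 1 - s * c i \<le> (s * c i)\<^sup>2" using abs_exp_taylor_le[of "s * c i"] by linarith
  qed (use pos in \<open>auto simp: less_imp_le\<close>)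
  also have "\<dots> = s\<^sup>2 * (\<Sum>i\<in>I. (c i)\<^sup>2 * \<nu> i)" by (simp add: sum_distrib_left power_mult_distrib mult_ac)
  also have "\<dots> \<le> s\<^sup>2 * \<sigma>\<^sup>2" by (intro mult_left_mono c) simp
  also have "\<dots> = 4 * r\<^sup>2" using assms by (simp add: s_def power_divide power_mult_distrib)
  finally have E_le: "(\<integral>\<omega>. exp (s * ?S \<omega>) \<partial>M) \<le> exp (4 * r\<^sup>2)" unfolding E by simp
  have "measure M {\<omega>\<in>space M. 4 * r * \<sigma> \<le> ?S \<omega>} \<le> exp (- s * (4 * r * \<sigma>)) * (\<integral>\<omega>\<in>space M. exp (s * ?S \<omega>) \<partial>M)"
    by (rule Chernoff_ineq_ge[OF s]) (use int in \<open>auto simp: set_integrable_def cong: Bochner_Integration.integrable_cong\<close>)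
  also have "(\<integral>\<omega>\<in>space M. exp (s * ?S \<omega>) \<partial>M) = (\<integral>\<omega>. exp (s * ?S \<omega>) \<partial>M)"
    by (rule set_integral_space[OF int])
  also have "exp (- s * (4 * r * \<sigma>)) * (\<integral>\<omega>. exp (s * ?S \<omega>) \<partial>M) \<le> exp (- s * (4 * r * \<sigma>)) * exp (4 * r\<^sup>2)"
    by (intro mult_left_mono E_le) simp
  also have "\<dots> = exp (- 4 * r\<^sup>2)"
    using assms by (simp add: s_def power2_eq_square field_simps flip: exp_add)
  finally show ?thesis by simp
qed

lemma poisson_family_abs_tail:
  assumes fam: "poisson_family M I X \<nu>"
    and c: "\<And>i. i \<in> I \<Longrightarrow> \<bar>c i\<bar> \<le> C" "(\<Sum>i\<in>I. (c i)\<^sup>2 * \<nu> i) \<le> \<sigma>\<^sup>2"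
    and "0 < \<sigma>" "0 < r" "2 * r * C \<le> \<sigma>"
  shows "measure M {\<omega>\<in>space M. 4 * r * \<sigma> \<le> \<bar>\<Sum>i\<in>I. c i * (real (X i \<omega>) - \<nu> i)\<bar>} \<le> 2 * exp (- 4 * r\<^sup>2)"
proof -
  interpret prob_space M using fam by (simp add: poisson_family_def)
  let ?S = "\<lambda>c \<omega>. \<Sum>i\<in>I. c i * (real (X i \<omega>) - \<nu> i)"
  let ?E = "\<lambda>c. {\<omega>\<in>space M. 4 * r * \<sigma> \<le> ?S c \<omega>}"
  note [measurable] = poisson_family_sum_measurable[OF fam]
  have "{\<omega>\<in>space M. 4 * r * \<sigma> \<le> \<bar>?S c \<omega>\<bar>} = ?E c \<union> ?E (\<lambda>i. - c i)"
    by (auto simp: sum_negf abs_if)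
  then have "measure M {\<omega>\<in>space M. 4 * r * \<sigma> \<le> \<bar>?S c \<omega>\<bar>} \<le> measure M (?E c) + measure M (?E (\<lambda>i. - c i))"
    by (simp only:) (intro measure_Un_le; measurable)
  also have "\<dots> \<le> exp (- 4 * r\<^sup>2) + exp (- 4 * r\<^sup>2)"
    by (intro add_mono poisson_family_tail[OF fam, where C = C]) (use assms in auto)
  finally show ?thesis by simp
qed

text \<open>
  The logarithm of the characteristic function is \<open>\<Sum> \<nu>\<^sub>i (e\<^sup>i\<^sup>c - 1 - i c)\<close> with \<open>c = c\<^sub>i\<close>. It
  is minus half the variance up to a cubic error, which is small relative to the variance if all
  coefficients are small. This is the central limit theorem in the form used below.
\<close>
lemma poisson_family_char_approx:
  assumes fam: "poisson_family M I X \<nu>"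
    and c: "\<And>i. i \<in> I \<Longrightarrow> \<bar>c i\<bar> \<le> C"
  shows "\<exists>\<zeta>. (\<integral>\<omega>. iexp (\<Sum>i\<in>I. c i * (real (X i \<omega>) - \<nu> i)) \<partial>M) = exp (\<zeta> - complex_of_real ((\<Sum>i\<in>I. (c i)\<^sup>2 * \<nu> i) / 2))
      \<and> norm \<zeta> \<le> C * (\<Sum>i\<in>I. (c i)\<^sup>2 * \<nu> i)"
proof -
  have pos: "\<And>i. i \<in> I \<Longrightarrow> 0 < \<nu> i" using fam by (auto simp: poisson_family_def)
  define \<zeta> where "\<zeta> = (\<Sum>i\<in>I. complex_of_real (\<nu> i) * (iexp (c i) - 1 - \<i> * c i + complex_of_real ((c i)\<^sup>2 / 2)))"
  have "(\<integral>\<omega>. iexp (\<Sum>i\<in>I. c i * (real (X i \<omega>) - \<nu> i)) \<partial>M)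
      = exp (\<Sum>i\<in>I. complex_of_real (\<nu> i) * (iexp (c i) - 1 - \<i> * c i))"
    using poisson_family_exp_moment(2)[OF fam, of "\<lambda>i. \<i> * c i"]
    by (simp add: sum_distrib_left mult.assoc)
  also have "(\<Sum>i\<in>I. complex_of_real (\<nu> i) * (iexp (c i) - 1 - \<i> * c i)) = \<zeta> - complex_of_real ((\<Sum>i\<in>I. (c i)\<^sup>2 * \<nu> i) / 2)"
    by (simp add: \<zeta>_def sum_divide_distrib sum_subtractf[symmetric]) (simp add: algebra_simps)
  finally have 1: "(\<integral>\<omega>. iexp (\<Sum>i\<in>I. c i * (real (X i \<omega>) - \<nu> i)) \<partial>M) = exp (\<zeta> - complex_of_real ((\<Sum>i\<in>I. (c i)\<^sup>2 * \<nu> i) / 2))" .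
  have "norm \<zeta> \<le> (\<Sum>i\<in>I. C * ((c i)\<^sup>2 * \<nu> i))"
    unfolding \<zeta>_def
  proof (rule sum_norm_le)
    fix i assume i: "i \<in> I"
    have "norm (iexp (c i) - 1 - \<i> * c i + complex_of_real ((c i)\<^sup>2 / 2)) \<le> \<bar>c i\<bar> ^ 3 / 6"
      using iexp_approx1[of "c i" 2] by (simp add: numeral_eq_Suc algebra_simps)
    also have "\<dots> \<le> \<bar>c i\<bar> * (c i)\<^sup>2" using power_Suc[of "\<bar>c i\<bar>" 2] by simp
    also have "\<dots> \<le> C * (c i)\<^sup>2" by (intro mult_right_mono c i) simp
    finally show "norm (complex_of_real (\<nu> i) * (iexp (c i) - 1 - \<i> * c i + complex_of_real ((c i)\<^sup>2 / 2))) \<le> C * ((c i)\<^sup>2 * \<nu> i)"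
      using pos[OF i] by (simp add: norm_mult mult_ac)
  qed
  then have "norm \<zeta> \<le> C * (\<Sum>i\<in>I. (c i)\<^sup>2 * \<nu> i)" by (simp add: sum_distrib_left)
  with 1 show ?thesis by blast
qed

section \<open>A maximum principle for bipartite weighted systems\<close>

lemma finite_off_diag [simp]: "finite (off_diag n)"
  by (rule finite_subset[of _ "{1..n} \<times> {1..n}"]) (auto simp: off_diag_def)

lemma off_diag_iff: "(i, j) \<in> off_diag n \<longleftrightarrow> i \<in> {1..n} \<and> j \<in> {1..n} - {i}"
  by (auto simp: off_diag_def)

lemma sum_off_diag_rows: "(\<Sum>p\<in>off_diag n. f p) = (\<Sum>i=1..n. \<Sum>j\<in>{1..n} - {i}. f (i, j))"
proof -
  have "off_diag n = Sigma {1..n} (\<lambda>i. {1..n} - {i})" by (auto simp: off_diag_def)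
  then show ?thesis by (simp add: sum.Sigma)
qed

lemma sum_off_diag_cols: "(\<Sum>p\<in>off_diag n. f p) = (\<Sum>j=1..n. \<Sum>i\<in>{1..n} - {j}. f (i, j))"
proof -
  have "(\<Sum>p\<in>off_diag n. f p) = (\<Sum>p\<in>off_diag n. f (prod.swap p))"
    by (rule sum.reindex_bij_witness[of _ prod.swap prod.swap]) (auto simp: off_diag_def)
  then show ?thesis by (simp add: sum_off_diag_rows)
qed

lemma card_off_diag: "(\<Sum>p\<in>off_diag n. c) = real n * (real n - 1) * c" if "1 \<le> n"
  unfolding sum_off_diag_rows using that by (simp add: of_nat_diff)

lemma sum_nonneg_le_of_weighted:
  fixes w h :: "'a \<Rightarrow> real"
  assumes "\<And>k. k \<in> J \<Longrightarrow> 1 / M \<le> w k" "\<And>k. k \<in> J \<Longrightarrow> 0 \<le> h k" "(\<Sum>k\<in>J. w k * h k) \<le> B" "0 < M"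
  shows "(\<Sum>k\<in>J. h k) \<le> M * B"
proof -
  have "(\<Sum>k\<in>J. h k) / M = (\<Sum>k\<in>J. 1 / M * h k)" by (simp add: sum_divide_distrib)
  also have "\<dots> \<le> (\<Sum>k\<in>J. w k * h k)" by (intro sum_mono mult_right_mono assms)
  also have "\<dots> \<le> B" by (rule assms(3))
  finally show ?thesis using \<open>0 < M\<close> by (simp add: pos_divide_le_eq mult.commute)
qed

text \<open>
  Case of the maximum principle with the largest and the smallest potential on the same side of the
  bipartition. All other vertices on the opposite side are on average close to both of them.
\<close>
lemma oscillation_same_side:
  fixes g h :: "nat \<Rightarrow> real"
  assumes "(\<Sum>k\<in>{1..n} - {p}. g k) \<le> K" "(\<Sum>k\<in>{1..n} - {q}. h k) \<le> K"
    and "\<And>k. k \<in> {1..n} \<Longrightarrow> 0 \<le> g k" "\<And>k. k \<in> {1..n} \<Longrightarrow> 0 \<le> h k"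
    and "\<And>k. k \<in> {1..n} \<Longrightarrow> g k + h k = D" "0 \<le> D"
  shows "(real n - 2) * D \<le> 2 * K"
proof -
  let ?J = "{1..n} - {p, q}"
  have "real n - 2 \<le> real (card ?J)"
  proof -
    have "card {1..n} \<le> card (?J \<union> {p, q})" by (rule card_mono) auto
    also have "\<dots> \<le> card ?J + card {p, q}" by (rule card_Un_le)
    also have "card {p, q} \<le> 2" by (simp add: card_insert_if)
    finally show ?thesis by simp
  qed
  then have "(real n - 2) * D \<le> real (card ?J) * D" using assms by (intro mult_right_mono)
  also have "\<dots> = (\<Sum>k\<in>?J. g k) + (\<Sum>k\<in>?J. h k)"
    using assms(5) by (simp flip: sum.distrib)
  also have "(\<Sum>k\<in>?J. g k) \<le> (\<Sum>k\<in>{1..n} - {p}. g k)" by (rule sum_mono2) (use assms in auto)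
  also have "(\<Sum>k\<in>?J. h k) \<le> (\<Sum>k\<in>{1..n} - {q}. h k)" by (rule sum_mono2) (use assms in auto)
  finally show ?thesis using assms by linarith
qed

text \<open>
  Case of the maximum principle with the extreme potentials on opposite sides. Here \<open>a\<close> and \<open>b\<close> are
  the distances from the extremes; both are small on average, so a typical edge has potential
  difference close to the oscillation \<open>D\<close>. The total flow is at most \<open>n B\<close>, which bounds \<open>D\<close>. The
  condition on \<open>n\<close> makes the contribution of the two exceptional vertices, at most \<open>2 n M D\<close>, no larger
  than half of the total \<open>n (n - 1) D / M\<close>.
\<close>
lemma oscillation_opposite_sides:
  fixes a b :: "nat \<Rightarrow> real" and w :: "nat \<times> nat \<Rightarrow> real"
  assumes w: "\<And>p. p \<in> off_diag n \<Longrightarrow> 1 / M \<le> w p" "\<And>p. p \<in> off_diag n \<Longrightarrow> w p \<le> M"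
    and M: "1 \<le> M" "4 * M\<^sup>2 + 1 \<le> real n" and "0 \<le> B"
    and a: "(\<Sum>i\<in>{1..n} - {q}. a i) \<le> M * B" "\<And>i. i \<in> {1..n} \<Longrightarrow> 0 \<le> a i" "\<And>i. i \<in> {1..n} \<Longrightarrow> a i \<le> D"
    and b: "(\<Sum>i\<in>{1..n} - {p}. b i) \<le> M * B" "\<And>i. i \<in> {1..n} \<Longrightarrow> 0 \<le> b i" "\<And>i. i \<in> {1..n} \<Longrightarrow> b i \<le> D"
    and "p \<in> {1..n}" "q \<in> {1..n}"
    and total: "- (real n * B) \<le> (\<Sum>(i, j)\<in>off_diag n. w (i, j) * (a i + b j - D))"
  shows "real n * D \<le> 12 * M ^ 3 * B"
proof -
  have n1: "1 \<le> n" using assms by simp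
  have D: "0 \<le> D" using a(2,3) \<open>q \<in> {1..n}\<close> by (meson order_trans)
  have sa: "(\<Sum>i=1..n. a i) \<le> M * B + D"
    using a(1) a(3)[OF \<open>q \<in> {1..n}\<close>] sum.remove[OF finite_atLeastAtMost \<open>q \<in> {1..n}\<close>, of a] by linarith
  have sb: "(\<Sum>i=1..n. b i) \<le> M * B + D"
    using b(1) b(3)[OF \<open>p \<in> {1..n}\<close>] sum.remove[OF finite_atLeastAtMost \<open>p \<in> {1..n}\<close>, of b] by linarith
  have W: "real n * (real n - 1) * (D / M) \<le> (\<Sum>p\<in>off_diag n. w p * D)"
    unfolding card_off_diag[OF n1, symmetric]
    by (rule sum_mono) (use w(1) D mult_right_mono in fastforce)
  have wa: "(\<Sum>(i, j)\<in>off_diag n. w (i, j) * a i) \<le> real n * M * (M * B + D)"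
  proof -
    have "(\<Sum>(i, j)\<in>off_diag n. w (i, j) * a i) \<le> (\<Sum>(i, j)\<in>off_diag n. M * a i)"
      by (rule sum_mono) (use w(2) a(2) in \<open>auto simp: off_diag_iff intro!: mult_right_mono\<close>)
    also have "\<dots> = (\<Sum>i=1..n. (real n - 1) * (M * a i))"
      by (simp add: sum_off_diag_rows of_nat_diff n1)
    also have "\<dots> \<le> (\<Sum>i=1..n. real n * (M * a i))"
      using a(2) M by (intro sum_mono mult_right_mono) auto
    also have "\<dots> = real n * M * (\<Sum>i=1..n. a i)" by (simp add: sum_distrib_left mult.assoc)
    also have "\<dots> \<le> real n * M * (M * B + D)" using sa M by (intro mult_left_mono) auto
    finally show ?thesis .
  qed
  have wb: "(\<Sum>(i, j)\<in>off_diag n. w (i, j) * b j) \<le> real n * M * (M * B + D)"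
  proof -
    have "(\<Sum>(i, j)\<in>off_diag n. w (i, j) * b j) \<le> (\<Sum>(i, j)\<in>off_diag n. M * b j)"
      by (rule sum_mono) (use w(2) b(2) in \<open>auto simp: off_diag_iff intro!: mult_right_mono\<close>)
    also have "\<dots> = (\<Sum>j=1..n. (real n - 1) * (M * b j))"
      by (simp add: sum_off_diag_cols of_nat_diff n1)
    also have "\<dots> \<le> (\<Sum>i=1..n. real n * (M * b i))"
      using b(2) M by (intro sum_mono mult_right_mono) auto
    also have "\<dots> = real n * M * (\<Sum>i=1..n. b i)" by (simp add: sum_distrib_left mult.assoc)
    also have "\<dots> \<le> real n * M * (M * B + D)" using sb M by (intro mult_left_mono) auto
    finally show ?thesis .
  qed
  have split: "(\<Sum>(i, j)\<in>off_diag n. w (i, j) * (a i + b j - D))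
      = (\<Sum>(i, j)\<in>off_diag n. w (i, j) * a i) + (\<Sum>(i, j)\<in>off_diag n. w (i, j) * b j) - (\<Sum>p\<in>off_diag n. w p * D)"
    by (simp add: case_prod_beta algebra_simps sum.distrib sum_subtractf)
  have "real n * ((real n - 1) * (D / M)) \<le> real n * (B + 2 * M * (M * B + D))"
    using W wa wb total unfolding split by (simp add: algebra_simps)
  then have "(real n - 1) * (D / M) \<le> B + 2 * M * (M * B + D)"
    by (rule mult_left_le_imp_le) (use n1 in auto)
  then have "(real n - 1) * D \<le> M * (B + 2 * M * (M * B + D))"
    using M by (simp add: field_simps)
  moreover have "4 * M\<^sup>2 * D \<le> (real n - 1) * D" using M D by (intro mult_right_mono) auto
  ultimately have "(real n - 1) * D \<le> 2 * M * B + 4 * M ^ 3 * B"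
    by (simp add: algebra_simps power2_eq_square power3_eq_cube)
  moreover have "real n * D \<le> 2 * ((real n - 1) * D)"
  proof -
    have "5 \<le> real n" using M one_le_power[OF M(1), of 2] by linarith
    then have "real n \<le> 2 * (real n - 1)" by simp
    from mult_right_mono[OF this D] show ?thesis by (simp only: mult.assoc)
  qed
  moreover have "M * B \<le> M ^ 3 * B"
    using M self_le_power[of M 3] \<open>0 \<le> B\<close> by (intro mult_right_mono) auto
  ultimately show ?thesis by linarith
qed

text \<open>
  Sup-norm bound of order \<open>1 / n\<close> for the inverse of the Fisher information of \<open>(\<alpha>, \<beta>)\<close>.
  With \<open>v\<^sub>j = - y\<^sub>j\<close> the system is the weighted graph Laplacian of the complete bipartite graph without
  a perfect matching. At a vertex of maximal potential all terms of the row sum have one sign, so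
  nearly all neighbours have nearly maximal potential; likewise at a minimum. The four cases say on
  which sides the extremes lie.
\<close>
lemma bipartite_max_principle:
  fixes x y :: "nat \<Rightarrow> real" and w :: "nat \<times> nat \<Rightarrow> real"
  assumes w: "\<And>p. p \<in> off_diag n \<Longrightarrow> 1 / M \<le> w p" "\<And>p. p \<in> off_diag n \<Longrightarrow> w p \<le> M"
    and M: "1 \<le> M" "4 * M\<^sup>2 + 1 \<le> real n"
    and rows: "\<And>i. i \<in> {1..n} \<Longrightarrow> \<bar>\<Sum>j\<in>{1..n} - {i}. w (i, j) * (x i + y j)\<bar> \<le> B"
    and cols: "\<And>j. j \<in> {1..n} \<Longrightarrow> \<bar>\<Sum>i\<in>{1..n} - {j}. w (i, j) * (x i + y j)\<bar> \<le> B"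
    and ij: "i \<in> {1..n}" "j \<in> {1..n}"
  shows "\<bar>x i + y j\<bar> \<le> 12 * M ^ 3 * B / real n"
proof -
  let ?I = "{1..n}"
  define v where "v j = - y j" for j
  have B: "0 \<le> B" using rows[OF ij(1)] by linarith
  have n4: "5 \<le> real n" using M one_le_power[OF M(1), of 2] by linarith
  define V where "V = x ` ?I \<union> v ` ?I"
  define U where "U = Max V"
  define L where "L = Min V"
  define D where "D = U - L"
  have V: "finite V" "V \<noteq> {}" using ij by (auto simp: V_def)
  have bd: "x k \<le> U" "v k \<le> U" "L \<le> x k" "L \<le> v k" if "k \<in> ?I" for k
    using V that by (auto simp: U_def L_def V_def intro!: Max_ge Min_le)
  have D: "0 \<le> D" using bd[OF ij(1)] by (simp add: D_def)
  have row: "\<bar>\<Sum>j\<in>?I - {i}. w (i, j) * (x i - v j)\<bar> \<le> B" if "i \<in> ?I" for i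
    using rows[OF that] by (simp add: v_def)
  have col: "\<bar>\<Sum>i\<in>?I - {j}. w (i, j) * (x i - v j)\<bar> \<le> B" if "j \<in> ?I" for j
    using cols[OF that] by (simp add: v_def)
  have top_x: "(\<Sum>j\<in>?I - {p}. U - v j) \<le> M * B" if "p \<in> ?I" "x p = U" for p
    by (rule sum_nonneg_le_of_weighted[of _ M "\<lambda>j. w (p, j)"])
      (use that row[OF that(1)] w bd M in \<open>auto simp: off_diag_iff\<close>)
  have top_v: "(\<Sum>i\<in>?I - {p}. U - x i) \<le> M * B" if "p \<in> ?I" "v p = U" for p
    by (rule sum_nonneg_le_of_weighted[of _ M "\<lambda>i. w (i, p)"])
      (use that col[OF that(1)] w bd M in \<open>auto simp: off_diag_iff abs_le_iff right_diff_distrib sum_subtractf\<close>)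
  have bot_x: "(\<Sum>j\<in>?I - {q}. v j - L) \<le> M * B" if "q \<in> ?I" "x q = L" for q
    by (rule sum_nonneg_le_of_weighted[of _ M "\<lambda>j. w (q, j)"])
      (use that row[OF that(1)] w bd M in \<open>auto simp: off_diag_iff abs_le_iff right_diff_distrib sum_subtractf\<close>)
  have bot_v: "(\<Sum>i\<in>?I - {q}. x i - L) \<le> M * B" if "q \<in> ?I" "v q = L" for q
    by (rule sum_nonneg_le_of_weighted[of _ M "\<lambda>i. w (i, q)"])
      (use that col[OF that(1)] w bd M in \<open>auto simp: off_diag_iff\<close>)
  have total: "\<bar>\<Sum>(i, j)\<in>off_diag n. w (i, j) * (x i - v j)\<bar> \<le> real n * B"
  proof -
    have "\<bar>\<Sum>(i, j)\<in>off_diag n. w (i, j) * (x i - v j)\<bar> \<le> (\<Sum>i=1..n. B)"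
      unfolding sum_off_diag_rows split_conv by (rule order_trans[OF sum_abs]) (intro sum_mono row)
    then show ?thesis by simp
  qed
  have easy: "real n * D \<le> 12 * M ^ 3 * B" if "(real n - 2) * D \<le> 2 * (M * B)"
  proof -
    have "real n * D \<le> 2 * ((real n - 2) * D)"
    proof -
      have "real n \<le> 2 * (real n - 2)" using n4 by simp
      from mult_right_mono[OF this D] show ?thesis by (simp only: mult.assoc)
    qed
    moreover have "M * B \<le> M ^ 3 * B"
      using M self_le_power[of M 3] B by (intro mult_right_mono) auto
    moreover have "0 \<le> M ^ 3 * B" using M B by simp
    ultimately show ?thesis using that by linarith
  qed
  have "U \<in> V" "L \<in> V" using V by (auto simp: U_def L_def)
  then consider (xx) p q where "p \<in> ?I" "q \<in> ?I" "x p = U" "x q = L"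
    | (vv) p q where "p \<in> ?I" "q \<in> ?I" "v p = U" "v q = L"
    | (xv) p q where "p \<in> ?I" "q \<in> ?I" "x p = U" "v q = L"
    | (vx) p q where "p \<in> ?I" "q \<in> ?I" "v p = U" "x q = L"
    unfolding V_def by (auto simp: image_iff)
  then have "real n * D \<le> 12 * M ^ 3 * B"
  proof cases
    case xx
    show ?thesis
      by (rule easy, rule oscillation_same_side[OF top_x[OF xx(1,3)] bot_x[OF xx(2,4)]])
        (use bd D in \<open>auto simp: D_def\<close>)
  next
    case vv
    show ?thesis
      by (rule easy, rule oscillation_same_side[OF top_v[OF vv(1,3)] bot_v[OF vv(2,4)]])
        (use bd D in \<open>auto simp: D_def\<close>)
  next
    case xv
    show ?thesis
    proof (rule oscillation_opposite_sides[OF w M B bot_v[OF xv(2,4)] _ _ top_x[OF xv(1,3)] _ _ xv(1,2)])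
      have "x i - L + (U - v j) - D = x i - v j" for i j by (simp add: D_def)
      then show "- (real n * B) \<le> (\<Sum>(i, j)\<in>off_diag n. w (i, j) * (x i - L + (U - v j) - D))"
        using total by (simp only: abs_le_iff) linarith
    qed (use bd in \<open>auto simp: D_def\<close>)
  next
    case vx
    show ?thesis
    proof (rule oscillation_opposite_sides[OF w M B top_v[OF vx(1,3)] _ _ bot_x[OF vx(2,4)] _ _ vx(2,1)])
      have "w (i, j) * (U - x i + (v j - L) - D) = - (w (i, j) * (x i - v j))" for i j
        by (simp add: D_def algebra_simps)
      then show "- (real n * B) \<le> (\<Sum>(i, j)\<in>off_diag n. w (i, j) * (U - x i + (v j - L) - D))"
        using total by (simp add: case_prod_beta sum_negf)
    qed (use bd in \<open>auto simp: D_def\<close>)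
  qed
  moreover have "\<bar>x i + y j\<bar> \<le> D"
    using bd[OF ij(1)] bd[OF ij(2)] by (auto simp: D_def v_def abs_le_iff)
  ultimately have "real n * \<bar>x i + y j\<bar> \<le> 12 * M ^ 3 * B"
    using n4 by (smt (verit) mult_left_mono)
  then show ?thesis using n4 by (simp add: pos_le_divide_eq mult.commute)
qed

section \<open>Contractions on finitely many coordinates\<close>

text \<open>
  Banach's fixed point theorem in the sup-norm over a finite index set whose size may vary, hence
  stated for functions and not for a metric type.
\<close>
lemma contraction_fixpoint:
  fixes \<Phi> :: "('e \<Rightarrow> real) \<Rightarrow> 'e \<Rightarrow> real"
  assumes "finite P" "0 \<le> \<tau>"
    and maps: "\<And>t. (\<And>p. p \<in> P \<Longrightarrow> \<bar>t p\<bar> \<le> \<tau>) \<Longrightarrow> (\<And>p. p \<in> P \<Longrightarrow> \<bar>\<Phi> t p\<bar> \<le> \<tau>)"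
    and contr: "\<And>s t c. (\<And>p. p \<in> P \<Longrightarrow> \<bar>s p\<bar> \<le> \<tau>) \<Longrightarrow> (\<And>p. p \<in> P \<Longrightarrow> \<bar>t p\<bar> \<le> \<tau>) \<Longrightarrow>
        (\<And>p. p \<in> P \<Longrightarrow> \<bar>s p - t p\<bar> \<le> c) \<Longrightarrow> (\<And>p. p \<in> P \<Longrightarrow> \<bar>\<Phi> s p - \<Phi> t p\<bar> \<le> c / 2)"
  obtains t where "\<And>p. p \<in> P \<Longrightarrow> \<bar>t p\<bar> \<le> \<tau>" "\<And>p. p \<in> P \<Longrightarrow> \<Phi> t p = t p"
proof -
  define u where "u m = (\<Phi> ^^ m) (\<lambda>_. 0)" for m
  have u_Suc: "u (Suc m) = \<Phi> (u m)" for m by (simp add: u_def)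
  have u_bd: "\<bar>u m p\<bar> \<le> \<tau>" if "p \<in> P" for m p
    using that
  proof (induction m arbitrary: p)
    case 0
    then show ?case using assms by (simp add: u_def)
  next
    case (Suc m)
    show ?case unfolding u_Suc by (rule maps) (use Suc in auto)
  qed
  have u_diff: "\<bar>u (Suc m) p - u m p\<bar> \<le> 2 * \<tau> * (1 / 2) ^ m" if "p \<in> P" for m p
    using that
  proof (induction m arbitrary: p)
    case 0
    then show ?case using u_bd[of p 0] u_bd[of p "Suc 0"] by simp
  next
    case (Suc m)
    have "\<bar>\<Phi> (u (Suc m)) p - \<Phi> (u m) p\<bar> \<le> (2 * \<tau> * (1 / 2) ^ m) / 2"
      by (rule contr) (use Suc u_bd in auto)
    then show ?case by (simp add: u_Suc)
  qed
  have "convergent (\<lambda>m. u m p)" if "p \<in> P" for p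
  proof -
    have "summable (\<lambda>m. u (Suc m) p - u m p)"
      by (rule summable_comparison_test'[where g = "\<lambda>m. 2 * \<tau> * (1 / 2) ^ m" and N = 0])
        (use u_diff[OF that] in \<open>auto intro!: summable_mult summable_geometric\<close>)
    then have "convergent (\<lambda>m. \<Sum>k<m. u (Suc k) p - u k p)" by (simp add: summable_iff_convergent)
    then have "convergent (\<lambda>m. u m p - u 0 p)" 
      using sum_lessThan_telescope[of "\<lambda>k. u k p"] by simp
    then show ?thesis by (simp add: convergent_diff_const_right_iff)
  qed
  then obtain t where t: "\<And>p. p \<in> P \<Longrightarrow> (\<lambda>m. u m p) \<longlonglongrightarrow> t p"
    unfolding convergent_def by metis
  have t_bd: "\<bar>t p\<bar> \<le> \<tau>" if "p \<in> P" for p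
    by (rule LIMSEQ_le_const2[OF tendsto_rabs[OF t[OF that]]]) (use u_bd that in auto)
  have "\<Phi> t p = t p" if "p \<in> P" for p
  proof (rule ccontr)
    assume ne: "\<Phi> t p \<noteq> t p"
    define d where "d = \<bar>\<Phi> t p - t p\<bar> / 2"
    have d: "0 < d" using ne by (simp add: d_def)
    have "\<forall>\<^sub>F m in sequentially. \<forall>p\<in>P. \<bar>u m p - t p\<bar> < d"
      by (rule eventually_ball_finite[OF \<open>finite P\<close>])
        (use t tendstoD[OF _ d] in \<open>force simp: dist_real_def\<close>)
    then obtain m where m: "\<And>p. p \<in> P \<Longrightarrow> \<bar>u m p - t p\<bar> < d" "\<And>p. p \<in> P \<Longrightarrow> \<bar>u (Suc m) p - t p\<bar> < d"
      unfolding eventually_sequentially by (meson le_SucI order_refl)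
    have "\<bar>\<Phi> (u m) p - \<Phi> t p\<bar> \<le> d / 2"
      by (rule contr) (use m u_bd t_bd that in \<open>auto simp: less_imp_le\<close>)
    moreover have "\<bar>\<Phi> t p - t p\<bar> \<le> \<bar>\<Phi> (u m) p - \<Phi> t p\<bar> + \<bar>\<Phi> (u m) p - t p\<bar>"
      by linarith
    moreover have "\<bar>\<Phi> (u m) p - t p\<bar> < d" using m(2)[OF that] unfolding u_Suc .
    moreover have "\<bar>\<Phi> t p - t p\<bar> = 2 * d" by (simp add: d_def)
    moreover have False if "A \<le> d / 2" "X \<le> A + C" "C < d" "X = 2 * d" for A C X :: real
      using that d by linarith
    ultimately show False by blast
  qed
  with t_bd show thesis by (rule that)
qed

section \<open>Weighted least squares with covariates\<close>

lemma sum_of_bool_mult: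
  fixes f :: "'i \<Rightarrow> real"
  assumes "finite A" "r \<in> A"
  shows "(\<Sum>k\<in>A. of_bool (k = r) * f k) = f r" "(\<Sum>k\<in>A. of_bool (r = k) * f k) = f r"
proof -
  have "(\<Sum>k\<in>A. of_bool (k = r) * f k) = (\<Sum>k\<in>A. if k = r then f k else 0)"
    by (rule sum.cong) auto
  then show "(\<Sum>k\<in>A. of_bool (k = r) * f k) = f r" using assms by simp
  then show "(\<Sum>k\<in>A. of_bool (r = k) * f k) = f r" by (simp add: eq_commute)
qed

text \<open>
  Elimination of one unknown at a time: the pivot \<open>s\<close> is the Schur complement, and it is nonzero
  because it is the value of the quadratic form at a nonzero vector.
\<close>
lemma pos_def_system_solvable:
  fixes A :: "'i \<Rightarrow> 'i \<Rightarrow> real" and b :: "'i \<Rightarrow> real"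
  assumes "finite I" "\<And>i j. i \<in> I \<Longrightarrow> j \<in> I \<Longrightarrow> A i j = A j i"
    and "\<And>x. (\<Sum>i\<in>I. \<Sum>j\<in>I. x i * A i j * x j) \<le> 0 \<Longrightarrow> (\<And>i. i \<in> I \<Longrightarrow> x i = 0)"
  shows "\<exists>x. \<forall>i\<in>I. (\<Sum>j\<in>I. A i j * x j) = b i"
  using assms
proof (induction I arbitrary: b rule: finite_induct)
  case empty
  then show ?case by simp
next
  case (insert k I)
  have sym: "A i j = A j i" if "i \<in> insert k I" "j \<in> insert k I" for i j using insert.prems(1) that .
  have pd: "x i = 0" if "(\<Sum>i\<in>insert k I. \<Sum>j\<in>insert k I. x i * A i j * x j) \<le> 0" "i \<in> insert k I" for x i
    using insert.prems(2) that by blast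
  have form: "(\<Sum>i\<in>insert k I. \<Sum>j\<in>insert k I. x i * A i j * x j)
      = x k * (\<Sum>j\<in>insert k I. A k j * x j) + (\<Sum>i\<in>I. x i * (\<Sum>j\<in>insert k I. A i j * x j))" for x
  proof -
    have "(\<Sum>i\<in>J. \<Sum>j\<in>J. x i * A i j * x j) = (\<Sum>i\<in>J. x i * (\<Sum>j\<in>J. A i j * x j))" for J
      by (simp add: sum_distrib_left mult.assoc)
    then show ?thesis by (simp only: sum.insert[OF insert.hyps, of "\<lambda>i. x i * (\<Sum>j\<in>insert k I. A i j * x j)"])
  qed
  have IH: "\<exists>x. \<forall>i\<in>I. (\<Sum>j\<in>I. A i j * x j) = b i" for b
  proof (rule insert.IH)
    fix x i assume le: "(\<Sum>i\<in>I. \<Sum>j\<in>I. x i * A i j * x j) \<le> 0" and i: "i \<in> I"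
    define x' where "x' = x(k := 0)"
    have "(\<Sum>i\<in>insert k I. \<Sum>j\<in>insert k I. x' i * A i j * x' j) = (\<Sum>i\<in>I. \<Sum>j\<in>I. x i * A i j * x j)"
      using insert.hyps by (auto simp: x'_def intro!: sum.cong)
    then have "x' i = 0" using pd[of x' i] le i by simp
    then show "x i = 0" using i insert.hyps by (auto simp: x'_def split: if_splits)
  qed (use sym in blast)
  obtain y where y: "\<And>i. i \<in> I \<Longrightarrow> (\<Sum>j\<in>I. A i j * y j) = b i" using IH[of b] by blast
  obtain z where z: "\<And>i. i \<in> I \<Longrightarrow> (\<Sum>j\<in>I. A i j * z j) = A i k" using IH[of "\<lambda>i. A i k"] by blast
  define s where "s = A k k - (\<Sum>j\<in>I. A k j * z j)"
  have "s \<noteq> 0"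
  proof
    assume "s = 0"
    define x where "x = (\<lambda>i. - z i)(k := 1)"
    have 1: "(\<Sum>j\<in>insert k I. A i j * x j) = A i k - (\<Sum>j\<in>I. A i j * z j)" for i
    proof -
      have "(\<Sum>j\<in>I. A i j * x j) = (\<Sum>j\<in>I. - (A i j * z j))"
        using insert.hyps by (intro sum.cong) (auto simp: x_def)
      then show ?thesis using insert.hyps by (simp add: x_def sum_negf)
    qed
    have "(\<Sum>i\<in>insert k I. \<Sum>j\<in>insert k I. x i * A i j * x j) = 0"
      unfolding form 1 using \<open>s = 0\<close> z by (simp add: s_def)
    then have "x k = 0" using pd[of x k] by simp
    then show False by (simp add: x_def)
  qed
  define c where "c = (b k - (\<Sum>j\<in>I. A k j * y j)) / s"
  define x where "x = (\<lambda>i. y i - c * z i)(k := c)"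
  have sol: "(\<Sum>j\<in>insert k I. A i j * x j) = A i k * c + (\<Sum>j\<in>I. A i j * y j) - c * (\<Sum>j\<in>I. A i j * z j)" for i
  proof -
    have "(\<Sum>j\<in>I. A i j * x j) = (\<Sum>j\<in>I. A i j * y j - c * (A i j * z j))"
      using insert.hyps by (intro sum.cong) (auto simp: x_def algebra_simps)
    then show ?thesis using insert.hyps by (simp add: x_def sum_subtractf sum_distrib_left)
  qed
  have "(\<Sum>j\<in>insert k I. A i j * x j) = b i" if "i \<in> insert k I" for i
  proof (cases "i = k")
    case True
    have "A k k * c - c * (\<Sum>j\<in>I. A k j * z j) = c * s" by (simp add: s_def algebra_simps)
    also have "c * s = b k - (\<Sum>j\<in>I. A k j * y j)" using \<open>s \<noteq> 0\<close> by (simp add: c_def)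
    finally show ?thesis unfolding sol True by simp
  next
    case False
    then have "i \<in> I" using that by simp
    then show ?thesis unfolding sol y[OF \<open>i \<in> I\<close>] z[OF \<open>i \<in> I\<close>] by simp
  qed
  then show ?case by blast
qed

text \<open>
  Normal equations of weighted least squares: observations \<open>p \<in> P\<close> with weights \<open>w p\<close> and regressors
  \<open>e r p\<close>. In the network, \<open>p\<close> is an ordered pair of nodes and \<open>w p\<close> its true rate.
\<close>
locale weighted_design =
  fixes P :: "'e set" and N :: nat and e :: "nat \<Rightarrow> 'e \<Rightarrow> real" and w :: "'e \<Rightarrow> real"
  assumes finite_P: "finite P"
    and w_pos: "\<And>p. p \<in> P \<Longrightarrow> 0 < w p"
    and identifiable: "\<And>x r. (\<And>p. p \<in> P \<Longrightarrow> (\<Sum>r=1..N. x r * e r p) = 0) \<Longrightarrow> r \<in> {1..N} \<Longrightarrow> x r = 0"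
begin

definition fit :: "(nat \<Rightarrow> real) \<Rightarrow> 'e \<Rightarrow> real" where
  "fit x p = (\<Sum>r=1..N. x r * e r p)"

definition gram :: "nat \<Rightarrow> nat \<Rightarrow> real" where
  "gram r s = (\<Sum>p\<in>P. e r p * e s p * w p)"

lemma fit_add: "fit (\<lambda>r. x r + y r) p = fit x p + fit y p"
  by (simp add: fit_def algebra_simps sum.distrib)

lemma fit_diff: "fit (\<lambda>r. x r - y r) p = fit x p - fit y p"
  by (simp add: fit_def algebra_simps sum_subtractf)

lemma fit_sum: "fit (\<lambda>r. \<Sum>l\<in>L. c l * x l r) p = (\<Sum>l\<in>L. c l * fit (x l) p)"
  unfolding fit_def sum_distrib_left sum_distrib_right
  by (subst sum.swap) (simp add: mult.assoc)

lemma gram_fit: "(\<Sum>s=1..N. gram r s * x s) = (\<Sum>p\<in>P. e r p * (w p * fit x p))"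
  unfolding gram_def fit_def sum_distrib_left sum_distrib_right
  by (subst sum.swap) (simp add: mult_ac)

lemma orthogonal_to_fit:
  assumes "\<And>r. r \<in> {1..N} \<Longrightarrow> (\<Sum>p\<in>P. e r p * v p) = 0"
  shows "(\<Sum>p\<in>P. fit x p * v p) = 0"
proof -
  have "(\<Sum>p\<in>P. fit x p * v p) = (\<Sum>r=1..N. x r * (\<Sum>p\<in>P. e r p * v p))"
    unfolding fit_def sum_distrib_left sum_distrib_right
    by (subst sum.swap) (simp add: mult_ac)
  also have "\<dots> = 0" by (rule sum.neutral) (use assms in auto)
  finally show ?thesis .
qed

lemma weighted_square_zero:
  assumes "(\<Sum>p\<in>P. v p * (w p * v p)) \<le> 0" "p \<in> P"
  shows "v p = 0"
proof -
  have nn: "0 \<le> v p * (w p * v p)" if "p \<in> P" for p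
    using mult_nonneg_nonneg[OF less_imp_le[OF w_pos[OF that]] zero_le_square[of "v p"]]
    by (simp only: mult.left_commute)
  have "(\<Sum>p\<in>P. v p * (w p * v p)) = 0"
    by (rule antisym[OF assms(1)]) (rule sum_nonneg[OF nn])
  then have "v p * (w p * v p) = 0"
    using sum_nonneg_eq_0_iff[of P "\<lambda>p. v p * (w p * v p)"] finite_P nn assms(2) by blast
  then show ?thesis using w_pos[OF assms(2)] by simp
qed

lemma normal_equations_zero:
  assumes "\<And>r. r \<in> {1..N} \<Longrightarrow> (\<Sum>p\<in>P. e r p * (w p * fit x p)) = 0" "p \<in> P"
  shows "fit x p = 0"
proof (rule weighted_square_zero[OF _ assms(2)])
  show "(\<Sum>p\<in>P. fit x p * (w p * fit x p)) \<le> 0"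
    using orthogonal_to_fit[of "\<lambda>p. w p * fit x p" x] assms(1) by simp
qed

lemma gram_solvable: "\<exists>x. \<forall>r\<in>{1..N}. (\<Sum>s=1..N. gram r s * x s) = b r"
proof (rule pos_def_system_solvable)
  fix x r assume le: "(\<Sum>i=1..N. \<Sum>j=1..N. x i * gram i j * x j) \<le> 0" and r: "r \<in> {1..N}"
  have "(\<Sum>i=1..N. \<Sum>j=1..N. x i * gram i j * x j) = (\<Sum>i=1..N. x i * (\<Sum>p\<in>P. e i p * (w p * fit x p)))"
    unfolding gram_fit[symmetric] by (simp add: sum_distrib_left mult.assoc)
  also have "\<dots> = (\<Sum>p\<in>P. fit x p * (w p * fit x p))"
    unfolding fit_def[of x] sum_distrib_left sum_distrib_right
    by (subst sum.swap) (simp add: mult_ac)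
  finally have "(\<Sum>p\<in>P. fit x p * (w p * fit x p)) \<le> 0" using le by simp
  then have "fit x p = 0" if "p \<in> P" for p using weighted_square_zero that by blast
  then show "x r = 0" using identifiable[of x r] r by (simp add: fit_def)
qed (auto simp: gram_def mult_ac)

lemma normal_equations_solvable:
  "\<exists>x. \<forall>r\<in>{1..N}. (\<Sum>p\<in>P. e r p * (w p * fit x p - f p)) = 0"
proof -
  obtain x where "\<forall>r\<in>{1..N}. (\<Sum>s=1..N. gram r s * x s) = (\<Sum>p\<in>P. e r p * f p)"
    using gram_solvable[of "\<lambda>r. \<Sum>p\<in>P. e r p * f p"] by blast
  then show ?thesis
    unfolding gram_fit by (auto simp: right_diff_distrib sum_subtractf)
qed

lemma is_inverse_gram: "is_inverse_upto N gram (inverse_upto N gram)"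
proof -
  obtain B where B: "\<And>s r. r \<in> {1..N} \<Longrightarrow> (\<Sum>k=1..N. gram r k * B s k) = of_bool (r = s)"
    using gram_solvable[of "\<lambda>r. of_bool (r = s)" for s] by metis
  have sym: "gram r s = gram s r" for r s by (simp add: gram_def mult_ac)
  have B_sym: "B s r = B r s" if "r \<in> {1..N}" "s \<in> {1..N}" for r s
  proof -
    have "B s r = (\<Sum>k=1..N. of_bool (k = r) * B s k)" using that by (simp add: sum_of_bool_mult)
    also have "\<dots> = (\<Sum>k=1..N. (\<Sum>l=1..N. gram k l * B r l) * B s k)"
      by (intro sum.cong refl) (simp only: B)
    also have "\<dots> = (\<Sum>l=1..N. \<Sum>k=1..N. (gram k l * B r l) * B s k)"
      unfolding sum_distrib_right by (rule sum.swap)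
    also have "\<dots> = (\<Sum>l=1..N. (\<Sum>k=1..N. gram l k * B s k) * B r l)"
      unfolding sum_distrib_right by (intro sum.cong refl) (simp add: gram_def mult_ac)
    also have "\<dots> = (\<Sum>l=1..N. of_bool (l = s) * B r l)"
      by (intro sum.cong refl) (simp only: B)
    also have "\<dots> = B r s" using that by (simp add: sum_of_bool_mult)
    finally show ?thesis .
  qed
  have "is_inverse_upto N gram (\<lambda>r s. B s r)"
    unfolding is_inverse_upto_def
  proof (intro ballI conjI)
    fix i j assume ij: "i \<in> {1..N}" "j \<in> {1..N}"
    show "(\<Sum>k=1..N. gram i k * B j k) = of_bool (i = j)" by (rule B[OF ij(1)])
    have "(\<Sum>k=1..N. B k i * gram k j) = (\<Sum>k=1..N. gram j k * B i k)"
    proof (rule sum.cong[OF refl])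
      fix k assume "k \<in> {1..N}"
      then show "B k i * gram k j = gram j k * B i k"
        using B_sym[OF ij(1)] sym[of k j] by simp
    qed
    also have "\<dots> = of_bool (j = i)" by (rule B[OF ij(2)])
    finally show "(\<Sum>k=1..N. B k i * gram k j) = of_bool (i = j)" by (simp only: eq_commute)
  qed
  then show ?thesis unfolding inverse_upto_def by (rule someI[where P = "is_inverse_upto N gram"])
qed

end

locale weighted_design_covariates = weighted_design P N e w
  for P :: "'e set" and N e w +
  fixes Z :: "'e \<Rightarrow> real^'p"
begin

text \<open>
  Coefficients of minus the weighted regression of the covariate \<open>Z\<^sub>l\<close> on the design, written with
  the inverse Gram matrix as in the definition of \<open>H\<close>. Thus \<open>resid\<close> is the part of \<open>Z\<close> orthogonal to
  the design, and \<open>schur\<close> is the information about \<open>\<gamma>\<close> after profiling out \<open>\<theta>\<close>.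
\<close>
definition proj :: "'p \<Rightarrow> nat \<Rightarrow> real" where
  "proj l r = - (\<Sum>s=1..N. inverse_upto N gram r s * (\<Sum>p\<in>P. e s p * (w p * Z p $ l)))"

definition resid :: "'e \<Rightarrow> real^'p" where
  "resid p = (\<chi> l. Z p $ l + fit (proj l) p)"

definition schur :: "real^'p^'p" where
  "schur = (\<chi> k l. \<Sum>p\<in>P. Z p $ k * (w p * resid p $ l))"

lemma resid_orthogonal:
  assumes "r \<in> {1..N}"
  shows "(\<Sum>p\<in>P. e r p * (w p * resid p $ l)) = 0"
proof -
  define b where "b s = (\<Sum>p\<in>P. e s p * (w p * Z p $ l))" for s
  have "(\<Sum>s=1..N. gram r s * proj l s) = - (\<Sum>t=1..N. (\<Sum>s=1..N. gram r s * inverse_upto N gram s t) * b t)"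
    unfolding proj_def b_def[symmetric] mult_minus_right sum_negf sum_distrib_left sum_distrib_right
    by (subst sum.swap) (simp add: mult_ac)
  also have "\<dots> = - (\<Sum>t=1..N. of_bool (r = t) * b t)"
    using is_inverse_gram assms by (auto simp: is_inverse_upto_def intro!: sum.cong)
  also have "\<dots> = - b r" using assms by (simp add: sum_of_bool_mult)
  finally show ?thesis
    unfolding gram_fit b_def by (simp add: resid_def distrib_left sum.distrib)
qed

lemma inner_resid: "resid p \<bullet> g = Z p \<bullet> g + (\<Sum>l\<in>UNIV. g $ l * fit (proj l) p)"
  by (simp add: inner_vec_def resid_def algebra_simps sum.distrib)

lemma schur_mult: "(schur *v g) $ k = (\<Sum>p\<in>P. Z p $ k * (w p * (resid p \<bullet> g)))"
  unfolding matrix_vector_mult_def schur_def inner_vec_def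
  by (simp add: sum_distrib_left sum_distrib_right mult_ac) (subst sum.swap, simp)

lemma resid_inner_orthogonal:
  assumes "r \<in> {1..N}"
  shows "(\<Sum>p\<in>P. e r p * (w p * (resid p \<bullet> g))) = 0"
proof -
  have "(\<Sum>p\<in>P. e r p * (w p * (resid p \<bullet> g))) = (\<Sum>l\<in>UNIV. g $ l * (\<Sum>p\<in>P. e r p * (w p * resid p $ l)))"
    unfolding inner_vec_def sum_distrib_left by (subst sum.swap) (simp add: mult_ac)
  then show ?thesis by (simp add: resid_orthogonal[OF assms])
qed

text \<open>
  Removing a projection does not increase the weighted norm of a covariate.
\<close>
lemma schur_diag_le: "schur $ k $ k \<le> (\<Sum>p\<in>P. w p * (Z p $ k)\<^sup>2)"
proof -
  have "0 \<le> (\<Sum>p\<in>P. w p * (fit (proj k) p)\<^sup>2)"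
    using w_pos by (intro sum_nonneg) (auto simp: less_imp_le)
  also have "\<dots> = (\<Sum>p\<in>P. fit (proj k) p * (w p * resid p $ k)
      + (w p * (Z p $ k)\<^sup>2 - Z p $ k * (w p * resid p $ k)))"
    by (intro sum.cong refl) (simp add: resid_def power2_eq_square algebra_simps)
  also have "\<dots> = (\<Sum>p\<in>P. w p * (Z p $ k)\<^sup>2) - schur $ k $ k"
    by (simp only: sum.distrib sum_subtractf orthogonal_to_fit[OF resid_orthogonal])
      (simp add: schur_def)
  finally show ?thesis by simp
qed

text \<open>
  Block elimination for the linearised scores: \<open>x0\<close> fits the data \<open>f\<close> by the design alone, and \<open>g\<close>
  then solves the system for the residual covariates. Orthogonality of \<open>resid\<close> to the design keeps
  the first set of equations intact.
\<close>
lemma linear_solution: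
  assumes x0: "\<And>r. r \<in> {1..N} \<Longrightarrow> (\<Sum>p\<in>P. e r p * (w p * fit x0 p - f p)) = 0"
    and g: "schur *v g = (\<Sum>p\<in>P. f p *\<^sub>R resid p)"
    and t: "\<And>p. p \<in> P \<Longrightarrow> t p = fit x0 p + resid p \<bullet> g"
  shows "\<And>r. r \<in> {1..N} \<Longrightarrow> (\<Sum>p\<in>P. e r p * (w p * t p - f p)) = 0"
    and "(\<Sum>p\<in>P. (w p * t p - f p) *\<^sub>R Z p) = 0"
    and "\<And>p. p \<in> P \<Longrightarrow> t p = fit (\<lambda>r. x0 r + (\<Sum>l\<in>UNIV. g $ l * proj l r)) p + Z p \<bullet> g"
proof -
  fix r assume r: "r \<in> {1..N}"
  have "(\<Sum>p\<in>P. e r p * (w p * t p - f p)) = (\<Sum>p\<in>P. e r p * (w p * fit x0 p - f p) + e r p * (w p * (resid p \<bullet> g)))"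
    by (intro sum.cong) (auto simp: t algebra_simps)
  then show "(\<Sum>p\<in>P. e r p * (w p * t p - f p)) = 0"
    by (simp only: sum.distrib x0[OF r] resid_inner_orthogonal[OF r])
next
  show "t p = fit (\<lambda>r. x0 r + (\<Sum>l\<in>UNIV. g $ l * proj l r)) p + Z p \<bullet> g" if "p \<in> P" for p
    using that by (simp add: t fit_add fit_sum inner_resid)
next
  have "(\<Sum>p\<in>P. (w p * t p - f p) *\<^sub>R Z p) $ k = 0" for k
  proof -
    have 1: "(\<Sum>p\<in>P. fit x0 p * (w p * resid p $ k)) = 0"
      by (rule orthogonal_to_fit) (rule resid_orthogonal)
    have 2: "(\<Sum>p\<in>P. fit (proj k) p * (w p * fit x0 p - f p)) = 0"
      by (rule orthogonal_to_fit) (rule x0)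
    have 3: "(\<Sum>p\<in>P. Z p $ k * (w p * (resid p \<bullet> g))) = (\<Sum>p\<in>P. f p * resid p $ k)"
      using arg_cong[OF g, of "\<lambda>v. v $ k"] by (simp add: schur_mult)
    have "(\<Sum>p\<in>P. (w p * t p - f p) *\<^sub>R Z p) $ k = (\<Sum>p\<in>P. (w p * t p - f p) * Z p $ k)"
      by simp
    also have "\<dots> = (\<Sum>p\<in>P. fit x0 p * (w p * resid p $ k) - fit (proj k) p * (w p * fit x0 p - f p)
        + (Z p $ k * (w p * (resid p \<bullet> g)) - f p * resid p $ k))"
      by (intro sum.cong) (auto simp: t resid_def algebra_simps)
    also have "\<dots> = 0" by (simp only: sum.distrib sum_subtractf 1 2 3)
    finally show ?thesis .
  qed
  then show "(\<Sum>p\<in>P. (w p * t p - f p) *\<^sub>R Z p) = 0" by (simp add: vec_eq_iff)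
qed

lemma combined_identifiable:
  assumes ker: "\<And>g. schur *v g = 0 \<Longrightarrow> g = 0"
    and zero: "\<And>p. p \<in> P \<Longrightarrow> fit x p + Z p \<bullet> g = 0"
  shows "g = 0" "\<And>r. r \<in> {1..N} \<Longrightarrow> x r = 0"
proof -
  define v where "v = (\<lambda>r. (\<Sum>l\<in>UNIV. g $ l * proj l r) - x r)"
  have v: "resid p \<bullet> g = fit v p" if "p \<in> P" for p
    using zero[OF that] by (simp add: inner_resid v_def fit_diff fit_sum)
  have "fit v p = 0" if "p \<in> P" for p
  proof (rule normal_equations_zero[OF _ that])
    fix r assume "r \<in> {1..N}"
    from resid_inner_orthogonal[OF this, of g] show "(\<Sum>p\<in>P. e r p * (w p * fit v p)) = 0"
      by (simp add: v cong: sum.cong)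
  qed
  then have "schur *v g = 0" by (simp add: vec_eq_iff schur_mult v cong: sum.cong)
  then show g0: "g = 0" by (rule ker)
  show "x r = 0" if "r \<in> {1..N}" for r
    using identifiable[of x r] zero that by (simp add: g0 fit_def)
qed

end

section \<open>Solving the score equations of a network\<close>

definition num_params :: "nat \<Rightarrow> nat" where
  "num_params n = 2 * n - 1"

text \<open>
  The derivative of \<open>\<alpha>\<^sub>i + \<beta>\<^sub>j\<close> with respect to the \<open>r\<close>-th coordinate of \<open>\<theta>\<close>; the parameter
  \<open>\<beta>\<^sub>n = 0\<close> has no coordinate.
\<close>
definition design :: "nat \<Rightarrow> nat \<Rightarrow> nat \<times> nat \<Rightarrow> real" where
  "design n r p = of_bool (r = fst p) + of_bool (snd p \<noteq> n \<and> r = n + snd p)"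

definition row_total :: "nat \<Rightarrow> (nat \<times> nat \<Rightarrow> real) \<Rightarrow> nat \<Rightarrow> real" where
  "row_total n v i = (\<Sum>j\<in>{1..n} - {i}. v (i, j))"

definition col_total :: "nat \<Rightarrow> (nat \<times> nat \<Rightarrow> real) \<Rightarrow> nat \<Rightarrow> real" where
  "col_total n v j = (\<Sum>i\<in>{1..n} - {j}. v (i, j))"

definition lin_pred :: "nat \<Rightarrow> (nat \<Rightarrow> real) \<Rightarrow> nat \<Rightarrow> nat \<Rightarrow> real" where
  "lin_pred n x i j = alpha_of x i + beta_of n x j"

lemma design_sum:
  assumes "(i, j) \<in> off_diag n"
  shows "(\<Sum>r=1..num_params n. x r * design n r (i, j)) = lin_pred n x i j"
proof -
  have ij: "i \<in> {1..num_params n}" "j \<noteq> n \<Longrightarrow> n + j \<in> {1..num_params n}"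
    using assms by (auto simp: off_diag_def num_params_def)
  have "(\<Sum>r=1..num_params n. x r * design n r (i, j))
      = (\<Sum>r=1..num_params n. of_bool (r = i) * x r) + of_bool (j \<noteq> n) * (\<Sum>r=1..num_params n. of_bool (r = n + j) * x r)"
    by (simp add: design_def distrib_left sum.distrib sum_distrib_left mult_ac of_bool_conj)
  also have "(\<Sum>r=1..num_params n. of_bool (r = i) * x r) = x i"
    using ij(1) by (intro sum_of_bool_mult) auto
  also have "of_bool (j \<noteq> n) * (\<Sum>r=1..num_params n. of_bool (r = n + j) * x r) = beta_of n x j"
  proof (cases "j = n")
    case False
    then have "(\<Sum>r=1..num_params n. of_bool (r = n + j) * x r) = x (n + j)"
      using ij(2) by (intro sum_of_bool_mult) auto
    then show ?thesis using False by (simp add: beta_of_def)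
  qed (simp add: beta_of_def)
  finally show ?thesis by (simp add: lin_pred_def alpha_of_def)
qed

lemma design_row_total:
  assumes "r \<in> {1..n}"
  shows "(\<Sum>p\<in>off_diag n. design n r p * v p) = row_total n v r"
proof -
  have "(\<Sum>p\<in>off_diag n. design n r p * v p) = (\<Sum>i=1..n. of_bool (r = i) * row_total n v i)"
    unfolding sum_off_diag_rows row_total_def sum_distrib_left
    using assms by (intro sum.cong refl) (auto simp: design_def)
  then show ?thesis using assms by (simp only: sum_of_bool_mult finite_atLeastAtMost)
qed

lemma design_col_total:
  assumes "j \<in> {1..n}" "j \<noteq> n"
  shows "(\<Sum>p\<in>off_diag n. design n (n + j) p * v p) = col_total n v j"
proof -
  have "(\<Sum>p\<in>off_diag n. design n (n + j) p * v p) = (\<Sum>k=1..n. of_bool (j = k) * col_total n v k)"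
    unfolding sum_off_diag_cols col_total_def sum_distrib_left
    using assms by (intro sum.cong refl) (auto simp: design_def)
  then show ?thesis using assms by (simp only: sum_of_bool_mult finite_atLeastAtMost)
qed

lemma row_total_indicator:
  assumes "i \<in> {1..n}"
  shows "row_total n v i = (\<Sum>p\<in>off_diag n. of_bool (fst p = i) * v p)"
proof -
  have "(\<Sum>p\<in>off_diag n. of_bool (fst p = i) * v p) = (\<Sum>k=1..n. of_bool (k = i) * row_total n v k)"
    unfolding sum_off_diag_rows row_total_def sum_distrib_left by simp
  then show ?thesis using assms by (simp only: sum_of_bool_mult finite_atLeastAtMost)
qed

lemma col_total_indicator:
  assumes "i \<in> {1..n}"
  shows "col_total n v i = (\<Sum>p\<in>off_diag n. of_bool (snd p = i) * v p)"
proof -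
  have "(\<Sum>p\<in>off_diag n. of_bool (snd p = i) * v p) = (\<Sum>k=1..n. of_bool (k = i) * col_total n v k)"
    unfolding sum_off_diag_cols col_total_def sum_distrib_left by simp
  then show ?thesis using assms by (simp only: sum_of_bool_mult finite_atLeastAtMost)
qed

text \<open>
  The \<open>2 n - 1\<close> equations contain no column total for \<open>n\<close>, but the row totals and the column totals
  have the same sum.
\<close>
lemma normal_equations_totals:
  assumes "\<And>r. r \<in> {1..num_params n} \<Longrightarrow> (\<Sum>p\<in>off_diag n. design n r p * v p) = 0" "i \<in> {1..n}"
  shows "row_total n v i = 0" "col_total n v i = 0"
proof -
  have row: "row_total n v k = 0" if "k \<in> {1..n}" for k
    using assms(1)[of k] design_row_total[OF that, of v] that by (auto simp: num_params_def)
  have col: "col_total n v k = 0" if "k \<in> {1..n}" "k \<noteq> n" for k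
    using assms(1)[of "n + k"] design_col_total[OF that, of v] that by (auto simp: num_params_def)
  show "row_total n v i = 0" by (rule row[OF assms(2)])
  have "(\<Sum>k=1..n. col_total n v k) = (\<Sum>k=1..n. row_total n v k)"
    unfolding row_total_def col_total_def
    by (simp only: sum_off_diag_rows[symmetric] sum_off_diag_cols[symmetric])
  also have "\<dots> = 0" using row by (intro sum.neutral) auto
  finally have "(\<Sum>k=1..n. col_total n v k) = 0" .
  moreover have "(\<Sum>k\<in>{1..n} - {n}. col_total n v k) = 0" using col by (intro sum.neutral) auto
  moreover have "n \<in> {1..n}" using assms(2) by auto
  ultimately have "col_total n v n = 0" by (metis add.right_neutral finite_atLeastAtMost sum.remove)
  then show "col_total n v i = 0" using col[OF assms(2)] by (cases "i = n") auto
qed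

lemma total_diff:
  "row_total n (\<lambda>p. u p - v p) i = row_total n u i - row_total n v i"
  "col_total n (\<lambda>p. u p - v p) i = col_total n u i - col_total n v i"
  by (simp_all add: row_total_def col_total_def sum_subtractf)

lemma abs_total_le:
  assumes "\<And>p. p \<in> off_diag n \<Longrightarrow> \<bar>v p\<bar> \<le> c" "0 \<le> c" "i \<in> {1..n}"
  shows "\<bar>row_total n v i\<bar> \<le> real n * c" "\<bar>col_total n v i\<bar> \<le> real n * c"
proof -
  have card: "real (card ({1..n} - {i})) * c \<le> real n * c"
    using assms by (intro mult_right_mono) auto
  have "\<bar>row_total n v i\<bar> \<le> (\<Sum>j\<in>{1..n} - {i}. c)" unfolding row_total_def
    by (rule order_trans[OF sum_abs], rule sum_mono) (use assms in \<open>auto simp: off_diag_iff\<close>)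
  then show "\<bar>row_total n v i\<bar> \<le> real n * c" using card by simp
  have "\<bar>col_total n v i\<bar> \<le> (\<Sum>j\<in>{1..n} - {i}. c)" unfolding col_total_def
    by (rule order_trans[OF sum_abs], rule sum_mono) (use assms in \<open>auto simp: off_diag_iff\<close>)
  then show "\<bar>col_total n v i\<bar> \<le> real n * c" using card by simp
qed

lemma abs_inner_le:
  fixes u v :: "real^'p"
  assumes "\<And>l. \<bar>u $ l\<bar> \<le> a" "\<And>l. \<bar>v $ l\<bar> \<le> b" "0 \<le> a"
  shows "\<bar>u \<bullet> v\<bar> \<le> real CARD('p) * a * b"
proof -
  have b: "0 \<le> b" by (rule order_trans[OF abs_ge_zero assms(2)])
  have "\<bar>u \<bullet> v\<bar> \<le> (\<Sum>l\<in>UNIV. \<bar>u $ l * v $ l\<bar>)"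
    unfolding inner_vec_def inner_real_def by (rule sum_abs)
  also have "\<dots> \<le> (\<Sum>l\<in>(UNIV::'p set). a * b)"
    unfolding abs_mult by (intro sum_mono mult_mono assms abs_ge_zero)
  finally show ?thesis by (simp add: mult.assoc)
qed

lemma row_sum_le_row_sum_norm: "(\<Sum>j\<in>UNIV. \<bar>A $ i $ j\<bar>) \<le> row_sum_norm A"
  unfolding row_sum_norm_def by (rule Max_ge) auto

lemma abs_matrix_vector_le:
  fixes A :: "real^'p^'p"
  assumes "row_sum_norm A \<le> K" "\<And>l. \<bar>b $ l\<bar> \<le> \<beta>"
  shows "\<bar>(A *v b) $ k\<bar> \<le> K * \<beta>"
proof -
  have "0 \<le> \<beta>" using assms(2)[of k] by linarith
  have "\<bar>(A *v b) $ k\<bar> \<le> (\<Sum>j\<in>UNIV. \<bar>A $ k $ j * b $ j\<bar>)"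
    unfolding matrix_vector_mult_def vec_lambda_beta by (rule sum_abs)
  also have "\<dots> \<le> (\<Sum>j\<in>UNIV. \<bar>A $ k $ j\<bar> * \<beta>)"
    unfolding abs_mult by (intro sum_mono mult_left_mono assms abs_ge_zero)
  also have "\<dots> \<le> K * \<beta>"
    unfolding sum_distrib_right[symmetric]
    by (rule mult_right_mono[OF order_trans[OF row_sum_le_row_sum_norm assms(1)] \<open>0 \<le> \<beta>\<close>])
  finally show ?thesis .
qed

locale network =
  fixes n :: nat and w :: "nat \<times> nat \<Rightarrow> real" and Z :: "nat \<times> nat \<Rightarrow> real^'p"
  assumes n_ge_5: "5 \<le> n" and weights_pos: "\<And>p. p \<in> off_diag n \<Longrightarrow> 0 < w p"
begin

lemma lin_pred_zero:
  assumes zero: "\<And>i j. (i, j) \<in> off_diag n \<Longrightarrow> lin_pred n x i j = 0" and r: "r \<in> {1..num_params n}"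
  shows "x r = 0"
proof -
  have small: "x i = 0" if "1 \<le> i" "i < n" for i
    using zero[of i n] that by (auto simp: off_diag_def lin_pred_def alpha_of_def beta_of_def)
  have beta: "x (n + j) = 0" if "1 \<le> j" "j < n" for j
  proof -
    define i where "i = (if j = 1 then 2 else 1 :: nat)"
    have "1 \<le> i" "i < n" "i \<noteq> j" using n_ge_5 by (auto simp: i_def)
    then show ?thesis using zero[of i j] small[of i] that
      by (auto simp: off_diag_def lin_pred_def alpha_of_def beta_of_def)
  qed
  have "x n = 0" using zero[of n 1] beta[of 1] n_ge_5
    by (auto simp: off_diag_def lin_pred_def alpha_of_def beta_of_def)
  moreover have "x r = 0" if "n < r" using beta[of "r - n"] that r by (auto simp: num_params_def)
  ultimately show ?thesis using small[of r] r by (cases "r < n"; cases "r = n") auto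
qed

sublocale weighted_design_covariates "off_diag n" "num_params n" "design n" w Z
proof
  show "0 < w p" if "p \<in> off_diag n" for p
    by (rule weights_pos[OF that])
  show "x r = 0" if "\<And>p. p \<in> off_diag n \<Longrightarrow> (\<Sum>r=1..num_params n. x r * design n r p) = 0" "r \<in> {1..num_params n}" for x r
  proof (rule lin_pred_zero[OF _ that(2)])
    fix i j assume "(i, j) \<in> off_diag n"
    then show "lin_pred n x i j = 0" using that(1) design_sum by metis
  qed
qed simp

lemma fit_eq: "(i, j) \<in> off_diag n \<Longrightarrow> fit x (i, j) = lin_pred n x i j"
  unfolding fit_def by (rule design_sum)

lemma totals_pos:
  assumes "i \<in> {1..n}"
  shows "0 < row_total n w i" "0 < col_total n w i"
proof -
  have ne: "{1..n} - {i} \<noteq> {}"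
  proof
    assume "{1..n} - {i} = {}"
    then have "card {1..n} \<le> card {i}" by (intro card_mono) auto
    then show False using n_ge_5 by simp
  qed
  have pos: "0 < w (i, j)" "0 < w (j, i)" if "j \<in> {1..n} - {i}" for j
    using that assms by (auto intro!: w_pos simp: off_diag_iff)
  show "0 < row_total n w i" "0 < col_total n w i"
    unfolding row_total_def col_total_def by (rule sum_pos[OF _ ne]; use pos in simp)+
qed

lemma sum_abs_le_square:
  assumes "\<And>p. p \<in> off_diag n \<Longrightarrow> \<bar>v p\<bar> \<le> c" "0 \<le> c"
  shows "\<bar>\<Sum>p\<in>off_diag n. v p\<bar> \<le> (real n)\<^sup>2 * c"
proof -
  have "\<bar>\<Sum>p\<in>off_diag n. v p\<bar> \<le> (\<Sum>p\<in>off_diag n. c)"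
    by (rule order_trans[OF sum_abs], rule sum_mono) (use assms in auto)
  also have "\<dots> = real n * (real n - 1) * c" using n_ge_5 by (intro card_off_diag) simp
  also have "\<dots> \<le> (real n)\<^sup>2 * c"
    unfolding power2_eq_square using assms by (intro mult_right_mono mult_left_mono) auto
  finally show ?thesis .
qed

text \<open>
  A lower bound on \<open>\<kappa>\<close>, since \<open>schur\<close> cannot be large. The growth condition bounds only the product of
  \<open>\<kappa>\<close> and a power of \<open>e\<^sup>\<rho>\<close>; this lemma converts it into a bound on \<open>e\<^sup>\<rho>\<close> itself, from which the
  condition \<open>4 M\<^sup>2 + 1 \<le> n\<close> of the maximum principle follows.
\<close>
lemma inverse_bound_lower:
  assumes pd: "pos_def_mat schur" and inv: "row_sum_norm (matrix_inv schur) \<le> \<kappa> / (real n)\<^sup>2"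
    and w: "\<And>p. p \<in> off_diag n \<Longrightarrow> w p \<le> M" and Z: "\<And>p l. p \<in> off_diag n \<Longrightarrow> \<bar>Z p $ l\<bar> \<le> q"
    and nonneg: "0 \<le> M" "0 \<le> q"
  shows "1 \<le> \<kappa> * (M * q\<^sup>2)"
proof -
  fix k :: 'p
  let ?c = "(real n)\<^sup>2 * (M * q\<^sup>2)"
  have diag: "schur $ l $ l \<le> ?c" for l
  proof -
    have "\<bar>w p * (Z p $ l)\<^sup>2\<bar> \<le> M * q\<^sup>2" if "p \<in> off_diag n" for p
      using w[OF that] w_pos[OF that] Z[OF that, of l] nonneg
      by (auto simp: abs_mult abs_le_square_iff[symmetric] intro!: mult_mono)
    then have "\<bar>\<Sum>p\<in>off_diag n. w p * (Z p $ l)\<^sup>2\<bar> \<le> ?c"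
      by (rule sum_abs_le_square) (use nonneg in auto)
    then show ?thesis using schur_diag_le[of l] by linarith
  qed
  have entry: "\<bar>schur $ l $ k\<bar> \<le> ?c" for l
    using pos_def_mat_entry_le[OF pd, of l k] diag[of l] diag[of k] by linarith
  have "1 = \<bar>(matrix_inv schur *v (\<chi> l. schur $ l $ k)) $ k\<bar>"
    using arg_cong[OF matrix_inv_works(2)[OF pos_def_mat_invertible[OF pd]], of "\<lambda>A. A $ k $ k"]
    by (simp add: matrix_matrix_mult_def matrix_vector_mult_def mat_def)
  also have "\<dots> \<le> \<kappa> / (real n)\<^sup>2 * ?c"
    by (rule abs_matrix_vector_le[OF inv]) (simp add: entry)
  finally show ?thesis using n_ge_5 by simp
qed

end

locale bounded_network = network n w Z
  for n :: nat and w :: "nat \<times> nat \<Rightarrow> real" and M :: real and Z :: "nat \<times> nat \<Rightarrow> real^'p" and q :: real +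
  assumes w_bounds: "\<And>p. p \<in> off_diag n \<Longrightarrow> 1 / M \<le> w p" "\<And>p. p \<in> off_diag n \<Longrightarrow> w p \<le> M"
    and M: "1 \<le> M" "4 * M\<^sup>2 + 1 \<le> real n"
    and q: "1 \<le> q"
    and Z_bound: "\<And>p l. p \<in> off_diag n \<Longrightarrow> \<bar>Z p $ l\<bar> \<le> q"
begin

lemma lin_pred_bound:
  assumes eqs: "\<And>r. r \<in> {1..num_params n} \<Longrightarrow> (\<Sum>p\<in>off_diag n. design n r p * (w p * fit x p - f p)) = 0"
    and f: "\<And>i. i \<in> {1..n} \<Longrightarrow> \<bar>row_total n f i\<bar> \<le> B" "\<And>i. i \<in> {1..n} \<Longrightarrow> \<bar>col_total n f i\<bar> \<le> B"
    and ij: "i \<in> {1..n}" "j \<in> {1..n}"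
  shows "\<bar>lin_pred n x i j\<bar> \<le> 12 * M ^ 3 * B / real n"
  unfolding lin_pred_def
proof (rule bipartite_max_principle[OF w_bounds M _ _ ij])
  fix k assume k: "k \<in> {1..n}"
  have "row_total n (\<lambda>p. w p * fit x p) k = row_total n f k"
    using normal_equations_totals(1)[OF eqs k] by (simp add: total_diff)
  moreover have "row_total n (\<lambda>p. w p * fit x p) k = (\<Sum>j\<in>{1..n} - {k}. w (k, j) * (alpha_of x k + beta_of n x j))"
    unfolding row_total_def using k by (intro sum.cong) (auto simp: fit_eq off_diag_iff lin_pred_def)
  ultimately show "\<bar>\<Sum>j\<in>{1..n} - {k}. w (k, j) * (alpha_of x k + beta_of n x j)\<bar> \<le> B"
    using f(1)[OF k] by simp
  have "col_total n (\<lambda>p. w p * fit x p) k = col_total n f k"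
    using normal_equations_totals(2)[OF eqs k] by (simp add: total_diff)
  moreover have "col_total n (\<lambda>p. w p * fit x p) k = (\<Sum>i\<in>{1..n} - {k}. w (i, k) * (alpha_of x i + beta_of n x k))"
    unfolding col_total_def using k by (intro sum.cong) (auto simp: fit_eq off_diag_iff lin_pred_def)
  ultimately show "\<bar>\<Sum>i\<in>{1..n} - {k}. w (i, k) * (alpha_of x i + beta_of n x k)\<bar> \<le> B"
    using f(2)[OF k] by simp
qed

lemma proj_bound:
  assumes "i \<in> {1..n}" "j \<in> {1..n}"
  shows "\<bar>lin_pred n (proj l) i j\<bar> \<le> 12 * M ^ 4 * q"
proof -
  define f where "f p = - (w p * Z p $ l)" for p
  have f: "\<bar>f p\<bar> \<le> M * q" if "p \<in> off_diag n" for p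
    unfolding f_def abs_minus_cancel abs_mult
    using w_bounds(2)[OF that] w_pos[OF that] Z_bound[OF that] M by (intro mult_mono) auto
  have "\<bar>lin_pred n (proj l) i j\<bar> \<le> 12 * M ^ 3 * (real n * (M * q)) / real n"
  proof (rule lin_pred_bound[where f = f, OF _ _ _ assms])
    fix r assume "r \<in> {1..num_params n}"
    from resid_orthogonal[OF this, of l]
    show "(\<Sum>p\<in>off_diag n. design n r p * (w p * fit (proj l) p - f p)) = 0"
      by (simp add: f_def resid_def algebra_simps)
  qed (use abs_total_le[OF f] M q in auto)
  then show ?thesis using n_ge_5 by (simp add: power_numeral_reduce mult_ac)
qed

lemma resid_bound:
  assumes "p \<in> off_diag n"
  shows "\<bar>resid p $ l\<bar> \<le> 13 * M ^ 4 * q"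
proof -
  obtain i j where p: "p = (i, j)" by (cases p)
  have "\<bar>fit (proj l) p\<bar> \<le> 12 * M ^ 4 * q"
    using assms proj_bound[of i j l] by (simp add: p fit_eq) (simp add: off_diag_iff)
  moreover have "q \<le> M ^ 4 * q" using M q one_le_power[of M 4] by (simp add: mult_le_cancel_right1)
  moreover have "resid p $ l = Z p $ l + fit (proj l) p" by (simp add: resid_def)
  ultimately show ?thesis using Z_bound[OF assms, of l] by linarith
qed

text \<open>
  The solution operator \<open>lin_sol\<close> of the linearised scores splits into the fit \<open>sol f\<close> of \<open>f\<close> by the
  design and the covariate part \<open>cov_sol f\<close>.
\<close>
definition sol :: "(nat \<times> nat \<Rightarrow> real) \<Rightarrow> nat \<Rightarrow> real" where
  "sol f = (SOME x. \<forall>r\<in>{1..num_params n}. (\<Sum>p\<in>off_diag n. design n r p * (w p * fit x p - f p)) = 0)"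

lemma sol: "r \<in> {1..num_params n} \<Longrightarrow> (\<Sum>p\<in>off_diag n. design n r p * (w p * fit (sol f) p - f p)) = 0"
  using someI_ex[OF normal_equations_solvable[of f]] unfolding sol_def by blast

definition cov_sol :: "(nat \<times> nat \<Rightarrow> real) \<Rightarrow> real^'p" where
  "cov_sol f = matrix_inv schur *v (\<Sum>p\<in>off_diag n. f p *\<^sub>R resid p)"

definition lin_sol :: "(nat \<times> nat \<Rightarrow> real) \<Rightarrow> nat \<times> nat \<Rightarrow> real" where
  "lin_sol f p = fit (sol f) p + resid p \<bullet> cov_sol f"

end

locale inverse_bounded_network = bounded_network n w M Z q
  for n w M and Z :: "nat \<times> nat \<Rightarrow> real^'p" and q +
  fixes \<kappa> :: real
  assumes inv: "invertible schur"
    and kappa_pos: "0 < \<kappa>"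
    and inv_bound: "row_sum_norm (matrix_inv schur) \<le> \<kappa> / (real n)\<^sup>2"
begin

lemma cov_sol_bound:
  assumes "\<And>l. \<bar>(\<Sum>p\<in>off_diag n. f p *\<^sub>R resid p) $ l\<bar> \<le> \<beta>"
  shows "\<bar>cov_sol f $ k\<bar> \<le> \<kappa> / (real n)\<^sup>2 * \<beta>"
  unfolding cov_sol_def by (rule abs_matrix_vector_le[OF inv_bound assms])

lemma cov_sol_diff: "cov_sol f - cov_sol h = cov_sol (\<lambda>p. f p - h p)"
  unfolding cov_sol_def by (simp add: matrix_vector_mult_diff_distrib[symmetric] sum_subtractf scaleR_left_diff_distrib)

lemma resid_sum_bound:
  assumes "\<And>p. p \<in> off_diag n \<Longrightarrow> \<bar>f p\<bar> \<le> c" "0 \<le> c"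
  shows "\<bar>(\<Sum>p\<in>off_diag n. f p *\<^sub>R resid p) $ l\<bar> \<le> (real n)\<^sup>2 * (c * (13 * M ^ 4 * q))"
proof -
  have "\<bar>\<Sum>p\<in>off_diag n. f p * resid p $ l\<bar> \<le> (real n)\<^sup>2 * (c * (13 * M ^ 4 * q))"
    using assms resid_bound M q
    by (intro sum_abs_le_square) (auto simp: abs_mult intro!: mult_mono mult_nonneg_nonneg)
  then show ?thesis by simp
qed

lemma lin_sol_works:
  shows "\<And>r. r \<in> {1..num_params n} \<Longrightarrow> (\<Sum>p\<in>off_diag n. design n r p * (w p * lin_sol f p - f p)) = 0"
    and "(\<Sum>p\<in>off_diag n. (w p * lin_sol f p - f p) *\<^sub>R Z p) = 0"
    and "\<And>p. p \<in> off_diag n \<Longrightarrow> lin_sol f p = fit (\<lambda>r. sol f r + (\<Sum>l\<in>UNIV. cov_sol f $ l * proj l r)) p + Z p \<bullet> cov_sol f"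
proof -
  have "schur *v cov_sol f = (\<Sum>p\<in>off_diag n. f p *\<^sub>R resid p)"
    unfolding cov_sol_def by (simp add: matrix_vector_mul_assoc matrix_inv_works(1)[OF inv])
  note * = linear_solution[where f = f and t = "lin_sol f", OF sol this lin_sol_def]
  show "\<And>r. r \<in> {1..num_params n} \<Longrightarrow> (\<Sum>p\<in>off_diag n. design n r p * (w p * lin_sol f p - f p)) = 0"
    "(\<Sum>p\<in>off_diag n. (w p * lin_sol f p - f p) *\<^sub>R Z p) = 0"
    "\<And>p. p \<in> off_diag n \<Longrightarrow> lin_sol f p = fit (\<lambda>r. sol f r + (\<Sum>l\<in>UNIV. cov_sol f $ l * proj l r)) p + Z p \<bullet> cov_sol f"
    using * by blast+
qed

text \<open>
  The operator bound behind the contraction: the maximum principle for the design part, and the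
  bound on the inverse of \<open>schur\<close>, used between two factors \<open>resid\<close>, for the covariate part.
\<close>
lemma lin_sol_lipschitz:
  assumes c: "\<And>p. p \<in> off_diag n \<Longrightarrow> \<bar>f p - h p\<bar> \<le> c" "0 \<le> c" and p: "p \<in> off_diag n"
  shows "\<bar>lin_sol f p - lin_sol h p\<bar> \<le> (12 * M ^ 3 + 169 * real CARD('p) * q\<^sup>2 * \<kappa> * M ^ 8) * c"
proof -
  obtain i j where ij: "p = (i, j)" "i \<in> {1..n}" "j \<in> {1..n}" using p by (cases p) (auto simp: off_diag_def)
  define x where "x r = sol f r - sol h r" for r
  have x: "fit x p' = fit (sol f) p' - fit (sol h) p'" for p' unfolding x_def by (rule fit_diff)
  have "\<bar>lin_pred n x i j\<bar> \<le> 12 * M ^ 3 * (real n * c) / real n"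
  proof (rule lin_pred_bound[where f = "\<lambda>p. f p - h p", OF _ _ _ ij(2,3)])
    fix r assume r: "r \<in> {1..num_params n}"
    have "(\<Sum>p\<in>off_diag n. design n r p * (w p * fit x p - (f p - h p)))
        = (\<Sum>p\<in>off_diag n. design n r p * (w p * fit (sol f) p - f p)) - (\<Sum>p\<in>off_diag n. design n r p * (w p * fit (sol h) p - h p))"
      unfolding x sum_subtractf[symmetric] by (intro sum.cong) (auto simp: algebra_simps)
    then show "(\<Sum>p\<in>off_diag n. design n r p * (w p * fit x p - (f p - h p))) = 0" by (simp add: sol[OF r])
  qed (use abs_total_le[OF c] in auto)
  then have 1: "\<bar>fit (sol f) p - fit (sol h) p\<bar> \<le> 12 * M ^ 3 * c"
    using n_ge_5 fit_eq[of i j x] p unfolding x[symmetric] by (simp add: ij(1) mult.assoc)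
  have "\<bar>(cov_sol f - cov_sol h) $ l\<bar> \<le> \<kappa> / (real n)\<^sup>2 * ((real n)\<^sup>2 * (c * (13 * M ^ 4 * q)))" for l
    unfolding cov_sol_diff by (rule cov_sol_bound[OF resid_sum_bound[OF c]])
  then have g: "\<bar>(cov_sol f - cov_sol h) $ l\<bar> \<le> \<kappa> * (c * (13 * M ^ 4 * q))" for l
    using n_ge_5 by (simp add: mult.assoc)
  have 2: "\<bar>resid p \<bullet> (cov_sol f - cov_sol h)\<bar> \<le> real CARD('p) * (13 * M ^ 4 * q) * (\<kappa> * (c * (13 * M ^ 4 * q)))"
    by (rule abs_inner_le[OF resid_bound[OF p] g]) (use M q in auto)
  also have "\<dots> = 169 * real CARD('p) * q\<^sup>2 * \<kappa> * M ^ 8 * c"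
    by (simp add: power2_eq_square power_numeral_reduce mult_ac)
  finally have "\<bar>resid p \<bullet> (cov_sol f - cov_sol h)\<bar> \<le> 169 * real CARD('p) * q\<^sup>2 * \<kappa> * M ^ 8 * c" .
  moreover have "lin_sol f p - lin_sol h p = (fit (sol f) p - fit (sol h) p) + resid p \<bullet> (cov_sol f - cov_sol h)"
    by (simp add: lin_sol_def inner_diff_right)
  ultimately show ?thesis using 1 by (simp add: distrib_right)
qed

text \<open>
  The matrix \<open>S\<close> applied to the noise. It solves the normal equations up to averages of the noise over
  many rows or columns (\<open>first_order_residual\<close>), which are smaller than the noise of the
  degrees by a factor \<open>n\<^sup>-\<^sup>1\<^sup>/\<^sup>2\<close>, up to powers of \<open>M\<close>.
\<close>
definition first_order :: "(nat \<times> nat \<Rightarrow> real) \<Rightarrow> nat \<Rightarrow> real" where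
  "first_order \<xi> r =
     (if r \<le> n then row_total n \<xi> r / row_total n w r + col_total n \<xi> n / col_total n w n
      else col_total n \<xi> (r - n) / col_total n w (r - n) - col_total n \<xi> n / col_total n w n)"

lemma first_order_fit:
  assumes "i \<in> {1..n}" "j \<in> {1..n}"
  shows "lin_pred n (first_order \<xi>) i j = row_total n \<xi> i / row_total n w i + col_total n \<xi> j / col_total n w j"
  using assms by (auto simp: lin_pred_def alpha_of_def beta_of_def first_order_def)

lemma first_order_residual:
  assumes "i \<in> {1..n}"
  shows "row_total n (\<lambda>p. w p * fit (first_order \<xi>) p) i
      = row_total n \<xi> i + (\<Sum>j\<in>{1..n} - {i}. w (i, j) * (col_total n \<xi> j / col_total n w j))"
    and "col_total n (\<lambda>p. w p * fit (first_order \<xi>) p) i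
      = col_total n \<xi> i + (\<Sum>j\<in>{1..n} - {i}. w (j, i) * (row_total n \<xi> j / row_total n w j))"
proof -
  have "row_total n (\<lambda>p. w p * fit (first_order \<xi>) p) i
      = (\<Sum>j\<in>{1..n} - {i}. w (i, j) * (row_total n \<xi> i / row_total n w i))
        + (\<Sum>j\<in>{1..n} - {i}. w (i, j) * (col_total n \<xi> j / col_total n w j))"
    unfolding row_total_def[of _ "\<lambda>p. w p * fit (first_order \<xi>) p"] sum.distrib[symmetric]
    using assms by (intro sum.cong) (auto simp: fit_eq off_diag_iff first_order_fit distrib_left)
  also have "(\<Sum>j\<in>{1..n} - {i}. w (i, j) * (row_total n \<xi> i / row_total n w i)) = row_total n \<xi> i"
    unfolding sum_distrib_right[symmetric] row_total_def[of n w, symmetric] using totals_pos(1)[OF assms] by simp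
  finally show "row_total n (\<lambda>p. w p * fit (first_order \<xi>) p) i
      = row_total n \<xi> i + (\<Sum>j\<in>{1..n} - {i}. w (i, j) * (col_total n \<xi> j / col_total n w j))" .
next
  have "col_total n (\<lambda>p. w p * fit (first_order \<xi>) p) i
      = (\<Sum>j\<in>{1..n} - {i}. w (j, i) * (col_total n \<xi> i / col_total n w i))
        + (\<Sum>j\<in>{1..n} - {i}. w (j, i) * (row_total n \<xi> j / row_total n w j))"
    unfolding col_total_def[of _ "\<lambda>p. w p * fit (first_order \<xi>) p"] sum.distrib[symmetric]
    using assms by (intro sum.cong) (auto simp: fit_eq off_diag_iff first_order_fit distrib_left)
  also have "(\<Sum>j\<in>{1..n} - {i}. w (j, i) * (col_total n \<xi> i / col_total n w i)) = col_total n \<xi> i"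
    unfolding sum_distrib_right[symmetric] col_total_def[of n w, symmetric] using totals_pos(2)[OF assms] by simp
  finally show "col_total n (\<lambda>p. w p * fit (first_order \<xi>) p) i
      = col_total n \<xi> i + (\<Sum>j\<in>{1..n} - {i}. w (j, i) * (row_total n \<xi> j / row_total n w j))" .
qed

text \<open>
  The deterministic core. With \<open>t = fit x p + Z p \<bullet> g\<close>, the scores vanish iff \<open>t\<close> is the linear
  solution for the data \<open>\<xi> - w (e\<^sup>t - 1 - t)\<close>. This is a fixed point equation with a contraction on the
  sup-norm ball of radius \<open>\<tau>\<close>: the hypothesis \<open>start\<close> places the solution for \<open>t = 0\<close> in half the ball, and
  \<open>small\<close> makes the Lipschitz constant at most \<open>1 / 2\<close>. Three corrections separate \<open>x\<close> from its first
  order term: the averaged noise \<open>B3\<close>, the quadratic remainder \<open>\<tau>\<^sup>2\<close>, and the covariate part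
  \<open>\<Sum>\<^sub>l g\<^sub>l proj l\<close>.
\<close>
theorem score_solution:
  assumes totals: "\<And>i. i \<in> {1..n} \<Longrightarrow> \<bar>row_total n \<xi> i\<bar> \<le> B1" "\<And>i. i \<in> {1..n} \<Longrightarrow> \<bar>col_total n \<xi> i\<bar> \<le> B1"
    and cov: "\<And>k. \<bar>(\<Sum>p\<in>off_diag n. \<xi> p *\<^sub>R resid p) $ k\<bar> \<le> B2"
    and smooth: "\<And>i. i \<in> {1..n} \<Longrightarrow> \<bar>\<Sum>j\<in>{1..n} - {i}. w (i, j) * (col_total n \<xi> j / col_total n w j)\<bar> \<le> B3"
      "\<And>i. i \<in> {1..n} \<Longrightarrow> \<bar>\<Sum>j\<in>{1..n} - {i}. w (j, i) * (row_total n \<xi> j / row_total n w j)\<bar> \<le> B3"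
    and \<tau>: "0 \<le> \<tau>" "\<tau> \<le> 1"
    and start: "12 * M ^ 3 * B1 / real n + real CARD('p) * (13 * M ^ 4 * q) * (\<kappa> / (real n)\<^sup>2 * B2) \<le> \<tau> / 2"
    and small: "(12 * M ^ 3 + 169 * real CARD('p) * q\<^sup>2 * \<kappa> * M ^ 8) * (M * (2 * \<tau>)) \<le> 1 / 2"
  shows "\<exists>x g.
    (\<forall>r\<in>{1..num_params n}. (\<Sum>p\<in>off_diag n. design n r p * (w p * exp (fit x p + Z p \<bullet> g) - w p - \<xi> p)) = 0) \<and>
    (\<Sum>p\<in>off_diag n. (w p * exp (fit x p + Z p \<bullet> g) - w p - \<xi> p) *\<^sub>R Z p) = 0 \<and>
    (\<forall>i\<in>{1..n}. i < n \<longrightarrow>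
       \<bar>x i - (row_total n \<xi> i / row_total n w i + col_total n \<xi> n / col_total n w n)\<bar>
       \<le> 12 * M ^ 3 * (B3 / real n + M * \<tau>\<^sup>2)
         + 12 * real CARD('p) * q * M ^ 4 * \<kappa> * (B2 / (real n)\<^sup>2 + 13 * q * M ^ 5 * \<tau>\<^sup>2))"
proof -
  define A where "A = 12 * M ^ 3 + 169 * real CARD('p) * q\<^sup>2 * \<kappa> * M ^ 8"
  have A: "0 \<le> A" unfolding A_def using M q kappa_pos by (intro add_nonneg_nonneg) auto
  define rem where "rem y = exp y - 1 - y" for y :: real
  define f where "f t p = \<xi> p - w p * rem (t p)" for t p
  define \<Phi> where "\<Phi> t = lin_sol (f t)" for t
  have f0: "f (\<lambda>_. 0) = \<xi>" by (simp add: f_def rem_def fun_eq_iff)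
  have lip: "\<bar>\<Phi> s p - \<Phi> t p\<bar> \<le> c / 2"
    if st: "\<And>p. p \<in> off_diag n \<Longrightarrow> \<bar>s p\<bar> \<le> \<tau>" "\<And>p. p \<in> off_diag n \<Longrightarrow> \<bar>t p\<bar> \<le> \<tau>"
      "\<And>p. p \<in> off_diag n \<Longrightarrow> \<bar>s p - t p\<bar> \<le> c" and p: "p \<in> off_diag n" for s t c p
  proof -
    have c: "0 \<le> c" using st(3)[OF p] by linarith
    have "\<bar>f s p - f t p\<bar> \<le> M * (2 * \<tau> * c)" if p: "p \<in> off_diag n" for p
    proof -
      have "\<bar>f s p - f t p\<bar> = w p * \<bar>rem (s p) - rem (t p)\<bar>"
        using w_pos[OF p] by (simp add: f_def abs_mult abs_minus_commute flip: right_diff_distrib)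
      also have "\<dots> \<le> w p * (2 * \<tau> * \<bar>s p - t p\<bar>)"
        unfolding rem_def using w_pos[OF p]
        by (intro mult_left_mono exp_taylor_lipschitz[OF st(1)[OF p] st(2)[OF p] \<tau>(2)]) simp
      also have "\<dots> \<le> M * (2 * \<tau> * c)"
        using w_bounds(2)[OF p] st(3)[OF p] \<tau> M by (intro mult_mono) auto
      finally show ?thesis .
    qed
    then have "\<bar>\<Phi> s p - \<Phi> t p\<bar> \<le> A * (M * (2 * \<tau> * c))"
      unfolding \<Phi>_def A_def using M \<tau> c by (intro lin_sol_lipschitz p) auto
    also have "\<dots> = (A * (M * (2 * \<tau>))) * c" by (simp add: mult_ac)
    also have "\<dots> \<le> 1 / 2 * c" using small c unfolding A_def by (intro mult_right_mono)
    finally show ?thesis by simp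
  qed
  have base: "\<bar>\<Phi> (\<lambda>_. 0) p\<bar> \<le> \<tau> / 2" if p: "p \<in> off_diag n" for p
  proof -
    obtain i j where ij: "p = (i, j)" "i \<in> {1..n}" "j \<in> {1..n}" using p by (cases p) (auto simp: off_diag_def)
    have "\<bar>lin_pred n (sol \<xi>) i j\<bar> \<le> 12 * M ^ 3 * B1 / real n"
      by (rule lin_pred_bound[OF sol totals ij(2,3)])
    moreover have "\<bar>resid p \<bullet> cov_sol \<xi>\<bar> \<le> real CARD('p) * (13 * M ^ 4 * q) * (\<kappa> / (real n)\<^sup>2 * B2)"
      by (rule abs_inner_le[OF resid_bound[OF p] cov_sol_bound[OF cov]]) (use M q in auto)
    ultimately have "\<bar>lin_pred n (sol \<xi>) i j + resid p \<bullet> cov_sol \<xi>\<bar> \<le> \<tau> / 2"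
      using start by linarith
    then show ?thesis unfolding \<Phi>_def f0 lin_sol_def using p by (simp add: ij(1) fit_eq)
  qed
  have zero: "\<bar>(\<lambda>_. 0 :: real) p\<bar> \<le> \<tau>" for p :: "nat \<times> nat" using \<tau> by simp
  have maps: "\<bar>\<Phi> t p\<bar> \<le> \<tau>" if t: "\<And>p. p \<in> off_diag n \<Longrightarrow> \<bar>t p\<bar> \<le> \<tau>" and p: "p \<in> off_diag n" for t p
  proof -
    have "\<bar>\<Phi> t p - \<Phi> (\<lambda>_. 0) p\<bar> \<le> \<tau> / 2"
      by (rule lip[OF t zero _ p]) (use t in auto)
    then show ?thesis using base[OF p] by linarith
  qed
  obtain t where t: "\<And>p. p \<in> off_diag n \<Longrightarrow> \<bar>t p\<bar> \<le> \<tau>" "\<And>p. p \<in> off_diag n \<Longrightarrow> \<Phi> t p = t p"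
    using contraction_fixpoint[where \<Phi> = \<Phi> and \<tau> = \<tau>, OF finite_off_diag \<tau>(1) maps lip] by blast
  define h where "h = f t"
  define x where "x r = sol h r + (\<Sum>l\<in>UNIV. cov_sol h $ l * proj l r)" for r
  have x_fun: "x = (\<lambda>r. sol h r + (\<Sum>l\<in>UNIV. cov_sol h $ l * proj l r))" by (simp add: x_def fun_eq_iff)
  have tx: "t p = fit x p + Z p \<bullet> cov_sol h" if "p \<in> off_diag n" for p
    using t(2)[OF that] lin_sol_works(3)[OF that, of h] unfolding \<Phi>_def h_def[symmetric] x_fun[symmetric] by simp
  have score: "w p * exp (fit x p + Z p \<bullet> cov_sol h) - w p - \<xi> p = w p * lin_sol h p - h p"
    if "p \<in> off_diag n" for p
    using t(2)[OF that] unfolding \<Phi>_def h_def[symmetric] tx[OF that, symmetric]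
    by (simp add: h_def f_def rem_def algebra_simps)
  have rem_bd: "\<bar>w p * rem (t p)\<bar> \<le> M * \<tau>\<^sup>2" if p: "p \<in> off_diag n" for p
  proof -
    have "\<bar>rem (t p)\<bar> \<le> (t p)\<^sup>2" unfolding rem_def using t(1)[OF p] \<tau> by (intro abs_exp_taylor_le) simp
    also have "\<dots> \<le> \<tau>\<^sup>2" using t(1)[OF p] \<tau> by (simp add: abs_le_square_iff[symmetric])
    finally show ?thesis
      using w_bounds(2)[OF p] w_pos[OF p] unfolding abs_mult by (intro mult_mono) auto
  qed
  show ?thesis
  proof (intro exI[of _ x] exI[of _ "cov_sol h"] conjI ballI impI)
    fix r assume r: "r \<in> {1..num_params n}"
    have "(\<Sum>p\<in>off_diag n. design n r p * (w p * exp (fit x p + Z p \<bullet> cov_sol h) - w p - \<xi> p))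
        = (\<Sum>p\<in>off_diag n. design n r p * (w p * lin_sol h p - h p))"
      by (intro sum.cong refl) (simp only: score)
    then show "(\<Sum>p\<in>off_diag n. design n r p * (w p * exp (fit x p + Z p \<bullet> cov_sol h) - w p - \<xi> p)) = 0"
      by (simp only: lin_sol_works(1)[OF r])
  next
    have "(\<Sum>p\<in>off_diag n. (w p * exp (fit x p + Z p \<bullet> cov_sol h) - w p - \<xi> p) *\<^sub>R Z p)
        = (\<Sum>p\<in>off_diag n. (w p * lin_sol h p - h p) *\<^sub>R Z p)"
      by (intro sum.cong refl) (simp only: score)
    then show "(\<Sum>p\<in>off_diag n. (w p * exp (fit x p + Z p \<bullet> cov_sol h) - w p - \<xi> p) *\<^sub>R Z p) = 0"
      by (simp only: lin_sol_works(2))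
  next
    fix i assume i: "i \<in> {1..n}" "i < n"
    have n: "n \<in> {1..n}" using i by auto
    have last: "lin_pred n y i n = y i" for y by (simp add: lin_pred_def alpha_of_def beta_of_def)
    define d where "d r = sol h r - first_order \<xi> r" for r
    have fit_d: "fit d p = fit (sol h) p - fit (first_order \<xi>) p" for p
      using fit_diff[of "sol h" "first_order \<xi>" p] by (simp add: d_def[abs_def])
    have "\<bar>lin_pred n d i n\<bar> \<le> 12 * M ^ 3 * (B3 + real n * (M * \<tau>\<^sup>2)) / real n"
    proof (rule lin_pred_bound[where f = "\<lambda>p. h p - w p * fit (first_order \<xi>) p", OF _ _ _ i(1) n])
      fix r assume r: "r \<in> {1..num_params n}"
      have "w p * fit d p - (h p - w p * fit (first_order \<xi>) p) = w p * fit (sol h) p - h p" for p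
        by (simp add: fit_d algebra_simps)
      then show "(\<Sum>p\<in>off_diag n. design n r p * (w p * fit d p - (h p - w p * fit (first_order \<xi>) p))) = 0"
        by (simp only: sol[OF r])
    next
      fix k assume k: "k \<in> {1..n}"
      have h: "h = (\<lambda>p. \<xi> p - w p * rem (t p))" by (simp add: h_def f_def fun_eq_iff)
      have nn: "0 \<le> M * \<tau>\<^sup>2" using M by simp
      note rem_tot = abs_total_le[where v = "\<lambda>p. w p * rem (t p)", OF rem_bd nn k]
      show "\<bar>row_total n (\<lambda>p. h p - w p * fit (first_order \<xi>) p) k\<bar> \<le> B3 + real n * (M * \<tau>\<^sup>2)"
        using rem_tot(1) smooth(1)[OF k] unfolding h total_diff first_order_residual[OF k] by linarith
      show "\<bar>col_total n (\<lambda>p. h p - w p * fit (first_order \<xi>) p) k\<bar> \<le> B3 + real n * (M * \<tau>\<^sup>2)"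
        using rem_tot(2) smooth(2)[OF k] unfolding h total_diff first_order_residual[OF k] by linarith
    qed
    then have 1: "\<bar>sol h i - first_order \<xi> i\<bar> \<le> 12 * M ^ 3 * (B3 / real n + M * \<tau>\<^sup>2)"
      using n_ge_5 unfolding last d_def by (simp add: field_simps)
    have hsum: "\<bar>(\<Sum>p\<in>off_diag n. h p *\<^sub>R resid p) $ k\<bar> \<le> B2 + (real n)\<^sup>2 * (M * \<tau>\<^sup>2 * (13 * M ^ 4 * q))" for k
    proof -
      have "\<bar>(\<Sum>p\<in>off_diag n. (w p * rem (t p)) *\<^sub>R resid p) $ k\<bar> \<le> (real n)\<^sup>2 * (M * \<tau>\<^sup>2 * (13 * M ^ 4 * q))"
        by (rule resid_sum_bound[OF rem_bd]) (use M in auto)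
      moreover have "(\<Sum>p\<in>off_diag n. h p *\<^sub>R resid p) $ k
          = (\<Sum>p\<in>off_diag n. \<xi> p *\<^sub>R resid p) $ k - (\<Sum>p\<in>off_diag n. (w p * rem (t p)) *\<^sub>R resid p) $ k"
        by (simp add: h_def f_def left_diff_distrib sum_subtractf)
      ultimately show ?thesis using cov[of k] by linarith
    qed
    have g: "\<bar>cov_sol h $ l\<bar> \<le> \<kappa> * (B2 / (real n)\<^sup>2 + 13 * q * M ^ 5 * \<tau>\<^sup>2)" for l
    proof -
      have "\<kappa> / (real n)\<^sup>2 * (B2 + (real n)\<^sup>2 * (M * \<tau>\<^sup>2 * (13 * M ^ 4 * q)))
          = \<kappa> * (B2 / (real n)\<^sup>2 + 13 * q * M ^ 5 * \<tau>\<^sup>2)"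
        using n_ge_5 by (simp add: field_simps power_numeral_reduce)
      then show ?thesis using cov_sol_bound[OF hsum, of l] by simp
    qed
    have "\<bar>\<Sum>l\<in>UNIV. cov_sol h $ l * proj l i\<bar>
        \<le> (\<Sum>l\<in>(UNIV::'p set). \<kappa> * (B2 / (real n)\<^sup>2 + 13 * q * M ^ 5 * \<tau>\<^sup>2) * (12 * M ^ 4 * q))"
    proof (rule order_trans[OF sum_abs], rule sum_mono)
      fix l
      have "\<bar>proj l i\<bar> \<le> 12 * M ^ 4 * q" using proj_bound[OF i(1) n, of l] unfolding last .
      then show "\<bar>cov_sol h $ l * proj l i\<bar> \<le> \<kappa> * (B2 / (real n)\<^sup>2 + 13 * q * M ^ 5 * \<tau>\<^sup>2) * (12 * M ^ 4 * q)"
        unfolding abs_mult using g[of l] by (intro mult_mono) (auto intro: order_trans[OF abs_ge_zero])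
    qed
    also have "\<dots> = 12 * real CARD('p) * q * M ^ 4 * \<kappa> * (B2 / (real n)\<^sup>2 + 13 * q * M ^ 5 * \<tau>\<^sup>2)"
      by (simp add: mult_ac)
    finally have 2: "\<bar>\<Sum>l\<in>UNIV. cov_sol h $ l * proj l i\<bar>
        \<le> 12 * real CARD('p) * q * M ^ 4 * \<kappa> * (B2 / (real n)\<^sup>2 + 13 * q * M ^ 5 * \<tau>\<^sup>2)" .
    have "first_order \<xi> i = row_total n \<xi> i / row_total n w i + col_total n \<xi> n / col_total n w n"
      using i by (simp add: first_order_def)
    then show "\<bar>x i - (row_total n \<xi> i / row_total n w i + col_total n \<xi> n / col_total n w n)\<bar>
       \<le> 12 * M ^ 3 * (B3 / real n + M * \<tau>\<^sup>2)
         + 12 * real CARD('p) * q * M ^ 4 * \<kappa> * (B2 / (real n)\<^sup>2 + 13 * q * M ^ 5 * \<tau>\<^sup>2)"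
      using 1 2 unfolding x_def by linarith
  qed
qed

end

section \<open>The scores of the network and the maximum likelihood estimator\<close>

definition edge_rate :: "nat \<Rightarrow> (nat \<Rightarrow> nat \<Rightarrow> real^'p) \<Rightarrow> (nat \<Rightarrow> real) \<Rightarrow> real^'p \<Rightarrow> nat \<times> nat \<Rightarrow> real" where
  "edge_rate n Z \<theta> \<gamma> p = rate n Z \<theta> \<gamma> (fst p) (snd p)"

definition edge_cov :: "(nat \<Rightarrow> nat \<Rightarrow> real^'p) \<Rightarrow> nat \<times> nat \<Rightarrow> real^'p" where
  "edge_cov Z p = Z (fst p) (snd p)"

definition edge_count :: "(nat \<Rightarrow> nat \<Rightarrow> nat) \<Rightarrow> nat \<times> nat \<Rightarrow> real" where
  "edge_count A p = real (A (fst p) (snd p))"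

lemma edge_rate_eq:
  "edge_rate n Z \<theta> \<gamma> p = exp (lin_pred n \<theta> (fst p) (snd p) + edge_cov Z p \<bullet> \<gamma>)"
  by (simp add: edge_rate_def rate_def lin_pred_def edge_cov_def)

lemma score_F_design:
  assumes "r \<in> {1..num_params n}"
  shows "score_F n Z A \<theta> \<gamma> r = (\<Sum>p\<in>off_diag n. design n r p * (edge_rate n Z \<theta> \<gamma> p - edge_count A p))"
proof (cases "r \<le> n")
  case True
  then have "r \<in> {1..n}" using assms by auto
  then show ?thesis using True
    by (simp add: design_row_total row_total_def score_F_def out_degree_def edge_rate_def edge_count_def sum_subtractf)
next
  case False
  then have r: "r - n \<in> {1..n}" "r - n \<noteq> n" "r = n + (r - n)" using assms by (auto simp: num_params_def)
  show ?thesis using False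
    by (subst (2) r(3), subst design_col_total[OF r(1,2)])
      (simp add: col_total_def score_F_def in_degree_def edge_rate_def edge_count_def sum_subtractf)
qed

lemma score_Q_edges:
  "score_Q n Z A \<theta> \<gamma> = (\<Sum>p\<in>off_diag n. (edge_rate n Z \<theta> \<gamma> p - edge_count A p) *\<^sub>R edge_cov Z p)"
  by (simp add: score_Q_def edge_rate_def edge_count_def edge_cov_def case_prod_beta)

lemma is_mle_design:
  "is_mle n Z A \<theta> \<gamma> \<longleftrightarrow>
     (\<forall>r\<in>{1..num_params n}. (\<Sum>p\<in>off_diag n. design n r p * (edge_rate n Z \<theta> \<gamma> p - edge_count A p)) = 0) \<and>
     (\<Sum>p\<in>off_diag n. (edge_rate n Z \<theta> \<gamma> p - edge_count A p) *\<^sub>R edge_cov Z p) = 0"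
  unfolding is_mle_def score_Q_edges num_params_def[symmetric]
  by (simp add: score_F_design)

lemma lin_pred_upd:
  assumes "p \<in> off_diag n"
  shows "lin_pred n (\<theta>(s := t)) (fst p) (snd p) = lin_pred n \<theta> (fst p) (snd p) + (t - \<theta> s) * design n s p"
  using assms by (auto simp: off_diag_def lin_pred_def alpha_of_def beta_of_def design_def)

lemma deriv_exp_sum:
  fixes c u d a :: "'e \<Rightarrow> real"
  shows "deriv (\<lambda>t. \<Sum>p\<in>P. c p * (exp (u p + (t - t0) * d p) - a p)) t0 = (\<Sum>p\<in>P. c p * (exp (u p) * d p))"
  by (rule DERIV_imp_deriv) (auto intro!: derivative_eq_intros sum.cong)

lemma partial_theta_sum:
  "partial_theta (\<lambda>\<theta>. \<Sum>p\<in>off_diag n. c p * (edge_rate n Z \<theta> \<gamma> p - a p)) \<theta> s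
     = (\<Sum>p\<in>off_diag n. c p * (edge_rate n Z \<theta> \<gamma> p * design n s p))"
proof -
  have "(\<Sum>p\<in>off_diag n. c p * (edge_rate n Z (\<theta>(s := t)) \<gamma> p - a p))
      = (\<Sum>p\<in>off_diag n. c p * (exp ((lin_pred n \<theta> (fst p) (snd p) + edge_cov Z p \<bullet> \<gamma>) + (t - \<theta> s) * design n s p) - a p))" for t
    by (intro sum.cong refl) (simp add: edge_rate_eq lin_pred_upd algebra_simps)
  then show ?thesis
    by (simp only: partial_theta_def deriv_exp_sum edge_rate_eq[symmetric])
qed

lemma partial_gamma_sum:
  "partial_gamma (\<lambda>\<gamma>. \<Sum>p\<in>off_diag n. c p * (edge_rate n Z \<theta> \<gamma> p - a p)) \<gamma> l
     = (\<Sum>p\<in>off_diag n. c p * (edge_rate n Z \<theta> \<gamma> p * edge_cov Z p $ l))"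
proof -
  have "(\<Sum>p\<in>off_diag n. c p * (edge_rate n Z \<theta> (\<gamma> + t *\<^sub>R axis l 1) p - a p))
      = (\<Sum>p\<in>off_diag n. c p * (exp ((lin_pred n \<theta> (fst p) (snd p) + edge_cov Z p \<bullet> \<gamma>) + (t - 0) * edge_cov Z p $ l) - a p))" for t
    by (intro sum.cong refl) (simp add: edge_rate_eq inner_add_right inner_axis algebra_simps)
  then show ?thesis
    by (simp only: partial_gamma_def deriv_exp_sum edge_rate_eq[symmetric])
qed

lemma inverse_upto_cong:
  assumes "\<And>i j. i \<in> {1..N} \<Longrightarrow> j \<in> {1..N} \<Longrightarrow> A i j = B i j"
  shows "inverse_upto N A = inverse_upto N B"
proof -
  have "is_inverse_upto N A C = is_inverse_upto N B C" for C
  proof -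
    have "(\<Sum>k=1..N. A i k * C k j) = (\<Sum>k=1..N. B i k * C k j)"
      "(\<Sum>k=1..N. C i k * A k j) = (\<Sum>k=1..N. C i k * B k j)" if "i \<in> {1..N}" "j \<in> {1..N}" for i j
      by (intro sum.cong refl; simp only: assms that)+
    then show ?thesis unfolding is_inverse_upto_def by (intro ball_cong refl) (simp only:)
  qed
  then have "is_inverse_upto N A = is_inverse_upto N B" by (rule ext)
  then show ?thesis by (simp add: inverse_upto_def)
qed

text \<open>
  All scores are weighted sums of rates, so the partial derivatives are Gram-type sums. The data
  cancel, and \<open>H\<close> is the profiled information for the true rates.
\<close>
lemma H_mat_eq_schur:
  assumes "network n (edge_rate n Z \<theta> \<gamma>)"
  shows "H_mat n Z A \<theta> \<gamma>
    = weighted_design_covariates.schur (off_diag n) (num_params n) (design n) (edge_rate n Z \<theta> \<gamma>) (edge_cov Z)"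
proof -
  interpret network n "edge_rate n Z \<theta> \<gamma>" "edge_cov Z" by fact
  let ?w = "edge_rate n Z \<theta> \<gamma>" and ?Z = "edge_cov Z" and ?P = "off_diag n" and ?N = "num_params n"
  have QF: "(\<lambda>\<theta>'. score_F n Z A \<theta>' \<gamma>' r) = (\<lambda>\<theta>'. \<Sum>p\<in>?P. design n r p * (edge_rate n Z \<theta>' \<gamma>' p - edge_count A p))"
    "(\<lambda>\<gamma>'. score_F n Z A \<theta>' \<gamma>' r) = (\<lambda>\<gamma>'. \<Sum>p\<in>?P. design n r p * (edge_rate n Z \<theta>' \<gamma>' p - edge_count A p))"
    if "r \<in> {1..?N}" for r \<theta>' \<gamma>'
    by (simp_all add: score_F_design[OF that] fun_eq_iff)
  have Q: "score_Q n Z A \<theta>' \<gamma>' $ k = (\<Sum>p\<in>?P. ?Z p $ k * (edge_rate n Z \<theta>' \<gamma>' p - edge_count A p))" for \<theta>' \<gamma>' k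
    by (simp add: score_Q_edges mult.commute)
  have "partial_theta (\<lambda>\<theta>'. score_F n Z A \<theta>' \<gamma> r) \<theta> s = gram r s" if "r \<in> {1..?N}" "s \<in> {1..?N}" for r s
    unfolding QF(1)[OF that(1)] partial_theta_sum gram_def by (simp add: mult_ac)
  then have W: "inverse_upto ?N (\<lambda>r s. partial_theta (\<lambda>\<theta>'. score_F n Z A \<theta>' \<gamma> r) \<theta> s) = inverse_upto ?N gram"
    by (rule inverse_upto_cong)
  have "H_mat n Z A \<theta> \<gamma> $ k $ l = schur $ k $ l" for k l
  proof -
    define b where "b s = (\<Sum>p\<in>?P. design n s p * (?w p * ?Z p $ l))" for s
    define c where "c r = (\<Sum>p\<in>?P. ?Z p $ k * (?w p * design n r p))" for r
    have "H_mat n Z A \<theta> \<gamma> $ k $ l = (\<Sum>p\<in>?P. ?Z p $ k * (?w p * ?Z p $ l))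
        - (\<Sum>r=1..?N. \<Sum>s=1..?N. c r * inverse_upto ?N gram r s * partial_gamma (\<lambda>\<gamma>'. score_F n Z A \<theta> \<gamma>' s) \<gamma> l)"
      unfolding H_mat_def Let_def num_params_def[symmetric] W vec_lambda_beta Q partial_theta_sum partial_gamma_sum c_def ..
    also have "(\<Sum>r=1..?N. \<Sum>s=1..?N. c r * inverse_upto ?N gram r s * partial_gamma (\<lambda>\<gamma>'. score_F n Z A \<theta> \<gamma>' s) \<gamma> l)
        = (\<Sum>r=1..?N. \<Sum>s=1..?N. c r * inverse_upto ?N gram r s * b s)"
      by (intro sum.cong refl) (simp only: QF(2) partial_gamma_sum b_def)
    also have "\<dots> = - (\<Sum>r=1..?N. proj l r * c r)"
      unfolding proj_def b_def[symmetric] by (simp add: sum_negf sum_distrib_left sum_distrib_right mult_ac)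
    also have "(\<Sum>r=1..?N. proj l r * c r) = (\<Sum>p\<in>?P. ?Z p $ k * (?w p * fit (proj l) p))"
      unfolding c_def fit_def sum_distrib_left by (subst sum.swap) (simp add: mult_ac)
    finally show ?thesis by (simp add: schur_def resid_def distrib_left sum.distrib)
  qed
  then show ?thesis by (simp add: vec_eq_iff)
qed

lemma exp_diff_mult_pos:
  fixes a b :: real
  shows "0 \<le> (a - b) * (exp a - exp b)" "(a - b) * (exp a - exp b) = 0 \<longleftrightarrow> a = b"
  by (cases a b rule: linorder_cases; simp add: mult_nonneg_nonneg mult_nonpos_nonpos)+

text \<open>
  The difference of two solutions has \<open>\<Sum> (\<eta> - \<eta>') (e\<^sup>\<eta> - e\<^sup>\<eta>\<^sup>') = 0\<close> with nonnegative terms, so the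
  linear predictors agree; positive definiteness of \<open>H\<close> then identifies the parameters.
\<close>
lemma mle_unique:
  assumes net: "network n (edge_rate n Z \<theta>0 \<gamma>0)"
    and H: "pos_def_mat (H_mat n Z A0 \<theta>0 \<gamma>0)"
    and mle: "is_mle n Z A \<theta> \<gamma>" "is_mle n Z A \<theta>' \<gamma>'" and r: "r \<in> {1..num_params n}"
  shows "\<theta> r = \<theta>' r"
proof -
  interpret network n "edge_rate n Z \<theta>0 \<gamma>0" "edge_cov Z" by fact
  define x where "x r = \<theta> r - \<theta>' r" for r
  define \<eta> where "\<eta> \<theta> \<gamma> p = lin_pred n \<theta> (fst p) (snd p) + edge_cov Z p \<bullet> \<gamma>" for \<theta> \<gamma> p
  define v where "v p = exp (\<eta> \<theta> \<gamma> p) - exp (\<eta> \<theta>' \<gamma>' p)" for p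
  have v: "v p = (edge_rate n Z \<theta> \<gamma> p - edge_count A p) - (edge_rate n Z \<theta>' \<gamma>' p - edge_count A p)" for p
    by (simp add: v_def edge_rate_eq \<eta>_def)
  have 1: "(\<Sum>p\<in>off_diag n. design n r p * v p) = 0" if "r \<in> {1..num_params n}" for r
  proof -
    have "(\<Sum>p\<in>off_diag n. design n r p * v p)
        = (\<Sum>p\<in>off_diag n. design n r p * (edge_rate n Z \<theta> \<gamma> p - edge_count A p))
          - (\<Sum>p\<in>off_diag n. design n r p * (edge_rate n Z \<theta>' \<gamma>' p - edge_count A p))"
      unfolding sum_subtractf[symmetric] by (intro sum.cong refl) (simp add: v algebra_simps)
    then show ?thesis using mle that unfolding is_mle_design by (simp only:)
  qed
  have 2: "(\<Sum>p\<in>off_diag n. v p *\<^sub>R edge_cov Z p) = 0"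
    using mle unfolding v scaleR_left_diff_distrib sum_subtractf is_mle_design by simp
  have eta_diff: "\<eta> \<theta> \<gamma> p - \<eta> \<theta>' \<gamma>' p = fit x p + edge_cov Z p \<bullet> (\<gamma> - \<gamma>')" if "p \<in> off_diag n" for p
  proof -
    have "fit x p = lin_pred n x (fst p) (snd p)" using fit_eq[of "fst p" "snd p" x] that by simp
    then show ?thesis
      by (simp add: \<eta>_def x_def lin_pred_def alpha_of_def beta_of_def inner_diff_right)
  qed
  have "(\<Sum>p\<in>off_diag n. (\<eta> \<theta> \<gamma> p - \<eta> \<theta>' \<gamma>' p) * v p)
      = (\<Sum>p\<in>off_diag n. fit x p * v p) + (\<Sum>p\<in>off_diag n. v p *\<^sub>R edge_cov Z p) \<bullet> (\<gamma> - \<gamma>')"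
    unfolding inner_sum_left sum.distrib[symmetric]
    by (intro sum.cong refl) (simp add: eta_diff algebra_simps)
  also have "(\<Sum>p\<in>off_diag n. fit x p * v p) = 0" by (rule orthogonal_to_fit) (rule 1)
  finally have "(\<Sum>p\<in>off_diag n. (\<eta> \<theta> \<gamma> p - \<eta> \<theta>' \<gamma>' p) * v p) = 0" by (simp add: 2)
  then have "(\<eta> \<theta> \<gamma> p - \<eta> \<theta>' \<gamma>' p) * v p = 0" if "p \<in> off_diag n" for p
    using sum_nonneg_eq_0_iff[of "off_diag n" "\<lambda>p. (\<eta> \<theta> \<gamma> p - \<eta> \<theta>' \<gamma>' p) * v p"] that
    by (simp add: v_def exp_diff_mult_pos(1))
  then have zero: "fit x p + edge_cov Z p \<bullet> (\<gamma> - \<gamma>') = 0" if "p \<in> off_diag n" for p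
    using that unfolding v_def exp_diff_mult_pos(2) by (simp flip: eta_diff)
  have ker: "g = 0" if "schur *v g = 0" for g
    using H that unfolding H_mat_eq_schur[OF net] pos_def_mat_def by (metis inner_zero_right less_irrefl)
  have "x r = 0" by (rule combined_identifiable(2)[OF ker zero r])
  then show ?thesis by (simp add: x_def)
qed

text \<open>
  The constructed zero of the scores is an MLE, hence the given estimator is one too, and uniqueness
  identifies both.
\<close>
lemma mle_expansion:
  assumes net: "inverse_bounded_network n (edge_rate n Z \<theta>s \<gamma>s) M (edge_cov Z) q \<kappa>"
    and H: "pos_def_mat (H_mat n Z A \<theta>s \<gamma>s)"
    and mle: "\<And>\<theta> \<gamma>. is_mle n Z A \<theta> \<gamma> \<Longrightarrow> is_mle n Z A \<theta>h \<gamma>h"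
    and score: "\<And>r. r \<in> {1..num_params n} \<Longrightarrow>
        (\<Sum>p\<in>off_diag n. design n r p * (edge_rate n Z \<theta>s \<gamma>s p
           * exp (weighted_design.fit (num_params n) (design n) x p + edge_cov Z p \<bullet> g)
           - edge_rate n Z \<theta>s \<gamma>s p - (edge_count A p - edge_rate n Z \<theta>s \<gamma>s p))) = 0"
      "(\<Sum>p\<in>off_diag n. (edge_rate n Z \<theta>s \<gamma>s p
           * exp (weighted_design.fit (num_params n) (design n) x p + edge_cov Z p \<bullet> g)
           - edge_rate n Z \<theta>s \<gamma>s p - (edge_count A p - edge_rate n Z \<theta>s \<gamma>s p)) *\<^sub>R edge_cov Z p) = 0"
    and r: "r \<in> {1..num_params n}"
  shows "\<theta>h r - \<theta>s r = x r"
proof -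
  interpret inverse_bounded_network n "edge_rate n Z \<theta>s \<gamma>s" M "edge_cov Z" q \<kappa> by fact
  have "edge_rate n Z (\<lambda>r. \<theta>s r + x r) (\<gamma>s + g) p - edge_count A p
      = edge_rate n Z \<theta>s \<gamma>s p * exp (fit x p + edge_cov Z p \<bullet> g)
        - edge_rate n Z \<theta>s \<gamma>s p - (edge_count A p - edge_rate n Z \<theta>s \<gamma>s p)" if "p \<in> off_diag n" for p
  proof -
    have "fit x p = lin_pred n x (fst p) (snd p)" using fit_eq[of "fst p" "snd p" x] that by simp
    then show ?thesis
      by (simp add: edge_rate_eq lin_pred_def alpha_of_def beta_of_def inner_add_right exp_add)
  qed
  then have "is_mle n Z A (\<lambda>r. \<theta>s r + x r) (\<gamma>s + g)"
    unfolding is_mle_design using score by (simp cong: sum.cong)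
  from mle_unique[OF network_axioms H mle[OF this] this r] show ?thesis by simp
qed

section \<open>Bounds for the noise\<close>

lemma sum_col_totals:
  assumes "i \<in> {1..n}"
  shows "(\<Sum>j\<in>{1..n} - {i}. c j * col_total n v j) = (\<Sum>p\<in>off_diag n. (of_bool (snd p \<noteq> i) * c (snd p)) * v p)"
proof -
  have "(\<Sum>p\<in>off_diag n. (of_bool (snd p \<noteq> i) * c (snd p)) * v p)
      = (\<Sum>j=1..n. of_bool (j \<noteq> i) * (c j * col_total n v j))"
    unfolding sum_off_diag_cols col_total_def sum_distrib_left by (simp add: mult.assoc)
  also have "\<dots> = (\<Sum>j\<in>{1..n} - {i}. c j * col_total n v j)"
    by (rule sum.mono_neutral_cong_right) (use assms in auto)
  finally show ?thesis by simp
qed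

lemma sum_row_totals:
  assumes "i \<in> {1..n}"
  shows "(\<Sum>j\<in>{1..n} - {i}. c j * row_total n v j) = (\<Sum>p\<in>off_diag n. (of_bool (fst p \<noteq> i) * c (fst p)) * v p)"
proof -
  have "(\<Sum>p\<in>off_diag n. (of_bool (fst p \<noteq> i) * c (fst p)) * v p)
      = (\<Sum>j=1..n. of_bool (j \<noteq> i) * (c j * row_total n v j))"
    unfolding sum_off_diag_rows row_total_def sum_distrib_left by (simp add: mult.assoc)
  also have "\<dots> = (\<Sum>j\<in>{1..n} - {i}. c j * row_total n v j)"
    by (rule sum.mono_neutral_cong_right) (use assms in auto)
  finally show ?thesis by simp
qed

definition bad_event ::
  "'w measure \<Rightarrow> 'i set \<Rightarrow> ('i \<Rightarrow> 'w \<Rightarrow> nat) \<Rightarrow> ('i \<Rightarrow> real) \<Rightarrow> real \<Rightarrow> 'k set \<Rightarrow> ('k \<Rightarrow> 'i \<Rightarrow> real) \<Rightarrow> 'w set" where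
  "bad_event \<M> I X \<nu> b K c = {\<omega>\<in>space \<M>. \<exists>k\<in>K. b \<le> \<bar>\<Sum>i\<in>I. c k i * (real (X i \<omega>) - \<nu> i)\<bar>}"

lemma bad_event_bound:
  assumes fam: "poisson_family \<M> I X \<nu>" and K: "finite K"
    and c: "\<And>k i. k \<in> K \<Longrightarrow> i \<in> I \<Longrightarrow> \<bar>c k i\<bar> \<le> C" "\<And>k. k \<in> K \<Longrightarrow> (\<Sum>i\<in>I. (c k i)\<^sup>2 * \<nu> i) \<le> \<sigma>\<^sup>2"
    and "0 < \<sigma>" "0 < r" "2 * r * C \<le> \<sigma>"
  shows "bad_event \<M> I X \<nu> (4 * r * \<sigma>) K c \<in> sets \<M>" (is "?E \<in> _")
    and "measure \<M> (bad_event \<M> I X \<nu> (4 * r * \<sigma>) K c) \<le> real (card K) * (2 * exp (- 4 * r\<^sup>2))"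
proof -
  interpret prob_space \<M> using fam by (simp add: poisson_family_def)
  note [measurable] = poisson_family_sum_measurable[OF fam]
  let ?F = "\<lambda>k. {\<omega>\<in>space \<M>. 4 * r * \<sigma> \<le> \<bar>\<Sum>i\<in>I. c k i * (real (X i \<omega>) - \<nu> i)\<bar>}"
  have F: "?F k \<in> sets \<M>" for k by measurable
  have E: "?E = (\<Union>k\<in>K. ?F k)" by (auto simp: bad_event_def)
  show "?E \<in> sets \<M>" unfolding E using K F by (intro sets.finite_UN) auto
  have "measure \<M> (\<Union>k\<in>K. ?F k) \<le> (\<Sum>k\<in>K. measure \<M> (?F k))"
    by (rule finite_measure_subadditive_finite) (use K F in auto)
  also have "\<dots> \<le> (\<Sum>k\<in>K. 2 * exp (- 4 * r\<^sup>2))"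
    by (intro sum_mono poisson_family_abs_tail[OF fam, where C = C]) (use assms in auto)
  finally show "measure \<M> ?E \<le> real (card K) * (2 * exp (- 4 * r\<^sup>2))" unfolding E by simp
qed

lemma not_bad_event:
  assumes "\<omega> \<in> space \<M>" "\<omega> \<notin> bad_event \<M> I X \<nu> b K c" "k \<in> K"
  shows "\<bar>\<Sum>i\<in>I. c k i * (real (X i \<omega>) - \<nu> i)\<bar> \<le> b"
  using assms unfolding bad_event_def mem_Collect_eq by (meson linear)

context inverse_bounded_network
begin

text \<open>
  The noise bounds required by \<open>score_solution\<close>: for the degrees, for the projection on the residual
  covariates, and for the averages in the residual of the first order term.
\<close>
definition good :: "real \<Rightarrow> (nat \<times> nat \<Rightarrow> real) \<Rightarrow> bool" where
  "good r \<xi> \<longleftrightarrow>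
     (\<forall>i\<in>{1..n}. \<bar>row_total n \<xi> i\<bar> \<le> 4 * r * sqrt (real n * M) \<and> \<bar>col_total n \<xi> i\<bar> \<le> 4 * r * sqrt (real n * M)) \<and>
     (\<forall>k. \<bar>(\<Sum>p\<in>off_diag n. \<xi> p *\<^sub>R resid p) $ k\<bar> \<le> 4 * r * (13 * M ^ 4 * q * real n * sqrt M)) \<and>
     (\<forall>i\<in>{1..n}. \<bar>\<Sum>j\<in>{1..n} - {i}. w (i, j) * (col_total n \<xi> j / col_total n w j)\<bar> \<le> 4 * r * (2 * M\<^sup>2 * sqrt M) \<and>
        \<bar>\<Sum>j\<in>{1..n} - {i}. w (j, i) * (row_total n \<xi> j / row_total n w j)\<bar> \<le> 4 * r * (2 * M\<^sup>2 * sqrt M))"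

lemma totals_lower:
  assumes "i \<in> {1..n}"
  shows "(real n - 1) / M \<le> row_total n w i" "(real n - 1) / M \<le> col_total n w i"
proof -
  have card: "(\<Sum>j\<in>{1..n} - {i}. 1 / M) = (real n - 1) / M"
    using assms n_ge_5 by (simp add: of_nat_diff)
  show "(real n - 1) / M \<le> row_total n w i"
    unfolding row_total_def card[symmetric]
    by (intro sum_mono w_bounds(1)) (use assms in \<open>auto simp: off_diag_iff\<close>)
  show "(real n - 1) / M \<le> col_total n w i"
    unfolding col_total_def card[symmetric]
    by (intro sum_mono w_bounds(1)) (use assms in \<open>auto simp: off_diag_iff\<close>)
qed

lemma totals_upper:
  assumes "i \<in> {1..n}"
  shows "row_total n w i \<le> real n * M" "col_total n w i \<le> real n * M"
proof -
  have "\<bar>w p\<bar> \<le> M" if "p \<in> off_diag n" for p using w_bounds(2)[OF that] w_pos[OF that] by simp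
  note * = abs_total_le[OF this _ assms]
  show "row_total n w i \<le> real n * M" "col_total n w i \<le> real n * M" using * M by fastforce+
qed

lemma smoothing_weight_bound:
  assumes "0 \<le> u" "u \<le> M" "(real n - 1) / M \<le> T"
  shows "\<bar>u / T\<bar> \<le> 2 * M\<^sup>2 / real n"
proof -
  have T: "real n / (2 * M) \<le> T"
    using assms(3) n_ge_5 M by (auto simp: field_simps elim!: order_trans[rotated])
  have pos: "0 < real n / (2 * M)" using M n_ge_5 by simp
  have "\<bar>u / T\<bar> = u / T" using assms(1) T pos by simp
  also have "\<dots> \<le> M / (real n / (2 * M))" by (rule frac_le) (use assms T pos M in auto)
  also have "\<dots> = 2 * M\<^sup>2 / real n" by (simp add: power2_eq_square)
  finally show ?thesis .
qed

text \<open>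
  Each condition is a Chernoff bound for a weighted sum of the noise, and there are \<open>4 n + p\<close> of
  them. With \<open>r\<^sup>2 = ln n\<close> the exponential is \<open>n\<^sup>-\<^sup>4\<close>, which beats the union bound.
\<close>
lemma good_event:
  assumes fam: "poisson_family \<M> (off_diag n) X w"
    and r: "0 < r" "4 * r\<^sup>2 \<le> real n"
  obtains G where "G \<in> sets \<M>" "measure \<M> (space \<M> - G) \<le> (4 * real n + real CARD('p)) * (2 * exp (- 4 * r\<^sup>2))"
    "\<And>\<omega>. \<omega> \<in> G \<Longrightarrow> good r (\<lambda>p. real (X p \<omega>) - w p)"
proof -
  interpret prob_space \<M> using fam by (simp add: poisson_family_def)
  have w0: "0 \<le> w p" if "p \<in> off_diag n" for p using w_pos[OF that] by simp
  have n1: "1 \<le> real n" using n_ge_5 by simp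
  have r_le: "2 * r \<le> real n"
  proof -
    have "(2 * r)\<^sup>2 \<le> real n" using r by (simp add: power_mult_distrib)
    also have "\<dots> \<le> (real n)\<^sup>2" using n1 by (simp add: power2_eq_square)
    finally show ?thesis by (rule power2_le_imp_le) simp
  qed
  have r_sqrt: "2 * r * 1 \<le> sqrt (real n * M)"
  proof (rule real_le_rsqrt)
    have "(2 * r * 1)\<^sup>2 \<le> real n" using r by (simp add: power_mult_distrib)
    also have "\<dots> \<le> real n * M" using M n1 by simp
    finally show "(2 * r * 1)\<^sup>2 \<le> real n * M" .
  qed
  have m1: "1 \<le> sqrt M" using M by simp
  have lin: "0 < sqrt (real n * M)" using M n1 by simp
  have cov: "0 < 13 * M ^ 4 * q * real n * sqrt M" using M n1 q by simp
  have smo: "0 < 2 * M\<^sup>2 * sqrt M" using M by simp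
  have covr: "2 * r * (13 * M ^ 4 * q) \<le> 13 * M ^ 4 * q * real n * sqrt M"
  proof -
    have "2 * r * (13 * M ^ 4 * q) \<le> real n * (13 * M ^ 4 * q)" using r_le M q by (intro mult_right_mono) auto
    also have "\<dots> \<le> real n * (13 * M ^ 4 * q) * sqrt M"
      using mult_left_mono[OF m1, of "real n * (13 * M ^ 4 * q)"] M q n1 by simp
    finally show ?thesis by (simp add: mult_ac)
  qed
  have smor: "2 * r * (2 * M\<^sup>2 / real n) \<le> 2 * M\<^sup>2 * sqrt M"
  proof -
    have "2 * r * (2 * M\<^sup>2 / real n) = (2 * r / real n) * (2 * M\<^sup>2)" by simp
    also have "\<dots> \<le> 1 * (2 * M\<^sup>2)" using r_le n1 by (intro mult_right_mono) auto
    also have "\<dots> \<le> 2 * M\<^sup>2 * sqrt M" using m1 M by simp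
    finally show ?thesis .
  qed
  define c1 where "c1 i p = (of_bool (fst p = i) :: real)" for i :: nat and p :: "nat \<times> nat"
  define c2 where "c2 j p = (of_bool (snd p = j) :: real)" for j :: nat and p :: "nat \<times> nat"
  define c3 where "c3 k p = resid p $ k" for k p
  define c4 where "c4 i p = of_bool (snd p \<noteq> i) * (w (i, snd p) / col_total n w (snd p))" for i and p :: "nat \<times> nat"
  define c5 where "c5 i p = of_bool (fst p \<noteq> i) * (w (fst p, i) / row_total n w (fst p))" for i and p :: "nat \<times> nat"
  have v1: "(\<Sum>p\<in>off_diag n. (c1 i p)\<^sup>2 * w p) \<le> (sqrt (real n * M))\<^sup>2" if "i \<in> {1..n}" for i
    using totals_upper(1)[OF that] M row_total_indicator[OF that, of w]
    by (simp add: c1_def power2_eq_square of_bool_conj[symmetric])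
  have v2: "(\<Sum>p\<in>off_diag n. (c2 i p)\<^sup>2 * w p) \<le> (sqrt (real n * M))\<^sup>2" if "i \<in> {1..n}" for i
    using totals_upper(2)[OF that] M col_total_indicator[OF that, of w]
    by (simp add: c2_def power2_eq_square of_bool_conj[symmetric])
  have gen: "(\<Sum>p\<in>off_diag n. (c p)\<^sup>2 * w p) \<le> (real n)\<^sup>2 * (C\<^sup>2 * M)"
    if "\<And>p. p \<in> off_diag n \<Longrightarrow> \<bar>c p\<bar> \<le> C" "0 \<le> C" for c C
  proof -
    have *: "\<bar>(c p)\<^sup>2 * w p\<bar> \<le> C\<^sup>2 * M" if p: "p \<in> off_diag n" for p
      using \<open>0 \<le> C\<close> \<open>\<And>p. p \<in> off_diag n \<Longrightarrow> \<bar>c p\<bar> \<le> C\<close>[OF p] w_bounds(2)[OF p] w0[OF p] M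
      by (auto simp: abs_mult abs_le_square_iff[symmetric] intro!: mult_mono)
    have "\<bar>\<Sum>p\<in>off_diag n. (c p)\<^sup>2 * w p\<bar> \<le> (real n)\<^sup>2 * (C\<^sup>2 * M)"
      by (rule sum_abs_le_square[OF *]) (use M in auto)
    then show ?thesis by (rule abs_le_D1)
  qed
  have b3: "\<bar>c3 k p\<bar> \<le> 13 * M ^ 4 * q" if "p \<in> off_diag n" for k p
    unfolding c3_def by (rule resid_bound[OF that])
  have v3: "(\<Sum>p\<in>off_diag n. (c3 k p)\<^sup>2 * w p) \<le> (13 * M ^ 4 * q * real n * sqrt M)\<^sup>2" for k
    using gen[of "c3 k" "13 * M ^ 4 * q", OF b3] M q by (simp add: power_mult_distrib mult_ac)
  have b4: "\<bar>c4 i p\<bar> \<le> 2 * M\<^sup>2 / real n" if "p \<in> off_diag n" "i \<in> {1..n}" for i p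
  proof (cases "snd p = i")
    case False
    then have a: "(i, snd p) \<in> off_diag n" "snd p \<in> {1..n}" using that by (auto simp: off_diag_def)
    have "c4 i p = w (i, snd p) / col_total n w (snd p)" using False by (simp add: c4_def)
    then show ?thesis
      using smoothing_weight_bound[OF w0[OF a(1)] w_bounds(2)[OF a(1)] totals_lower(2)[OF a(2)]] by (simp only:)
  qed (use M in \<open>simp add: c4_def\<close>)
  have b5: "\<bar>c5 i p\<bar> \<le> 2 * M\<^sup>2 / real n" if "p \<in> off_diag n" "i \<in> {1..n}" for i p
  proof (cases "fst p = i")
    case False
    then have a: "(fst p, i) \<in> off_diag n" "fst p \<in> {1..n}" using that by (auto simp: off_diag_def)
    have "c5 i p = w (fst p, i) / row_total n w (fst p)" using False by (simp add: c5_def)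
    then show ?thesis
      using smoothing_weight_bound[OF w0[OF a(1)] w_bounds(2)[OF a(1)] totals_lower(1)[OF a(2)]] by (simp only:)
  qed (use M in \<open>simp add: c5_def\<close>)
  have sq: "(real n)\<^sup>2 * ((2 * M\<^sup>2 / real n)\<^sup>2 * M) = (2 * M\<^sup>2 * sqrt M)\<^sup>2"
    using n1 M by (simp add: power_mult_distrib power_divide)
  have v4: "(\<Sum>p\<in>off_diag n. (c4 i p)\<^sup>2 * w p) \<le> (2 * M\<^sup>2 * sqrt M)\<^sup>2" if "i \<in> {1..n}" for i
    unfolding sq[symmetric] using b4 that by (intro gen) auto
  have v5: "(\<Sum>p\<in>off_diag n. (c5 i p)\<^sup>2 * w p) \<le> (2 * M\<^sup>2 * sqrt M)\<^sup>2" if "i \<in> {1..n}" for i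
    unfolding sq[symmetric] using b5 that by (intro gen) auto
  define E1 where "E1 = bad_event \<M> (off_diag n) X w (4 * r * sqrt (real n * M)) {1..n} c1"
  have T1: "E1 \<in> sets \<M>" "measure \<M> E1 \<le> real n * (2 * exp (- 4 * r\<^sup>2))"
    using bad_event_bound[OF fam, of "{1..n}" c1 "1", OF _ _ v1 lin r(1) r_sqrt]
    unfolding E1_def[symmetric] by (auto simp: c1_def)
  define E2 where "E2 = bad_event \<M> (off_diag n) X w (4 * r * sqrt (real n * M)) {1..n} c2"
  have T2: "E2 \<in> sets \<M>" "measure \<M> E2 \<le> real n * (2 * exp (- 4 * r\<^sup>2))"
    using bad_event_bound[OF fam, of "{1..n}" c2 "1", OF _ _ v2 lin r(1) r_sqrt]
    unfolding E2_def[symmetric] by (auto simp: c2_def)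
  define E3 where "E3 = bad_event \<M> (off_diag n) X w (4 * r * (13 * M ^ 4 * q * real n * sqrt M)) UNIV c3"
  have T3: "E3 \<in> sets \<M>" "measure \<M> E3 \<le> real CARD('p) * (2 * exp (- 4 * r\<^sup>2))"
    using bad_event_bound[OF fam, of UNIV c3 "13 * M ^ 4 * q", OF _ b3 v3 cov r(1) covr]
    unfolding E3_def[symmetric] by auto
  define E4 where "E4 = bad_event \<M> (off_diag n) X w (4 * r * (2 * M\<^sup>2 * sqrt M)) {1..n} c4"
  have T4: "E4 \<in> sets \<M>" "measure \<M> E4 \<le> real n * (2 * exp (- 4 * r\<^sup>2))"
    using bad_event_bound[OF fam, of "{1..n}" c4 "2 * M\<^sup>2 / real n", OF _ b4 v4 smo r(1) smor]
    unfolding E4_def[symmetric] by auto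
  define E5 where "E5 = bad_event \<M> (off_diag n) X w (4 * r * (2 * M\<^sup>2 * sqrt M)) {1..n} c5"
  have T5: "E5 \<in> sets \<M>" "measure \<M> E5 \<le> real n * (2 * exp (- 4 * r\<^sup>2))"
    using bad_event_bound[OF fam, of "{1..n}" c5 "2 * M\<^sup>2 / real n", OF _ b5 v5 smo r(1) smor]
    unfolding E5_def[symmetric] by auto
  note [measurable] = T1(1) T2(1) T3(1) T4(1) T5(1)
  define G where "G = space \<M> - (E1 \<union> (E2 \<union> (E3 \<union> (E4 \<union> E5))))"
  have sub: "E1 \<union> (E2 \<union> (E3 \<union> (E4 \<union> E5))) \<subseteq> space \<M>"
    by (auto simp: E1_def E2_def E3_def E4_def E5_def bad_event_def)
  show thesis
  proof (rule that[of G])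
    show "G \<in> sets \<M>" unfolding G_def by measurable
    have "space \<M> - G = E1 \<union> (E2 \<union> (E3 \<union> (E4 \<union> E5)))" using sub by (auto simp: G_def)
    moreover have "measure \<M> (E1 \<union> (E2 \<union> (E3 \<union> (E4 \<union> E5))))
        \<le> measure \<M> E1 + (measure \<M> E2 + (measure \<M> E3 + (measure \<M> E4 + measure \<M> E5)))"
      by (intro order_trans[OF measure_Un_le] add_left_mono order_refl; measurable)
    ultimately show "measure \<M> (space \<M> - G) \<le> (4 * real n + real CARD('p)) * (2 * exp (- 4 * r\<^sup>2))"
      using T1(2) T2(2) T3(2) T4(2) T5(2) by (simp only: distrib_right)
    fix \<omega> assume "\<omega> \<in> G"
    then have \<omega>: "\<omega> \<in> space \<M>" "\<omega> \<notin> E1" "\<omega> \<notin> E2" "\<omega> \<notin> E3" "\<omega> \<notin> E4" "\<omega> \<notin> E5" by (auto simp: G_def)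
    let ?\<xi> = "\<lambda>p. real (X p \<omega>) - w p"
    have r1: "row_total n ?\<xi> i = (\<Sum>p\<in>off_diag n. c1 i p * ?\<xi> p)" if "i \<in> {1..n}" for i
      unfolding c1_def by (rule row_total_indicator[OF that])
    have r2: "col_total n ?\<xi> i = (\<Sum>p\<in>off_diag n. c2 i p * ?\<xi> p)" if "i \<in> {1..n}" for i
      unfolding c2_def by (rule col_total_indicator[OF that])
    have r3: "(\<Sum>p\<in>off_diag n. ?\<xi> p *\<^sub>R resid p) $ k = (\<Sum>p\<in>off_diag n. c3 k p * ?\<xi> p)" for k
      by (simp add: c3_def mult.commute)
    have r4: "(\<Sum>j\<in>{1..n} - {i}. w (i, j) * (col_total n ?\<xi> j / col_total n w j)) = (\<Sum>p\<in>off_diag n. c4 i p * ?\<xi> p)" if "i \<in> {1..n}" for i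
      using sum_col_totals[OF that, of "\<lambda>j. w (i, j) / col_total n w j" ?\<xi>] by (simp add: c4_def)
    have r5: "(\<Sum>j\<in>{1..n} - {i}. w (j, i) * (row_total n ?\<xi> j / row_total n w j)) = (\<Sum>p\<in>off_diag n. c5 i p * ?\<xi> p)" if "i \<in> {1..n}" for i
      using sum_row_totals[OF that, of "\<lambda>j. w (j, i) / row_total n w j" ?\<xi>] by (simp add: c5_def)
    show "good r ?\<xi>"
      unfolding good_def
    proof (intro conjI ballI allI)
      fix i assume i: "i \<in> {1..n}"
      show "\<bar>row_total n ?\<xi> i\<bar> \<le> 4 * r * sqrt (real n * M)" unfolding r1[OF i] by (rule not_bad_event[OF \<omega>(1) \<omega>(2)[unfolded E1_def] i])
      show "\<bar>col_total n ?\<xi> i\<bar> \<le> 4 * r * sqrt (real n * M)" unfolding r2[OF i] by (rule not_bad_event[OF \<omega>(1) \<omega>(3)[unfolded E2_def] i])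
      show "\<bar>\<Sum>j\<in>{1..n} - {i}. w (i, j) * (col_total n ?\<xi> j / col_total n w j)\<bar> \<le> 4 * r * (2 * M\<^sup>2 * sqrt M)"
        unfolding r4[OF i] by (rule not_bad_event[OF \<omega>(1) \<omega>(5)[unfolded E4_def] i])
      show "\<bar>\<Sum>j\<in>{1..n} - {i}. w (j, i) * (row_total n ?\<xi> j / row_total n w j)\<bar> \<le> 4 * r * (2 * M\<^sup>2 * sqrt M)"
        unfolding r5[OF i] by (rule not_bad_event[OF \<omega>(1) \<omega>(6)[unfolded E5_def] i])
    next
      fix k
      show "\<bar>(\<Sum>p\<in>off_diag n. ?\<xi> p *\<^sub>R resid p) $ k\<bar> \<le> 4 * r * (13 * M ^ 4 * q * real n * sqrt M)"
        unfolding r3 by (rule not_bad_event[OF \<omega>(1) \<omega>(4)[unfolded E3_def] UNIV_I])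
    qed
  qed
qed

end

section \<open>Orders of magnitude\<close>

text \<open>
  Bookkeeping of powers. Here \<open>M = e\<^sup>\<rho>\<close>, \<open>R = n\<^sup>1\<^sup>/\<^sup>2\<close> and \<open>s = (ln n)\<^sup>1\<^sup>/\<^sup>2\<close>, while \<open>Y\<close> is a
  constant times \<open>\<kappa> e\<^sup>2\<^sup>3\<^sup>\<rho> ln n / n\<^sup>1\<^sup>/\<^sup>2\<close>, the quantity that tends to \<open>0\<close>. The radius \<open>\<tau>\<close> is twice the
  sup-norm of the linear solution for the noise. The factor \<open>R sqrt M\<close> in the last claim bounds the
  normalisation: the standard deviation of the estimators is at least \<open>(n M)\<^sup>-\<^sup>1\<^sup>/\<^sup>2\<close>.
\<close>
lemma rate_bounds:
  fixes M s R \<kappa> q P K Y \<tau> :: real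
  assumes M: "1 \<le> M" and s: "1 \<le> s" and R: "1 \<le> R" and q: "1 \<le> q" and P: "1 \<le> P" and \<kappa>: "0 < \<kappa>"
    and K: "K = 13 * M ^ 5 * q\<^sup>2 * \<kappa>" "1 \<le> K"
    and Y: "Y = K * M ^ 18 * s\<^sup>2 / R" "20000 * P\<^sup>2 * Y \<le> 1"
    and \<tau>: "\<tau> = 2 * (12 * M ^ 3 * (4 * s * (R * sqrt M)) / R\<^sup>2
        + P * (13 * M ^ 4 * q) * (\<kappa> / (R\<^sup>2)\<^sup>2 * (4 * s * (13 * M ^ 4 * q * R\<^sup>2 * sqrt M))))"
  shows "0 \<le> \<tau>" "\<tau> \<le> 1"
    and "(12 * M ^ 3 + 169 * P * q\<^sup>2 * \<kappa> * M ^ 8) * (M * (2 * \<tau>)) \<le> 1 / 2"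
    and "R * sqrt M * (12 * M ^ 3 * (4 * s * (2 * M\<^sup>2 * sqrt M) / R\<^sup>2 + M * \<tau>\<^sup>2)
      + 12 * P * q * M ^ 4 * \<kappa> * (4 * s * (13 * M ^ 4 * q * R\<^sup>2 * sqrt M) / (R\<^sup>2)\<^sup>2 + 13 * q * M ^ 5 * \<tau>\<^sup>2))
      \<le> 1000000 * P ^ 3 * Y"
proof -
  define m where "m = sqrt M"
  have m: "1 \<le> m" "M = m\<^sup>2" using M by (auto simp: m_def)
  have pos: "0 < m" "0 < s" "0 < R" "0 < q" "0 < P" using m s R q P by auto
  have "0 < K" using K(2) by linarith
  note pos = pos this
  have mpow: "m ^ i \<le> m ^ j" if "i \<le> j" for i j using m that by (intro power_increasing)
  have Kk: "K = 13 * m ^ 10 * q\<^sup>2 * \<kappa>" unfolding K(1) m(2) by (simp flip: power_mult)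
  have Yy: "Y = K * m ^ 36 * s\<^sup>2 / R" unfolding Y(1) m(2) by (simp flip: power_mult)
  have Y0: "0 < Y" unfolding Yy using pos by simp
  have s2: "s \<le> s\<^sup>2" using s by (simp add: power2_eq_square)
  \<comment> \<open>in terms of \<open>m = sqrt M\<close>, every error term is at most a constant times one of these\<close>
  have absorb: "K * m ^ i * s / R \<le> Y" "K * m ^ i * s\<^sup>2 / R \<le> Y" "m ^ i * s / R \<le> Y" "m ^ i * s\<^sup>2 / R \<le> Y"
    if "i \<le> 36" for i
  proof -
    have a: "K * m ^ i * s\<^sup>2 / R \<le> Y" unfolding Yy
      using pos mpow[OF that] by (intro divide_right_mono mult_right_mono mult_left_mono) auto
    have b: "K * m ^ i * s / R \<le> K * m ^ i * s\<^sup>2 / R"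
      using pos s2 by (intro divide_right_mono mult_left_mono) auto
    have c: "m ^ i * s / R \<le> K * m ^ i * s / R" "m ^ i * s\<^sup>2 / R \<le> K * m ^ i * s\<^sup>2 / R"
      using pos K(2) by (auto intro!: divide_right_mono simp: mult_le_cancel_right1)
    show "K * m ^ i * s / R \<le> Y" "K * m ^ i * s\<^sup>2 / R \<le> Y" "m ^ i * s / R \<le> Y" "m ^ i * s\<^sup>2 / R \<le> Y"
      using a b c by linarith+
  qed
  have P2: "1 \<le> P\<^sup>2" "P \<le> P\<^sup>2" "P\<^sup>2 \<le> P ^ 3" "P \<le> P ^ 3" "1 \<le> P ^ 3"
    using P power_increasing[of 1 2 P] power_increasing[of 2 3 P] power_increasing[of 1 3 P] one_le_power[of P] by auto
  have Y1: "Y \<le> 1"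
  proof -
    have "Y \<le> 20000 * P\<^sup>2 * Y" using P2 Y0 by (simp add: mult_le_cancel_right1)
    then show ?thesis using Y(2) by simp
  qed
  have KR: "K / R \<le> 1"
  proof -
    have "K / R \<le> K * m ^ 0 * s / R" using pos s by (intro divide_right_mono) auto
    then show ?thesis using absorb(1)[of 0] Y1 by linarith
  qed
  have \<tau>_eq: "\<tau> = 96 * (m ^ 7 * s / R) + 104 * P * (m ^ 7 * s / R * (K / R))"
    unfolding \<tau> Kk m_def[symmetric] m(2) using pos
    by (simp add: field_simps power2_eq_square power_numeral_reduce)
  show \<tau>0: "0 \<le> \<tau>" unfolding \<tau>_eq using pos by simp
  have \<tau>_le: "\<tau> \<le> 200 * P * (m ^ 7 * s / R)"
  proof -
    have "m ^ 7 * s / R * (K / R) \<le> m ^ 7 * s / R * 1" using pos KR by (intro mult_left_mono) auto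
    then have le: "m ^ 7 * s / R * (K / R) \<le> m ^ 7 * s / R" by simp
    have "104 * P * (m ^ 7 * s / R * (K / R)) \<le> 104 * P * (m ^ 7 * s / R)"
      using pos by (intro mult_left_mono le) auto
    moreover have "96 * (m ^ 7 * s / R) \<le> 96 * P * (m ^ 7 * s / R)" using pos P
      by (intro mult_right_mono) auto
    ultimately show ?thesis unfolding \<tau>_eq by linarith
  qed
  have "200 * P * (m ^ 7 * s / R) \<le> 200 * P\<^sup>2 * Y"
    using absorb(3)[of 7] P2 pos Y0 by (intro mult_mono) auto
  then show "\<tau> \<le> 1" using \<tau>_le Y(2) Y0 P2 by linarith
  have \<tau>2: "\<tau>\<^sup>2 \<le> 40000 * P\<^sup>2 * (m ^ 14 * s\<^sup>2 / R\<^sup>2)"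
  proof -
    have "\<tau>\<^sup>2 \<le> (200 * P * (m ^ 7 * s / R))\<^sup>2" by (rule power_mono[OF \<tau>_le \<tau>0])
    also have "\<dots> = 40000 * P\<^sup>2 * (m ^ 14 * s\<^sup>2 / R\<^sup>2)"
      by (simp add: power_mult_distrib power_divide flip: power_mult)
    finally show ?thesis .
  qed
  have A: "12 * M ^ 3 + 169 * P * q\<^sup>2 * \<kappa> * M ^ 8 \<le> 25 * P * K * m ^ 6"
  proof -
    have "169 * P * q\<^sup>2 * \<kappa> * M ^ 8 = 13 * P * K * m ^ 6"
      unfolding Kk m(2) by (simp add: power_numeral_reduce power2_eq_square)
    moreover have "12 * M ^ 3 = 12 * m ^ 6" unfolding m(2) by (simp flip: power_mult)
    moreover have "1 * m ^ 6 \<le> (P * K) * m ^ 6"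
      using P K pos mult_mono[of 1 P 1 K] by (intro mult_right_mono) auto
    ultimately show ?thesis by linarith
  qed
  have "(12 * M ^ 3 + 169 * P * q\<^sup>2 * \<kappa> * M ^ 8) * (M * (2 * \<tau>))
      \<le> (25 * P * K * m ^ 6) * (m\<^sup>2 * (2 * (200 * P * (m ^ 7 * s / R))))"
    unfolding m(2)[symmetric] using A \<tau>_le \<tau>0 M pos by (intro mult_mono) auto
  also have "\<dots> = 10000 * P\<^sup>2 * (K * m ^ 15 * s / R)"
    by (simp add: power_numeral_reduce power2_eq_square)
  also have "\<dots> \<le> 10000 * P\<^sup>2 * Y" using absorb(1)[of 15] P2 by (intro mult_left_mono) auto
  also have "\<dots> \<le> 1 / 2" using Y(2) by simp
  finally show "(12 * M ^ 3 + 169 * P * q\<^sup>2 * \<kappa> * M ^ 8) * (M * (2 * \<tau>)) \<le> 1 / 2" .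
  have e1: "R * m * (12 * M ^ 3 * (4 * s * (2 * M\<^sup>2 * m) / R\<^sup>2)) = 96 * (m ^ 12 * s / R)"
    unfolding m(2) using pos by (simp add: field_simps power2_eq_square power_numeral_reduce)
  have e2: "R * m * (12 * M ^ 3 * (M * \<tau>\<^sup>2)) \<le> 480000 * P\<^sup>2 * (m ^ 23 * s\<^sup>2 / R)"
  proof -
    have "R * m * (12 * M ^ 3 * (M * \<tau>\<^sup>2)) \<le> R * m * (12 * M ^ 3 * (M * (40000 * P\<^sup>2 * (m ^ 14 * s\<^sup>2 / R\<^sup>2))))"
      using \<tau>2 pos M by (intro mult_left_mono) auto
    also have "\<dots> = 480000 * P\<^sup>2 * (m ^ 23 * s\<^sup>2 / R)"
      unfolding m(2) using pos by (simp add: field_simps power2_eq_square power_numeral_reduce)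
    finally show ?thesis .
  qed
  have e3: "R * m * (12 * P * q * M ^ 4 * \<kappa> * (4 * s * (13 * M ^ 4 * q * R\<^sup>2 * m) / (R\<^sup>2)\<^sup>2)) = 48 * P * (K * m ^ 8 * s / R)"
    unfolding m(2) Kk using pos by (simp add: field_simps power2_eq_square power_numeral_reduce)
  have e4: "R * m * (12 * P * q * M ^ 4 * \<kappa> * (13 * q * M ^ 5 * \<tau>\<^sup>2)) \<le> 480000 * P ^ 3 * (K * m ^ 23 * s\<^sup>2 / R)"
  proof -
    have "R * m * (12 * P * q * M ^ 4 * \<kappa> * (13 * q * M ^ 5 * \<tau>\<^sup>2))
        \<le> R * m * (12 * P * q * M ^ 4 * \<kappa> * (13 * q * M ^ 5 * (40000 * P\<^sup>2 * (m ^ 14 * s\<^sup>2 / R\<^sup>2))))"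
      using \<tau>2 pos M \<kappa> by (intro mult_left_mono) auto
    also have "\<dots> = 480000 * P ^ 3 * (K * m ^ 23 * s\<^sup>2 / R)"
      unfolding m(2) Kk using pos by (simp add: field_simps power2_eq_square power_numeral_reduce)
    finally show ?thesis .
  qed
  have "R * m * (12 * M ^ 3 * (4 * s * (2 * M\<^sup>2 * m) / R\<^sup>2 + M * \<tau>\<^sup>2)
      + 12 * P * q * M ^ 4 * \<kappa> * (4 * s * (13 * M ^ 4 * q * R\<^sup>2 * m) / (R\<^sup>2)\<^sup>2 + 13 * q * M ^ 5 * \<tau>\<^sup>2))
      \<le> 96 * (m ^ 12 * s / R) + 480000 * P\<^sup>2 * (m ^ 23 * s\<^sup>2 / R) + (48 * P * (K * m ^ 8 * s / R)
        + 480000 * P ^ 3 * (K * m ^ 23 * s\<^sup>2 / R))"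
    using e1 e2 e3 e4 by (simp only: distrib_left)
  also have "\<dots> \<le> 96 * P ^ 3 * Y + 480000 * P ^ 3 * Y + (48 * P ^ 3 * Y + 480000 * P ^ 3 * Y)"
    using absorb(1)[of 8] absorb(2)[of 23] absorb(3)[of 12] absorb(4)[of 23] P2 pos Y0
    by (intro add_mono mult_mono) auto
  also have "\<dots> = 960144 * (P ^ 3 * Y)" by simp
  also have "\<dots> \<le> 1000000 * (P ^ 3 * Y)" using pos Y0 by (intro mult_right_mono) auto
  also have "\<dots> = 1000000 * P ^ 3 * Y" by simp
  finally show "R * sqrt M * (12 * M ^ 3 * (4 * s * (2 * M\<^sup>2 * sqrt M) / R\<^sup>2 + M * \<tau>\<^sup>2)
      + 12 * P * q * M ^ 4 * \<kappa> * (4 * s * (13 * M ^ 4 * q * R\<^sup>2 * sqrt M) / (R\<^sup>2)\<^sup>2 + 13 * q * M ^ 5 * \<tau>\<^sup>2))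
      \<le> 1000000 * P ^ 3 * Y" unfolding m_def .
qed

section \<open>The limit law of the first order term\<close>

lemma norm_iexp_diff_le: "norm (iexp a - iexp b) \<le> \<bar>a - b\<bar>" "norm (iexp a - iexp b) \<le> 2"
proof -
  have "iexp a - iexp b = iexp b * (iexp (a - b) - 1)"
    by (simp add: algebra_simps flip: exp_add)
  then have "norm (iexp a - iexp b) = norm (iexp (a - b) - 1)" by (simp add: norm_mult)
  also have "\<dots> \<le> \<bar>a - b\<bar>" using iexp_approx1[of "a - b" 0] by simp
  finally show "norm (iexp a - iexp b) \<le> \<bar>a - b\<bar>" .
  show "norm (iexp a - iexp b) \<le> 2"
    using norm_triangle_ineq4[of "iexp a" "iexp b"] by simp
qed

text \<open>
  Variables that are uniformly close on an event of large probability have close characteristic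
  functions.
\<close>
lemma char_perturbation:
  fixes Y1 Y2 :: "'w \<Rightarrow> real"
  assumes "prob_space \<M>" "Y1 \<in> borel_measurable \<M>" "Y2 \<in> borel_measurable \<M>" "G \<in> sets \<M>"
    and close: "\<And>\<omega>. \<omega> \<in> G \<Longrightarrow> \<bar>Y1 \<omega> - Y2 \<omega>\<bar> \<le> \<epsilon>" and "0 \<le> \<epsilon>"
  shows "norm ((\<integral>\<omega>. iexp (Y1 \<omega>) \<partial>\<M>) - (\<integral>\<omega>. iexp (Y2 \<omega>) \<partial>\<M>)) \<le> \<epsilon> + 2 * measure \<M> (space \<M> - G)"
proof -
  interpret prob_space \<M> by fact
  note [measurable] = assms(2,3,4)
  have int: "integrable \<M> (\<lambda>\<omega>. iexp (Y1 \<omega>))" "integrable \<M> (\<lambda>\<omega>. iexp (Y2 \<omega>))"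
    by (rule integrable_const_bound[of _ 1]; simp)+
  have bound: "norm (iexp (Y1 \<omega>) - iexp (Y2 \<omega>)) \<le> \<epsilon> + 2 * indicator (space \<M> - G) \<omega>"
    if "\<omega> \<in> space \<M>" for \<omega>
  proof (cases "\<omega> \<in> G")
    case True
    then show ?thesis
      using order_trans[OF norm_iexp_diff_le(1)[of "Y1 \<omega>" "Y2 \<omega>"] close[OF True]] by simp
  next
    case False
    then show ?thesis using norm_iexp_diff_le(2)[of "Y1 \<omega>" "Y2 \<omega>"] that \<open>0 \<le> \<epsilon>\<close> by simp
  qed
  have int': "integrable \<M> (\<lambda>\<omega>. 2 * indicator (space \<M> - G) \<omega> :: real)"
    by (intro integrable_mult_right integrable_real_indicator) (auto simp: emeasure_eq_measure)
  have "norm (\<integral>\<omega>. iexp (Y1 \<omega>) - iexp (Y2 \<omega>) \<partial>\<M>) \<le> (\<integral>\<omega>. \<epsilon> + 2 * indicator (space \<M> - G) \<omega> \<partial>\<M>)"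
  proof (rule order_trans[OF integral_norm_bound integral_mono])
    show "integrable \<M> (\<lambda>\<omega>. norm (iexp (Y1 \<omega>) - iexp (Y2 \<omega>)))"
      by (rule integrable_norm[OF Bochner_Integration.integrable_diff[OF int]])
    show "integrable \<M> (\<lambda>\<omega>. \<epsilon> + 2 * indicator (space \<M> - G) \<omega>)"
      by (rule Bochner_Integration.integrable_add[OF integrable_const int'])
  qed (rule bound)
  also have "\<dots> = \<epsilon> + 2 * measure \<M> (space \<M> - G)"
    using int' by (simp add: prob_space)
  finally show ?thesis by (simp add: int)
qed

context bounded_network
begin

text \<open>
  The first order term in the direction \<open>s\<close> is a weighted noise sum with coefficients
  \<open>s\<^sub>i / u\<^sub>i\<close> in the selected rows and \<open>\<Sum> s\<^sub>i / u\<^sub>n\<close> in the last column. Its variance \<open>V\<close> is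
  the form \<open>v\<close> of \<open>S\<close> plus the contribution of the cells that the last column shares with the selected rows.
  There are as many of these as selected rows, so their share is of order \<open>M\<^sup>2 / n\<close>.
\<close>
lemma linear_statistic_char:
  fixes idx :: "'k::finite \<Rightarrow> nat" and s :: "'k \<Rightarrow> real"
  assumes fam: "poisson_family \<M> (off_diag n) X w"
    and idx: "inj idx" "\<And>i. idx i \<in> {1..n}" "\<And>i. idx i \<noteq> n"
    and v: "(\<Sum>i\<in>UNIV. (s i)\<^sup>2 / row_total n w (idx i)) + (\<Sum>i\<in>UNIV. s i)\<^sup>2 / col_total n w n = v"
    and D: "\<And>i. i \<in> {1..n} \<Longrightarrow> (real n - 1) / M \<le> row_total n w i" "(real n - 1) / M \<le> col_total n w n"
  shows "\<exists>\<zeta> V. (\<integral>\<omega>. iexp (\<Sum>i\<in>UNIV. s i * (row_total n (\<lambda>p. real (X p \<omega>) - w p) (idx i) / row_total n w (idx i)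
             + col_total n (\<lambda>p. real (X p \<omega>) - w p) n / col_total n w n)) \<partial>\<M>) = exp (\<zeta> - complex_of_real (V / 2))
      \<and> \<bar>V - v\<bar> \<le> 2 * real CARD('k) * v * (M\<^sup>2 / (real n - 1))
      \<and> norm \<zeta> \<le> (real CARD('k) + 1) * sqrt (v * (M / (real n - 1))) * V"
proof -
  define d where "d = (real n - 1) / M"
  have d: "0 < d" using n_ge_5 M by (simp add: d_def)
  have n: "n \<in> {1..n}" using n_ge_5 by simp
  define \<rho> where "\<rho> i = row_total n w (idx i)" for i
  define \<kappa> where "\<kappa> = col_total n w n"
  have row: "d \<le> \<rho> i" for i using D(1)[OF idx(2)] by (simp add: d_def \<rho>_def)
  have col: "d \<le> \<kappa>" using D(2) by (simp add: d_def \<kappa>_def)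
  have pos: "0 < \<rho> i" "0 < \<kappa>" for i using row[of i] col d by linarith+
  define a where "a i = s i / \<rho> i" for i
  define e where "e = (\<Sum>i\<in>UNIV. s i) / \<kappa>"
  have v: "v = (\<Sum>i\<in>UNIV. (a i)\<^sup>2 * \<rho> i) + e\<^sup>2 * \<kappa>"
    unfolding v[symmetric] a_def e_def \<rho>_def[symmetric] \<kappa>_def[symmetric]
    using pos by (simp add: power2_eq_square less_imp_neq[symmetric])
  have v0: "0 \<le> v" unfolding v using pos by (intro add_nonneg_nonneg sum_nonneg) (auto simp: less_imp_le)
  have a_bd: "\<bar>a i\<bar> \<le> sqrt (v / d)" for i
  proof (rule real_le_rsqrt)
    have "(a i)\<^sup>2 * \<rho> i \<le> (\<Sum>i\<in>UNIV. (a i)\<^sup>2 * \<rho> i)"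
      using pos by (intro member_le_sum) (auto simp: less_imp_le)
    also have "\<dots> \<le> v" unfolding v using pos by simp
    finally have "(a i)\<^sup>2 * d \<le> v" using mult_left_mono[OF row[of i], of "(a i)\<^sup>2"] by simp
    then show "\<bar>a i\<bar>\<^sup>2 \<le> v / d" using d by (simp add: pos_le_divide_eq)
  qed
  have e_bd: "\<bar>e\<bar> \<le> sqrt (v / d)"
  proof (rule real_le_rsqrt)
    have "0 \<le> (\<Sum>i\<in>UNIV. (a i)\<^sup>2 * \<rho> i)" using pos by (intro sum_nonneg) (auto simp: less_imp_le)
    then have "e\<^sup>2 * \<kappa> \<le> v" unfolding v by simp
    then have "e\<^sup>2 * d \<le> v" using mult_left_mono[OF col, of "e\<^sup>2"] by simp
    then show "\<bar>e\<bar>\<^sup>2 \<le> v / d" using d by (simp add: pos_le_divide_eq)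
  qed
  define b where "b f = (\<Sum>i\<in>UNIV. of_bool (f = idx i) * a i)" for f
  have b_idx: "b (idx i) = a i" for i
  proof -
    have "b (idx i) = (\<Sum>j\<in>UNIV. of_bool (i = j) * a j)"
      unfolding b_def using idx(1) by (intro sum.cong refl) (simp add: inj_eq)
    then show ?thesis by (simp add: sum_of_bool_mult)
  qed
  have b_sum: "(\<Sum>p\<in>off_diag n. b (fst p) * h p) = (\<Sum>i\<in>UNIV. a i * row_total n h (idx i))" for h
  proof -
    have "(\<Sum>p\<in>off_diag n. b (fst p) * h p) = (\<Sum>i\<in>UNIV. a i * (\<Sum>p\<in>off_diag n. of_bool (fst p = idx i) * h p))"
      unfolding b_def sum_distrib_left sum_distrib_right by (subst sum.swap) (simp add: mult_ac)
    then show ?thesis by (simp only: row_total_indicator[OF idx(2)])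
  qed
  define c where "c p = b (fst p) + of_bool (snd p = n) * e" for p :: "nat \<times> nat"
  have stat: "(\<Sum>i\<in>UNIV. s i * (row_total n h (idx i) / \<rho> i + col_total n h n / \<kappa>)) = (\<Sum>p\<in>off_diag n. c p * h p)" for h
  proof -
    have "(\<Sum>p\<in>off_diag n. c p * h p) = (\<Sum>p\<in>off_diag n. b (fst p) * h p) + e * (\<Sum>p\<in>off_diag n. of_bool (snd p = n) * h p)"
      unfolding c_def sum_distrib_left sum.distrib[symmetric] by (intro sum.cong refl) (simp add: algebra_simps)
    also have "\<dots> = (\<Sum>i\<in>UNIV. a i * row_total n h (idx i)) + e * col_total n h n"
      by (simp only: b_sum col_total_indicator[OF n])
    also have "\<dots> = (\<Sum>i\<in>UNIV. s i * (row_total n h (idx i) / \<rho> i + col_total n h n / \<kappa>))"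
      by (simp add: a_def e_def distrib_left sum.distrib sum_divide_distrib sum_distrib_right)
    finally show ?thesis by simp
  qed
  define C where "C = (real CARD('k) + 1) * sqrt (v / d)"
  have "\<bar>c p\<bar> \<le> C" for p
  proof -
    have "\<bar>b (fst p)\<bar> \<le> (\<Sum>i\<in>(UNIV::'k set). sqrt (v / d))"
      unfolding b_def
    proof (rule order_trans[OF sum_abs], rule sum_mono)
      fix i
      show "\<bar>of_bool (fst p = idx i) * a i\<bar> \<le> sqrt (v / d)" using a_bd[of i] v0 d by simp
    qed
    moreover have "\<bar>of_bool (snd p = n) * e\<bar> \<le> sqrt (v / d)" using e_bd v0 d by simp
    ultimately show ?thesis unfolding c_def C_def by (simp add: algebra_simps)
  qed
  then obtain \<zeta> where \<zeta>: "(\<integral>\<omega>. iexp (\<Sum>p\<in>off_diag n. c p * (real (X p \<omega>) - w p)) \<partial>\<M>)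
        = exp (\<zeta> - complex_of_real ((\<Sum>p\<in>off_diag n. (c p)\<^sup>2 * w p) / 2))"
      "norm \<zeta> \<le> C * (\<Sum>p\<in>off_diag n. (c p)\<^sup>2 * w p)"
    using poisson_family_char_approx[OF fam, of c C] by blast
  define V where "V = (\<Sum>p\<in>off_diag n. (c p)\<^sup>2 * w p)"
  have "V - v = (\<Sum>i\<in>UNIV. a i * (2 * e * w (idx i, n)))"
  proof -
    have "V = (\<Sum>p\<in>off_diag n. b (fst p) * (b (fst p) * w p)) + (\<Sum>p\<in>off_diag n. b (fst p) * (2 * e * (of_bool (snd p = n) * w p)))
        + e\<^sup>2 * (\<Sum>p\<in>off_diag n. of_bool (snd p = n) * w p)"
      unfolding V_def c_def sum_distrib_left sum.distrib[symmetric]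
      by (intro sum.cong refl) (auto simp: power2_eq_square algebra_simps)
    moreover have "row_total n (\<lambda>p. b (fst p) * w p) (idx i) = a i * \<rho> i" for i
      unfolding row_total_def \<rho>_def by (simp add: b_idx sum_distrib_left)
    moreover have "row_total n (\<lambda>p. 2 * e * (of_bool (snd p = n) * w p)) (idx i) = 2 * e * w (idx i, n)" for i
    proof -
      have "(\<Sum>j\<in>{1..n} - {idx i}. of_bool (j = n) * w (idx i, j)) = w (idx i, n)"
        by (rule sum_of_bool_mult(1)) (use n idx(3)[of i] in auto)
      then show ?thesis unfolding row_total_def by (simp flip: sum_distrib_left)
    qed
    ultimately show ?thesis
      unfolding b_sum col_total_indicator[OF n, symmetric] v \<kappa>_def by (simp add: power2_eq_square mult.assoc)
  qed
  also have "\<bar>\<dots>\<bar> \<le> (\<Sum>i\<in>(UNIV::'k set). sqrt (v / d) * (2 * sqrt (v / d) * M))"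
  proof (rule order_trans[OF sum_abs], rule sum_mono)
    fix i
    have "(idx i, n) \<in> off_diag n" using idx(2,3)[of i] n by (auto simp: off_diag_def)
    then have "\<bar>w (idx i, n)\<bar> \<le> M" using w_bounds(2) w_pos by (simp add: less_imp_le)
    then show "\<bar>a i * (2 * e * w (idx i, n))\<bar> \<le> sqrt (v / d) * (2 * sqrt (v / d) * M)"
      unfolding abs_mult using a_bd[of i] e_bd v0 d by (intro mult_mono) auto
  qed
  also have "\<dots> = 2 * real CARD('k) * v * (M\<^sup>2 / (real n - 1))"
  proof -
    have sq: "sqrt (v / d) * sqrt (v / d) = v / d" using v0 d by simp
    have "(\<Sum>i\<in>(UNIV::'k set). sqrt (v / d) * (2 * sqrt (v / d) * M))
        = 2 * real CARD('k) * M * (sqrt (v / d) * sqrt (v / d))" by (simp add: mult_ac)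
    also have "\<dots> = 2 * real CARD('k) * v * (M\<^sup>2 / (real n - 1))"
      unfolding sq by (simp add: d_def power2_eq_square)
    finally show ?thesis .
  qed
  finally have V: "\<bar>V - v\<bar> \<le> 2 * real CARD('k) * v * (M\<^sup>2 / (real n - 1))" .
  have C: "C = (real CARD('k) + 1) * sqrt (v * (M / (real n - 1)))" by (simp add: C_def d_def)
  show ?thesis
    using \<zeta> V unfolding V_def[symmetric] C[symmetric] \<rho>_def[symmetric] \<kappa>_def[symmetric] stat by blast
qed

end

section \<open>Asymptotic normality of the estimator\<close>

lemma poisson_network_family:
  assumes "poisson_network n Z \<theta> \<gamma> \<M> a"
  shows "poisson_family \<M> (off_diag n) (\<lambda>p. a (fst p) (snd p)) (edge_rate n Z \<theta> \<gamma>)"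
proof -
  have "(\<lambda>(i, j). a i j) = (\<lambda>p. a (fst p) (snd p))" by (auto simp: fun_eq_iff)
  then show ?thesis
    using assms unfolding poisson_network_def poisson_family_def
    by (auto simp: edge_rate_def rate_def)
qed

text \<open>
  Everything at a fixed \<open>n\<close>: outside an event of small probability the estimator in the direction \<open>s\<close>
  equals its first order term up to \<open>O(Y)\<close>, since the entries of \<open>s\<close> are at most \<open>(v n M)\<^sup>1\<^sup>/\<^sup>2\<close>. The first
  order term has a nearly Gaussian characteristic function.
\<close>
lemma mle_char_approx:
  fixes idx :: "'k::finite \<Rightarrow> nat" and s :: "'k \<Rightarrow> real" and Z :: "nat \<Rightarrow> nat \<Rightarrow> real^'p" and \<theta>h :: "'w \<Rightarrow> nat \<Rightarrow> real"
  defines "P \<equiv> real CARD('p)"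
  assumes model: "poisson_network n Z \<theta>s \<gamma>s \<M> a"
    and net: "inverse_bounded_network n (edge_rate n Z \<theta>s \<gamma>s) M (edge_cov Z) q \<kappa>"
    and H: "\<And>A. pos_def_mat (H_mat n Z A \<theta>s \<gamma>s)"
    and n: "1 \<le> ln (real n)" "4 * ln (real n) \<le> real n"
    and K: "1 \<le> 13 * M ^ 5 * q\<^sup>2 * \<kappa>"
    and Y: "Y = 13 * M ^ 5 * q\<^sup>2 * \<kappa> * M ^ 18 * ln (real n) / sqrt (real n)" "20000 * P\<^sup>2 * Y \<le> 1"
    and meas: "\<And>r. r \<in> {1..num_params n} \<Longrightarrow> (\<lambda>\<omega>. \<theta>h \<omega> r) \<in> borel_measurable \<M>"
    and mle: "\<And>\<omega>. \<omega> \<in> space \<M> \<Longrightarrow> \<exists>\<theta> \<gamma>. is_mle n Z (\<lambda>i j. a i j \<omega>) \<theta> \<gamma> \<Longrightarrow>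
        is_mle n Z (\<lambda>i j. a i j \<omega>) (\<theta>h \<omega>) (\<gamma>h \<omega>)"
    and idx: "inj idx" "\<And>i. idx i \<in> {1..n}" "\<And>i. idx i \<noteq> n"
    and v: "(\<Sum>i\<in>UNIV. (s i)\<^sup>2 / row_total n (edge_rate n Z \<theta>s \<gamma>s) (idx i))
      + (\<Sum>i\<in>UNIV. s i)\<^sup>2 / col_total n (edge_rate n Z \<theta>s \<gamma>s) n = v"
  shows "\<exists>\<zeta> V. norm ((\<integral>\<omega>. iexp (\<Sum>i\<in>UNIV. s i * (\<theta>h \<omega> (idx i) - \<theta>s (idx i))) \<partial>\<M>) - exp (\<zeta> - complex_of_real (V / 2)))
        \<le> real CARD('k) * sqrt v * (1000000 * P ^ 3 * Y) + 2 * ((4 * real n + P) * (2 * exp (- 4 * ln (real n))))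
      \<and> \<bar>V - v\<bar> \<le> 2 * real CARD('k) * v * (M\<^sup>2 / (real n - 1))
      \<and> norm \<zeta> \<le> (real CARD('k) + 1) * sqrt (v * (M / (real n - 1))) * V"
proof -
  define w where "w = edge_rate n Z \<theta>s \<gamma>s"
  interpret inverse_bounded_network n w M "edge_cov Z" q \<kappa> using net unfolding w_def .
  define X where "X p = a (fst p) (snd p)" for p
  have fam: "poisson_family \<M> (off_diag n) X w"
    unfolding X_def w_def by (rule poisson_network_family[OF model])
  interpret prob_space \<M> using fam by (simp add: poisson_family_def)
  define \<xi> where "\<xi> \<omega> p = real (X p \<omega>) - w p" for \<omega> p
  define r where "r = sqrt (ln (real n))"
  have r: "1 \<le> r" "r\<^sup>2 = ln (real n)" using n by (auto simp: r_def)
  obtain G where G: "G \<in> sets \<M>" "measure \<M> (space \<M> - G) \<le> (4 * real n + P) * (2 * exp (- 4 * r\<^sup>2))"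
    "\<And>\<omega>. \<omega> \<in> G \<Longrightarrow> good r (\<xi> \<omega>)"
    using good_event[OF fam, of r] r n unfolding \<xi>_def P_def by auto
  define R where "R = sqrt (real n)"
  have R: "1 \<le> R" "R\<^sup>2 = real n" using n_ge_5 by (auto simp: R_def)
  have RM: "sqrt (real n * M) = R * sqrt M" by (simp add: R_def real_sqrt_mult)
  have P: "1 \<le> P" unfolding P_def by (simp add: Suc_leI)
  define \<tau> where "\<tau> = 2 * (12 * M ^ 3 * (4 * r * (R * sqrt M)) / R\<^sup>2
        + P * (13 * M ^ 4 * q) * (\<kappa> / (R\<^sup>2)\<^sup>2 * (4 * r * (13 * M ^ 4 * q * R\<^sup>2 * sqrt M))))"
  have Y': "Y = 13 * M ^ 5 * q\<^sup>2 * \<kappa> * M ^ 18 * r\<^sup>2 / R" unfolding Y(1) r(2) R_def ..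
  note rates = rate_bounds[OF M(1) r(1) R(1) q P kappa_pos refl K Y' Y(2) \<tau>_def]
  define \<delta> where "\<delta> = 12 * M ^ 3 * (4 * r * (2 * M\<^sup>2 * sqrt M) / real n + M * \<tau>\<^sup>2)
      + 12 * P * q * M ^ 4 * \<kappa> * (4 * r * (13 * M ^ 4 * q * real n * sqrt M) / (real n)\<^sup>2 + 13 * q * M ^ 5 * \<tau>\<^sup>2)"
  have \<delta>: "R * sqrt M * \<delta> \<le> 1000000 * P ^ 3 * Y" using rates(4) unfolding \<delta>_def R(2) .
  define T where "T \<omega> i = row_total n (\<xi> \<omega>) (idx i) / row_total n w (idx i) + col_total n (\<xi> \<omega>) n / col_total n w n" for \<omega> i
  have nn: "n \<in> {1..n}" using n_ge_5 by simp
  have close: "\<bar>(\<theta>h \<omega> (idx i) - \<theta>s (idx i)) - T \<omega> i\<bar> \<le> \<delta>" if \<omega>: "\<omega> \<in> G" for \<omega> i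
  proof -
    note g = G(3)[OF \<omega>, unfolded good_def RM]
    have B: "\<And>i. i \<in> {1..n} \<Longrightarrow> \<bar>row_total n (\<xi> \<omega>) i\<bar> \<le> 4 * r * (R * sqrt M)"
      "\<And>i. i \<in> {1..n} \<Longrightarrow> \<bar>col_total n (\<xi> \<omega>) i\<bar> \<le> 4 * r * (R * sqrt M)"
      "\<And>k. \<bar>(\<Sum>p\<in>off_diag n. \<xi> \<omega> p *\<^sub>R resid p) $ k\<bar> \<le> 4 * r * (13 * M ^ 4 * q * real n * sqrt M)"
      "\<And>i. i \<in> {1..n} \<Longrightarrow> \<bar>\<Sum>j\<in>{1..n} - {i}. w (i, j) * (col_total n (\<xi> \<omega>) j / col_total n w j)\<bar> \<le> 4 * r * (2 * M\<^sup>2 * sqrt M)"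
      "\<And>i. i \<in> {1..n} \<Longrightarrow> \<bar>\<Sum>j\<in>{1..n} - {i}. w (j, i) * (row_total n (\<xi> \<omega>) j / row_total n w j)\<bar> \<le> 4 * r * (2 * M\<^sup>2 * sqrt M)"
      using g by blast+
    have start: "12 * M ^ 3 * (4 * r * (R * sqrt M)) / real n
        + real CARD('p) * (13 * M ^ 4 * q) * (\<kappa> / (real n)\<^sup>2 * (4 * r * (13 * M ^ 4 * q * real n * sqrt M))) \<le> \<tau> / 2"
      unfolding \<tau>_def R(2) P_def by simp
    obtain x g where sol:
      "\<forall>r\<in>{1..num_params n}. (\<Sum>p\<in>off_diag n. design n r p * (w p * exp (fit x p + edge_cov Z p \<bullet> g) - w p - \<xi> \<omega> p)) = 0"
      "(\<Sum>p\<in>off_diag n. (w p * exp (fit x p + edge_cov Z p \<bullet> g) - w p - \<xi> \<omega> p) *\<^sub>R edge_cov Z p) = 0"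
      "\<forall>i\<in>{1..n}. i < n \<longrightarrow>
         \<bar>x i - (row_total n (\<xi> \<omega>) i / row_total n w i + col_total n (\<xi> \<omega>) n / col_total n w n)\<bar> \<le> \<delta>"
      using score_solution[OF B rates(1,2) start rates(3)[unfolded P_def]] unfolding \<delta>_def P_def by blast
    have \<xi>: "\<xi> \<omega> p = edge_count (\<lambda>i j. a i j \<omega>) p - edge_rate n Z \<theta>s \<gamma>s p" for p
      by (simp add: \<xi>_def X_def edge_count_def w_def)
    have "\<omega> \<in> space \<M>" using sets.sets_into_space[OF G(1)] \<omega> by blast
    then have "is_mle n Z (\<lambda>i j. a i j \<omega>) (\<theta>h \<omega>) (\<gamma>h \<omega>)" if "is_mle n Z (\<lambda>i j. a i j \<omega>) \<theta> \<gamma>" for \<theta> \<gamma>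
      using mle that by blast
    from mle_expansion[OF net H this bspec[OF sol(1)[unfolded \<xi> w_def]] sol(2)[unfolded \<xi> w_def], where r = "idx i"]
    have "\<theta>h \<omega> (idx i) - \<theta>s (idx i) = x (idx i)"
      using idx(2)[of i] by (auto simp: num_params_def)
    moreover have "idx i < n" using idx(2,3)[of i] by auto
    ultimately show ?thesis using bspec[OF sol(3) idx(2)[of i]] by (simp only: T_def)
  qed
  have pos: "0 < row_total n w (idx i)" "0 < col_total n w n" for i
    using totals_pos idx(2) nn by blast+
  have v0: "0 \<le> v" unfolding v[symmetric] w_def[symmetric] using pos
    by (intro add_nonneg_nonneg sum_nonneg) (auto simp: less_imp_le)
  have s_bd: "\<bar>s i\<bar> \<le> sqrt v * (R * sqrt M)" for i
  proof -
    have "(s i)\<^sup>2 / row_total n w (idx i) \<le> (\<Sum>i\<in>UNIV. (s i)\<^sup>2 / row_total n w (idx i))"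
      using pos by (intro member_le_sum) (auto simp: less_imp_le)
    also have "\<dots> \<le> v" unfolding v[symmetric] w_def[symmetric] using pos by (simp add: less_imp_le)
    finally have "(s i)\<^sup>2 \<le> v * row_total n w (idx i)" using pos by (simp add: pos_divide_le_eq)
    also have "\<dots> \<le> v * (real n * M)" using totals_upper(1)[OF idx(2)] v0 by (intro mult_left_mono)
    finally have "\<bar>s i\<bar> \<le> sqrt (v * (real n * M))" by (intro real_le_rsqrt) simp
    then show ?thesis by (simp only: real_sqrt_mult[of v] RM)
  qed
  have \<delta>0: "0 \<le> \<delta>" unfolding \<delta>_def using M q P kappa_pos r n_ge_5
    by (intro add_nonneg_nonneg mult_nonneg_nonneg divide_nonneg_nonneg) auto
  have stat_close: "\<bar>(\<Sum>i\<in>UNIV. s i * (\<theta>h \<omega> (idx i) - \<theta>s (idx i))) - (\<Sum>i\<in>UNIV. s i * T \<omega> i)\<bar>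
      \<le> real CARD('k) * sqrt v * (1000000 * P ^ 3 * Y)" if \<omega>: "\<omega> \<in> G" for \<omega>
  proof -
    have "\<bar>\<Sum>i\<in>UNIV. s i * ((\<theta>h \<omega> (idx i) - \<theta>s (idx i)) - T \<omega> i)\<bar>
        \<le> (\<Sum>i\<in>(UNIV::'k set). sqrt v * (R * sqrt M) * \<delta>)"
    proof (rule order_trans[OF sum_abs], rule sum_mono)
      fix i
      show "\<bar>s i * ((\<theta>h \<omega> (idx i) - \<theta>s (idx i)) - T \<omega> i)\<bar> \<le> sqrt v * (R * sqrt M) * \<delta>"
        unfolding abs_mult using s_bd[of i] close[OF \<omega>, of i] v0 R M by (intro mult_mono) auto
    qed
    also have "\<dots> = real CARD('k) * sqrt v * (R * sqrt M * \<delta>)" by simp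
    also have "\<dots> \<le> real CARD('k) * sqrt v * (1000000 * P ^ 3 * Y)" using \<delta> v0 by (intro mult_left_mono) auto
    finally show ?thesis by (simp add: right_diff_distrib sum_subtractf)
  qed
  have tot_meas: "(\<lambda>\<omega>. row_total n (\<xi> \<omega>) i) \<in> borel_measurable \<M>" "(\<lambda>\<omega>. col_total n (\<xi> \<omega>) i) \<in> borel_measurable \<M>"
    if "i \<in> {1..n}" for i
    unfolding row_total_indicator[OF that] col_total_indicator[OF that] \<xi>_def
    by (rule poisson_family_sum_measurable[OF fam])+
  have "norm ((\<integral>\<omega>. iexp (\<Sum>i\<in>UNIV. s i * (\<theta>h \<omega> (idx i) - \<theta>s (idx i))) \<partial>\<M>) - (\<integral>\<omega>. iexp (\<Sum>i\<in>UNIV. s i * T \<omega> i) \<partial>\<M>))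
      \<le> real CARD('k) * sqrt v * (1000000 * P ^ 3 * Y) + 2 * measure \<M> (space \<M> - G)"
  proof (rule char_perturbation[OF prob_space_axioms _ _ G(1) stat_close])
    have "idx i \<in> {1..num_params n}" for i using idx(2)[of i] by (auto simp: num_params_def)
    then show "(\<lambda>\<omega>. \<Sum>i\<in>UNIV. s i * (\<theta>h \<omega> (idx i) - \<theta>s (idx i))) \<in> borel_measurable \<M>"
      by (intro borel_measurable_sum borel_measurable_times borel_measurable_diff borel_measurable_const meas)
    show "(\<lambda>\<omega>. \<Sum>i\<in>UNIV. s i * T \<omega> i) \<in> borel_measurable \<M>"
      unfolding T_def using idx(2) nn
      by (intro borel_measurable_sum borel_measurable_times borel_measurable_add borel_measurable_divide
          borel_measurable_const tot_meas)
    have "0 \<le> Y" unfolding Y' using M q kappa_pos R by simp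
    then show "0 \<le> real CARD('k) * sqrt v * (1000000 * P ^ 3 * Y)" using v0 P by simp
  qed
  then have main: "norm ((\<integral>\<omega>. iexp (\<Sum>i\<in>UNIV. s i * (\<theta>h \<omega> (idx i) - \<theta>s (idx i))) \<partial>\<M>) - (\<integral>\<omega>. iexp (\<Sum>i\<in>UNIV. s i * T \<omega> i) \<partial>\<M>))
      \<le> real CARD('k) * sqrt v * (1000000 * P ^ 3 * Y) + 2 * ((4 * real n + P) * (2 * exp (- 4 * ln (real n))))"
    using G(2) unfolding r(2) by linarith
  obtain \<zeta> V where "(\<integral>\<omega>. iexp (\<Sum>i\<in>UNIV. s i * T \<omega> i) \<partial>\<M>) = exp (\<zeta> - complex_of_real (V / 2))"
    "\<bar>V - v\<bar> \<le> 2 * real CARD('k) * v * (M\<^sup>2 / (real n - 1))"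
    "norm \<zeta> \<le> (real CARD('k) + 1) * sqrt (v * (M / (real n - 1))) * V"
    using linear_statistic_char[OF fam idx v[folded w_def] totals_lower(1) totals_lower(2)[OF nn]]
    unfolding T_def \<xi>_def by blast
  with main show ?thesis by auto
qed

lemma eta_bound_rho:
  fixes Z :: "nat \<Rightarrow> nat \<Rightarrow> real^'p"
  assumes p: "p \<in> off_diag n" and e: "0 < e1" "0 < e2"
  shows "\<bar>lin_pred n \<theta> (fst p) (snd p) + edge_cov Z p \<bullet> \<gamma>\<bar> \<le> rho n Z \<theta> \<gamma> e1 e2" "0 \<le> rho n Z \<theta> \<gamma> e1 e2"
proof -
  obtain i j where ij: "p = (i, j)" by (cases p)
  have cov: "infnorm (Z i j) \<le> covariate_bound n Z"
    unfolding covariate_bound_def using p ij by (intro Max_ge) (auto intro: rev_image_eqI)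
  have lin: "\<bar>alpha_of \<theta> i + beta_of n \<theta> j\<bar> \<le> (MAX (i, j)\<in>off_diag n. \<bar>alpha_of \<theta> i + beta_of n \<theta> j\<bar>)"
    using p ij by (intro Max_ge) (auto intro: rev_image_eqI)
  have c0: "0 \<le> covariate_bound n Z" using cov infnorm_pos_le[of "Z i j"] by linarith
  have "\<bar>Z i j \<bullet> \<gamma>\<bar> \<le> real CARD('p) * covariate_bound n Z * infnorm \<gamma>"
    by (rule abs_inner_le) (use cov c0 component_le_infnorm_cart order_trans in \<open>blast+\<close>)
  moreover have "0 \<le> real CARD('p) * covariate_bound n Z * e2" using c0 e by simp
  ultimately show b: "\<bar>lin_pred n \<theta> (fst p) (snd p) + edge_cov Z p \<bullet> \<gamma>\<bar> \<le> rho n Z \<theta> \<gamma> e1 e2"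
    using lin e unfolding rho_def lin_pred_def edge_cov_def ij by simp
  then show "0 \<le> rho n Z \<theta> \<gamma> e1 e2" by linarith
qed

lemma S_entry_leading_block:
  assumes "i \<in> {1..n}" "j \<in> {1..n}"
  shows "S_entry n Z \<theta> \<gamma> i j = of_bool (i = j) / row_total n (edge_rate n Z \<theta> \<gamma>) i + 1 / col_total n (edge_rate n Z \<theta> \<gamma>) n"
proof -
  have "(\<Sum>c=1..n. u_entry n Z \<theta> \<gamma> i c) = row_total n (edge_rate n Z \<theta> \<gamma>) i"
    unfolding row_total_def by (rule sum.mono_neutral_cong_right) (auto simp: u_entry_def edge_rate_def)
  moreover have "(\<Sum>r=1..n. u_entry n Z \<theta> \<gamma> r n) = col_total n (edge_rate n Z \<theta> \<gamma>) n"
    unfolding col_total_def by (rule sum.mono_neutral_cong_right) (auto simp: u_entry_def edge_rate_def)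
  ultimately show ?thesis using assms unfolding S_entry_def Let_def by simp
qed

text \<open>
  The leading block of \<open>S\<close> is a diagonal matrix plus a multiple of the all-ones matrix.
\<close>
lemma S_block_quadratic_form:
  fixes idx :: "'k::finite \<Rightarrow> nat" and x :: "real^'k"
  assumes idx: "inj idx" "\<And>i. idx i \<in> {1..n}"
  shows "x \<bullet> ((\<chi> i j. S_entry n Z \<theta> \<gamma> (idx i) (idx j)) *v x)
    = (\<Sum>i\<in>UNIV. (x $ i)\<^sup>2 / row_total n (edge_rate n Z \<theta> \<gamma>) (idx i)) + (\<Sum>i\<in>UNIV. x $ i)\<^sup>2 / col_total n (edge_rate n Z \<theta> \<gamma>) n"
proof -
  define \<rho> where "\<rho> i = row_total n (edge_rate n Z \<theta> \<gamma>) (idx i)" for i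
  define \<kappa> where "\<kappa> = col_total n (edge_rate n Z \<theta> \<gamma>) n"
  have "((\<chi> i j. S_entry n Z \<theta> \<gamma> (idx i) (idx j)) *v x) $ i = x $ i / \<rho> i + (\<Sum>j\<in>UNIV. x $ j) / \<kappa>" for i
  proof -
    have "((\<chi> i j. S_entry n Z \<theta> \<gamma> (idx i) (idx j)) *v x) $ i = (\<Sum>j\<in>UNIV. of_bool (i = j) * (x $ j / \<rho> i) + x $ j / \<kappa>)"
      using idx by (simp add: matrix_vector_mult_def S_entry_leading_block inj_eq \<rho>_def \<kappa>_def distrib_right)
    also have "\<dots> = (\<Sum>j\<in>UNIV. of_bool (i = j) * (x $ j / \<rho> i)) + (\<Sum>j\<in>UNIV. x $ j) / \<kappa>"
      by (simp only: sum.distrib sum_divide_distrib)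
    also have "(\<Sum>j\<in>UNIV. of_bool (i = j) * (x $ j / \<rho> i)) = x $ i / \<rho> i"
      by (rule sum_of_bool_mult(2)) auto
    finally show ?thesis .
  qed
  then have "x \<bullet> ((\<chi> i j. S_entry n Z \<theta> \<gamma> (idx i) (idx j)) *v x) = (\<Sum>i\<in>UNIV. x $ i * (x $ i / \<rho> i + (\<Sum>j\<in>UNIV. x $ j) / \<kappa>))"
    by (simp add: inner_vec_def)
  also have "\<dots> = (\<Sum>i\<in>UNIV. (x $ i)\<^sup>2 / \<rho> i) + (\<Sum>i\<in>UNIV. x $ i)\<^sup>2 / \<kappa>"
    unfolding distrib_left sum.distrib sum_distrib_right[symmetric] by (simp add: power2_eq_square)
  finally show ?thesis by (simp add: \<rho>_def \<kappa>_def)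
qed

lemma S_block_pos_def:
  fixes idx :: "'k::finite \<Rightarrow> nat"
  assumes idx: "inj idx" "\<And>i. idx i \<in> {1..n}" and "network n (edge_rate n Z \<theta> \<gamma>)"
  shows "pos_def_mat (\<chi> i j. S_entry n Z \<theta> \<gamma> (idx i) (idx j))"
  unfolding pos_def_mat_def
proof (intro conjI allI impI)
  interpret network n "edge_rate n Z \<theta> \<gamma>" "edge_cov Z" by fact
  have pos: "0 < row_total n (edge_rate n Z \<theta> \<gamma>) i" "0 < col_total n (edge_rate n Z \<theta> \<gamma>) i" if "i \<in> {1..n}" for i
    using totals_pos[OF that] by blast+
  have nn: "n \<in> {1..n}" using n_ge_5 by simp
  show "transpose (\<chi> i j. S_entry n Z \<theta> \<gamma> (idx i) (idx j)) = (\<chi> i j. S_entry n Z \<theta> \<gamma> (idx i) (idx j))"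
    using idx by (auto simp: transpose_def vec_eq_iff S_entry_leading_block inj_eq)
  fix x :: "real^'k" assume "x \<noteq> 0"
  then obtain i where i: "x $ i \<noteq> 0" by (auto simp: vec_eq_iff)
  have "0 < (\<Sum>i\<in>UNIV. (x $ i)\<^sup>2 / row_total n (edge_rate n Z \<theta> \<gamma>) (idx i))"
    using i pos(1)[OF idx(2)] by (intro sum_pos2[of _ i]) (auto simp: less_imp_le)
  moreover have "0 \<le> (\<Sum>i\<in>UNIV. x $ i)\<^sup>2 / col_total n (edge_rate n Z \<theta> \<gamma>) n"
    using pos(2)[OF nn] by (simp add: less_imp_le)
  ultimately show "0 < x \<bullet> ((\<chi> i j. S_entry n Z \<theta> \<gamma> (idx i) (idx j)) *v x)"
    unfolding S_block_quadratic_form[OF idx] by linarith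
qed

lemma edge_rate_bounds:
  fixes Z :: "nat \<Rightarrow> nat \<Rightarrow> real^'p"
  assumes p: "p \<in> off_diag n" and e: "0 < e1" "0 < e2"
  shows "1 / exp (rho n Z \<theta> \<gamma> e1 e2) \<le> edge_rate n Z \<theta> \<gamma> p" "edge_rate n Z \<theta> \<gamma> p \<le> exp (rho n Z \<theta> \<gamma> e1 e2)"
  using eta_bound_rho(1)[OF assms, where \<theta> = \<theta> and \<gamma> = \<gamma> and Z = Z] unfolding edge_rate_eq
  by (auto simp: abs_le_iff exp_minus[symmetric] inverse_eq_divide[symmetric])

lemma network_of_rates:
  fixes Z :: "nat \<Rightarrow> nat \<Rightarrow> real^'p"
  assumes "5 \<le> n"
  shows "network n (edge_rate n Z \<theta> \<gamma>)"
  using assms by unfold_locales (auto simp: edge_rate_eq)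

lemma iexp_limit_of_approximation:
  fixes E \<zeta> :: "nat \<Rightarrow> complex" and V Y :: "nat \<Rightarrow> real"
  assumes ev: "\<forall>\<^sub>F n in sequentially. norm (E n - exp (\<zeta> n - complex_of_real (V n / 2))) \<le> a n
      \<and> \<bar>V n - v\<bar> \<le> b n \<and> norm (\<zeta> n) \<le> c n * \<bar>V n\<bar>"
    and "a \<longlonglongrightarrow> 0" "b \<longlonglongrightarrow> 0" "c \<longlonglongrightarrow> 0"
  shows "E \<longlonglongrightarrow> complex_of_real (exp (- v / 2))"
proof -
  have "(\<lambda>n. V n - v) \<longlonglongrightarrow> 0"
    by (rule Lim_null_comparison[OF _ assms(3)]) (use ev in \<open>auto elim: eventually_mono\<close>)
  then have V: "V \<longlonglongrightarrow> v" by (simp add: LIM_zero_iff)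
  have "(\<lambda>n. c n * \<bar>V n\<bar>) \<longlonglongrightarrow> 0" using tendsto_mult[OF assms(4) tendsto_rabs[OF V]] by simp
  then have \<zeta>: "\<zeta> \<longlonglongrightarrow> 0"
    by (rule Lim_null_comparison[rotated]) (use ev in \<open>auto elim: eventually_mono\<close>)
  have "(\<lambda>n. exp (\<zeta> n - complex_of_real (V n / 2))) \<longlonglongrightarrow> exp (0 - complex_of_real (v / 2))"
    by (intro tendsto_intros \<zeta> V) simp
  moreover have "(\<lambda>n. E n - exp (\<zeta> n - complex_of_real (V n / 2))) \<longlonglongrightarrow> 0"
    by (rule Lim_null_comparison[OF _ assms(2)]) (use ev in \<open>auto elim: eventually_mono\<close>)
  ultimately have "(\<lambda>n. (E n - exp (\<zeta> n - complex_of_real (V n / 2))) + exp (\<zeta> n - complex_of_real (V n / 2)))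
      \<longlonglongrightarrow> 0 + exp (0 - complex_of_real (v / 2))"
    by (intro tendsto_add)
  then show ?thesis by (simp add: exp_of_real[symmetric])
qed

text \<open>
  With \<open>K\<close> and \<open>L\<close> at least \<open>1\<close>, smallness of \<open>Y\<close> bounds \<open>M\<close> by a small power of \<open>n\<close>.
\<close>
lemma polynomial_rate_small:
  fixes M Y K L :: real
  assumes Y: "Y = K * M ^ 18 * L / sqrt (real n)" and "1 \<le> K" "1 \<le> M" "1 \<le> L" "2 \<le> n"
  shows "0 \<le> Y" "M\<^sup>2 / (real n - 1) \<le> 2 * Y" "M / (real n - 1) \<le> 2 * Y" "Y \<le> 1 / 8 \<Longrightarrow> 4 * M\<^sup>2 + 1 \<le> real n"
proof -
  define R where "R = sqrt (real n)"
  have R: "1 \<le> R" "R * R = real n" using \<open>2 \<le> n\<close> by (auto simp: R_def)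
  show "0 \<le> Y" using assms by simp
  have "M\<^sup>2 \<le> M ^ 18" using \<open>1 \<le> M\<close> by (intro power_increasing) auto
  also have "\<dots> \<le> K * M ^ 18 * L"
    using assms mult_mono[of 1 "K * L" "M ^ 18" "M ^ 18"] mult_mono[of 1 K 1 L] by (simp add: mult_ac)
  finally have MR: "M\<^sup>2 \<le> Y * R" using R unfolding Y R_def[symmetric] by simp
  have "Y * R \<le> Y * real n" using R \<open>0 \<le> Y\<close> mult_left_mono[of 1 R R] by (intro mult_left_mono) auto
  with MR have Mn: "M\<^sup>2 \<le> Y * real n" by simp
  have n: "real n \<le> 2 * (real n - 1)" "0 < real n - 1" using \<open>2 \<le> n\<close> by auto
  have "M\<^sup>2 \<le> Y * (2 * (real n - 1))"
    using Mn mult_left_mono[OF n(1) \<open>0 \<le> Y\<close>] by linarith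
  then show M2: "M\<^sup>2 / (real n - 1) \<le> 2 * Y" using n(2) by (simp add: pos_divide_le_eq mult_ac)
  have "M \<le> M\<^sup>2" using \<open>1 \<le> M\<close> by (simp add: power2_eq_square)
  then have "M / (real n - 1) \<le> M\<^sup>2 / (real n - 1)" using n(2) by (intro divide_right_mono) auto
  with M2 show "M / (real n - 1) \<le> 2 * Y" by simp
  assume "Y \<le> 1 / 8"
  then have "Y * real n \<le> 1 / 8 * real n" by (intro mult_right_mono) auto
  with Mn have "4 * M\<^sup>2 \<le> real n / 2" by simp
  moreover have "2 \<le> real n" using \<open>2 \<le> n\<close> by simp
  ultimately show "4 * M\<^sup>2 + 1 \<le> real n" by linarith
qed

lemma borel_measurable_vec_lambda:
  fixes f :: "'k::finite \<Rightarrow> 'w \<Rightarrow> real"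
  assumes "\<And>i. f i \<in> borel_measurable \<M>"
  shows "(\<lambda>\<omega>. \<chi> i. f i \<omega>) \<in> borel_measurable \<M>"
  unfolding borel_measurable_euclidean_space[of "\<lambda>\<omega>. \<chi> i. f i \<omega>"]
  using assms by (auto simp: Basis_vec_def inner_axis)

lemma borel_measurable_matrix_vector_mult:
  fixes A :: "real^'k^'k"
  assumes "f \<in> borel_measurable \<M>"
  shows "(\<lambda>\<omega>. A *v f \<omega>) \<in> borel_measurable \<M>"
  by (rule measurable_compose[OF assms borel_measurable_continuous_onI])
    (rule matrix_vector_mult_linear_continuous_on)

theorem theorem2:
  fixes M :: "nat \<Rightarrow> 'w measure"
    and a :: "nat \<Rightarrow> nat \<Rightarrow> nat \<Rightarrow> 'w \<Rightarrow> nat"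
    and Z :: "nat \<Rightarrow> nat \<Rightarrow> nat \<Rightarrow> real ^ 'p"
    and \<theta>s :: "nat \<Rightarrow> nat \<Rightarrow> real"
    and \<gamma>s :: "nat \<Rightarrow> real ^ 'p"
    and \<theta>h :: "nat \<Rightarrow> 'w \<Rightarrow> nat \<Rightarrow> real"
    and \<gamma>h :: "nat \<Rightarrow> 'w \<Rightarrow> real ^ 'p"
    and \<Z> :: "real set"
    and \<epsilon>1 \<epsilon>2 \<kappa> :: "nat \<Rightarrow> real"
    and idx :: "'k::finite \<Rightarrow> nat"
  assumes model: "\<And>n. n \<ge> 2 \<Longrightarrow> poisson_network n (Z n) (\<theta>s n) (\<gamma>s n) (M n) (a n)"
    and compact: "compact \<Z>"
    and covariates: "\<And>n i j l. n \<ge> 2 \<Longrightarrow> (i, j) \<in> off_diag n \<Longrightarrow> Z n i j $ l \<in> \<Z>"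
    and eps: "\<And>n. \<epsilon>1 n > 0" "\<And>n. \<epsilon>2 n > 0"
    and H_pos_def: "\<forall>\<^sub>F n in sequentially. \<forall>\<omega>\<in>space (M n).
          \<forall>\<theta>\<in>sup_ball (2 * n - 1) (\<theta>s n) (\<epsilon>1 n).
            pos_def_mat (H_mat n (Z n) (\<lambda>i j. a n i j \<omega>) \<theta> (\<gamma>s n))"
    and H_inv_bound: "\<forall>\<^sub>F n in sequentially. \<forall>\<omega>\<in>space (M n).
          (SUP \<theta>\<in>sup_ball (2 * n - 1) (\<theta>s n) (\<epsilon>1 n).
             ereal (row_sum_norm (matrix_inv (H_mat n (Z n) (\<lambda>i j. a n i j \<omega>) \<theta> (\<gamma>s n)))))
          \<le> ereal (\<kappa> n / (real n)\<^sup>2)"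
    and growth: "(\<lambda>n. \<kappa> n * exp (23 * rho n (Z n) (\<theta>s n) (\<gamma>s n) (\<epsilon>1 n) (\<epsilon>2 n)))
          \<in> o(\<lambda>n. sqrt (real n) / ln (real n))"
    and measurable: "\<And>n r. n \<ge> 2 \<Longrightarrow> r \<in> {1..2 * n - 1} \<Longrightarrow>
            (\<lambda>\<omega>. \<theta>h n \<omega> r) \<in> borel_measurable (M n)"
          "\<And>n. n \<ge> 2 \<Longrightarrow> \<gamma>h n \<in> borel_measurable (M n)"
    and mle: "\<And>n \<omega>. n \<ge> 2 \<Longrightarrow> \<omega> \<in> space (M n) \<Longrightarrow>
          \<exists>\<theta> \<gamma>. is_mle n (Z n) (\<lambda>i j. a n i j \<omega>) \<theta> \<gamma> \<Longrightarrow>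
          is_mle n (Z n) (\<lambda>i j. a n i j \<omega>) (\<theta>h n \<omega>) (\<gamma>h n \<omega>)"
    and idx: "bij_betw idx UNIV {1..CARD('k)}"
  shows "asymptotically_normal M
           (\<lambda>n \<omega>. \<chi> i. \<theta>h n \<omega> (idx i) - \<theta>s n (idx i))
           (\<lambda>n. \<chi> i j. S_entry n (Z n) (\<theta>s n) (\<gamma>s n) (idx i) (idx j))"
proof -
  define P where "P = real CARD('p)"
  define k where "k = CARD('k)"
  have P: "1 \<le> P" unfolding P_def by (simp add: Suc_leI)
  have inj: "inj idx" and range: "\<And>i. idx i \<in> {1..k}"
    using idx unfolding bij_betw_def k_def by auto
  obtain q where q: "1 \<le> q" "\<And>n p l. 2 \<le> n \<Longrightarrow> p \<in> off_diag n \<Longrightarrow> \<bar>edge_cov (Z n) p $ l\<bar> \<le> q"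
  proof -
    obtain b where b: "\<And>z. z \<in> \<Z> \<Longrightarrow> \<bar>z\<bar> \<le> b"
      using compact_imp_bounded[OF compact] by (auto simp: bounded_iff)
    have "\<bar>edge_cov (Z n) p $ l\<bar> \<le> max 1 b" if "2 \<le> n" "p \<in> off_diag n" for n p l
    proof -
      have "Z n (fst p) (snd p) $ l \<in> \<Z>" by (rule covariates) (use that in auto)
      from b[OF this] show ?thesis by (simp add: edge_cov_def)
    qed
    then show thesis by (intro that[of "max 1 b"]) auto
  qed
  define w where "w n = edge_rate n (Z n) (\<theta>s n) (\<gamma>s n)" for n
  \<comment> \<open>the true rates lie in \<open>[1 / E n, E n]\<close>\<close>
  define E where "E n = exp (rho n (Z n) (\<theta>s n) (\<gamma>s n) (\<epsilon>1 n) (\<epsilon>2 n))" for n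
  define Y where "Y n = 13 * E n ^ 5 * q\<^sup>2 * \<kappa> n * E n ^ 18 * ln (real n) / sqrt (real n)" for n
  have Y_lim: "Y \<longlonglongrightarrow> 0"
  proof -
    have "(\<lambda>n. 13 * q\<^sup>2 * (\<kappa> n * exp (23 * rho n (Z n) (\<theta>s n) (\<gamma>s n) (\<epsilon>1 n) (\<epsilon>2 n)) / (sqrt (real n) / ln (real n)))) \<longlonglongrightarrow> 13 * q\<^sup>2 * 0"
      by (intro tendsto_mult_left smalloD_tendsto[OF growth])
    moreover have "13 * q\<^sup>2 * (\<kappa> n * exp (23 * rho n (Z n) (\<theta>s n) (\<gamma>s n) (\<epsilon>1 n) (\<epsilon>2 n)) / (sqrt (real n) / ln (real n))) = Y n" for n
    proof -
      have "exp (23 * rho n (Z n) (\<theta>s n) (\<gamma>s n) (\<epsilon>1 n) (\<epsilon>2 n)) = E n ^ 5 * E n ^ 18"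
        unfolding E_def power_add[symmetric] by (simp flip: exp_of_nat_mult)
      then show ?thesis by (simp add: Y_def mult_ac)
    qed
    ultimately show ?thesis by simp
  qed
  \<comment> \<open>the conditions, all true for large \<open>n\<close>, under which the estimates at a fixed \<open>n\<close> apply\<close>
  define regular where "regular n \<longleftrightarrow> k < n \<and> 5 \<le> n \<and> 1 \<le> ln (real n) \<and> 4 * ln (real n) \<le> real n \<and>
      1 \<le> 13 * E n ^ 5 * q\<^sup>2 * \<kappa> n \<and> 20000 * P\<^sup>2 * Y n \<le> 1 \<and>
      inverse_bounded_network n (w n) (E n) (edge_cov (Z n)) q (\<kappa> n) \<and>
      (\<forall>A. pos_def_mat (H_mat n (Z n) A (\<theta>s n) (\<gamma>s n)))" for n
  have "\<forall>\<^sub>F n in sequentially. regular n"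
  proof -
    have "\<forall>\<^sub>F n in sequentially. 1 \<le> ln (real n)" "\<forall>\<^sub>F n in sequentially. 4 * ln (real n) \<le> real n"
      by real_asymp+
    moreover have "\<forall>\<^sub>F n in sequentially. Y n < 1 / (20000 * P\<^sup>2)"
      using P by (intro order_tendstoD(2)[OF Y_lim]) auto
    ultimately show ?thesis
      using eventually_gt_at_top[of k] eventually_ge_at_top[of 5] H_pos_def H_inv_bound
    proof eventually_elim
      case (elim n)
      have n: "2 \<le> n" "5 \<le> n" using elim by auto
      interpret network n "w n" "edge_cov (Z n)"
        unfolding w_def by (rule network_of_rates[OF n(2)])
      have schur: "H_mat n (Z n) A (\<theta>s n) (\<gamma>s n) = schur" for A
        using H_mat_eq_schur[OF network_of_rates[OF n(2)]] unfolding w_def by blast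
      obtain \<omega> where \<omega>: "\<omega> \<in> space (M n)"
        using prob_space.not_empty[of "M n"] model[OF n(1)] unfolding poisson_network_def by blast
      have ball: "\<theta>s n \<in> sup_ball (2 * n - 1) (\<theta>s n) (\<epsilon>1 n)"
        using eps(1)[of n] by (simp add: sup_ball_def less_imp_le)
      have pd: "pos_def_mat schur" using elim \<omega> ball unfolding schur[of "\<lambda>i j. a n i j \<omega>", symmetric] by blast
      have "ereal (row_sum_norm (matrix_inv schur)) \<le> ereal (\<kappa> n / (real n)\<^sup>2)"
        using order_trans[OF SUP_upper[OF ball] elim(7)[rule_format, OF \<omega>]]
        unfolding schur[of "\<lambda>i j. a n i j \<omega>", symmetric] by blast
      then have inv: "row_sum_norm (matrix_inv schur) \<le> \<kappa> n / (real n)\<^sup>2" by simp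
      have E1: "1 \<le> E n"
      proof -
        have "(1, 2) \<in> off_diag n" using n by (auto simp: off_diag_def)
        from eta_bound_rho(2)[OF this eps(1)[of n] eps(2)[of n]] show ?thesis by (simp add: E_def)
      qed
      note wb = edge_rate_bounds[OF _ eps(1)[of n] eps(2)[of n], where Z = "Z n" and \<theta> = "\<theta>s n" and \<gamma> = "\<gamma>s n" and n = n, folded w_def E_def]
      have K1: "1 \<le> \<kappa> n * (E n * q\<^sup>2)"
        by (rule inverse_bound_lower[OF pd inv wb(2) q(2)[OF n(1)]]) (use E1 q(1) in auto)
      have \<kappa>: "0 < \<kappa> n"
      proof (rule ccontr)
        assume "\<not> 0 < \<kappa> n"
        then have "\<kappa> n * (E n * q\<^sup>2) \<le> 0" using E1 by (intro mult_nonpos_nonneg) auto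
        with K1 show False by simp
      qed
      have "\<kappa> n * (E n * q\<^sup>2) \<le> \<kappa> n * (13 * E n ^ 5 * q\<^sup>2)"
      proof -
        have "1 * E n \<le> 13 * E n ^ 5" using E1 self_le_power[of "E n" 5] by (intro mult_mono) auto
        from mult_right_mono[OF this, of "q\<^sup>2"] show ?thesis using \<kappa> by simp
      qed
      with K1 have K: "1 \<le> 13 * E n ^ 5 * q\<^sup>2 * \<kappa> n" by (simp add: mult_ac)
      have Y1: "20000 * P\<^sup>2 * Y n \<le> 1" using elim P by (simp add: field_simps)
      note rate = polynomial_rate_small[OF Y_def K E1 elim(1) n(1)]
      have "Y n \<le> 1 / 8"
      proof -
        have "20000 * 1 * Y n \<le> 20000 * P\<^sup>2 * Y n"
          using rate(1) P one_le_power[OF P, of 2] by (intro mult_right_mono mult_left_mono) auto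
        then show ?thesis using Y1 by simp
      qed
      from rate(4)[OF this] have nM: "4 * (E n)\<^sup>2 + 1 \<le> real n" .
      have "inverse_bounded_network n (w n) (E n) (edge_cov (Z n)) q (\<kappa> n)"
        by unfold_locales (use wb E1 nM q q(2)[OF n(1)] pos_def_mat_invertible[OF pd] \<kappa> inv in auto)
      then show ?case using elim K Y1 pd n unfolding regular_def schur by blast
    qed
  qed
  then obtain N0 where "\<And>n. N0 \<le> n \<Longrightarrow> regular n"
    unfolding eventually_sequentially by blast
  note N0 = this[unfolded regular_def]
  define \<Sigma> :: "nat \<Rightarrow> real^'k^'k" where "\<Sigma> n = (\<chi> i j. S_entry n (Z n) (\<theta>s n) (\<gamma>s n) (idx i) (idx j))" for n
  define D where "D n \<omega> = (\<chi> i. \<theta>h n \<omega> (idx i) - \<theta>s n (idx i))" for n \<omega>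
  have idx_n: "idx i \<in> {1..n}" "idx i \<noteq> n" if "k < n" for i n using range[of i] that by auto
  have \<Sigma>_pd: "pos_def_mat (\<Sigma> n)" if "N0 \<le> n" for n
    unfolding \<Sigma>_def using N0[OF that] by (intro S_block_pos_def inj idx_n network_of_rates) auto
  have meas: "(\<lambda>\<omega>. inv_sqrt_mat (\<Sigma> n) *v D n \<omega>) \<in> borel_measurable (M n)" if "N0 \<le> n" for n
  proof -
    have n: "k < n" "2 \<le> n" using N0[OF that] by auto
    have "(\<lambda>\<omega>. \<theta>h n \<omega> (idx i)) \<in> borel_measurable (M n)" for i
      by (rule measurable(1)[OF n(2)]) (use idx_n(1)[OF n(1), of i] in auto)
    then show ?thesis unfolding D_def
      by (intro borel_measurable_matrix_vector_mult borel_measurable_vec_lambda borel_measurable_diff borel_measurable_const)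
  qed
  have prob: "prob_space (M n)" if "N0 \<le> n" for n
    using model[of n] N0[OF that] unfolding poisson_network_def by auto
  have char: "(\<lambda>n. \<integral>\<omega>. iexp (t \<bullet> (inv_sqrt_mat (\<Sigma> n) *v D n \<omega>)) \<partial>M n) \<longlonglongrightarrow> complex_of_real (exp (- (t \<bullet> t) / 2))" for t
  proof -
    define v where "v = t \<bullet> t"
    have v0: "0 \<le> v" by (simp add: v_def)
    define close where "close n z \<longleftrightarrow>
        norm ((\<integral>\<omega>. iexp (t \<bullet> (inv_sqrt_mat (\<Sigma> n) *v D n \<omega>)) \<partial>M n) - exp (fst z - complex_of_real (snd z / 2)))
          \<le> real k * sqrt v * (1000000 * P ^ 3 * Y n) + 2 * ((4 * real n + P) * (2 * exp (- 4 * ln (real n))))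
        \<and> \<bar>snd z - v\<bar> \<le> 2 * real k * v * (2 * Y n)
        \<and> norm (fst z) \<le> ((real k + 1) * sqrt (v * (2 * Y n))) * \<bar>snd z\<bar>" for n z
    have "\<exists>z. close n z" if n: "N0 \<le> n" for n
    proof -
      note F = N0[OF n]
      have n2: "2 \<le> n" "k < n" using F by auto
      define s where "s = inv_sqrt_mat (\<Sigma> n) *v t"
      have inner: "t \<bullet> (inv_sqrt_mat (\<Sigma> n) *v D n \<omega>) = (\<Sum>i\<in>UNIV. s $ i * (\<theta>h n \<omega> (idx i) - \<theta>s n (idx i)))" for \<omega>
        unfolding transpose_adjoint[OF inv_sqrt_mat_normalizes(1)[OF \<Sigma>_pd[OF n]], symmetric] s_def[symmetric]
        by (simp add: inner_vec_def D_def)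
      have quad: "(\<Sum>i\<in>UNIV. (s $ i)\<^sup>2 / row_total n (w n) (idx i)) + (\<Sum>i\<in>UNIV. s $ i)\<^sup>2 / col_total n (w n) n = v"
        using inv_sqrt_mat_normalizes(2)[OF \<Sigma>_pd[OF n], of t]
          S_block_quadratic_form[OF inj idx_n(1)[OF n2(2)], of s "Z n" "\<theta>s n" "\<gamma>s n"]
        unfolding s_def[symmetric] v_def \<Sigma>_def[symmetric] w_def by simp
      have net: "inverse_bounded_network n (edge_rate n (Z n) (\<theta>s n) (\<gamma>s n)) (E n) (edge_cov (Z n)) q (\<kappa> n)"
        using F unfolding w_def by blast
      have "1 \<le> E n"
        using F inverse_bounded_network.axioms(1) bounded_network.M(1) by blast
      note rate = polynomial_rate_small[OF Y_def _ this _ n2(1)]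
      obtain \<zeta> V where zV: "norm ((\<integral>\<omega>. iexp (\<Sum>i\<in>UNIV. s $ i * (\<theta>h n \<omega> (idx i) - \<theta>s n (idx i))) \<partial>M n) - exp (\<zeta> - complex_of_real (V / 2)))
          \<le> real k * sqrt v * (1000000 * P ^ 3 * Y n) + 2 * ((4 * real n + P) * (2 * exp (- 4 * ln (real n))))"
        "\<bar>V - v\<bar> \<le> 2 * real k * v * ((E n)\<^sup>2 / (real n - 1))"
        "norm \<zeta> \<le> (real k + 1) * sqrt (v * (E n / (real n - 1))) * V"
        using mle_char_approx[OF model[OF n2(1)] net _ _ _ _ Y_def _ _ _ inj idx_n[OF n2(2)] quad[unfolded w_def], of "\<theta>h n" "\<gamma>h n"]
          F measurable(1)[OF n2(1)] mle[OF n2(1)]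
        unfolding num_params_def P_def k_def by blast
      have "2 * real k * v * ((E n)\<^sup>2 / (real n - 1)) \<le> 2 * real k * v * (2 * Y n)"
        using rate(2) F v0 by (intro mult_left_mono) auto
      moreover have "(real k + 1) * sqrt (v * (E n / (real n - 1))) * V \<le> ((real k + 1) * sqrt (v * (2 * Y n))) * \<bar>V\<bar>"
      proof -
        have "(real k + 1) * sqrt (v * (E n / (real n - 1))) * V \<le> (real k + 1) * sqrt (v * (E n / (real n - 1))) * \<bar>V\<bar>"
          using v0 \<open>1 \<le> E n\<close> n2 by (intro mult_left_mono mult_nonneg_nonneg) auto
        also have "\<dots> \<le> (real k + 1) * sqrt (v * (2 * Y n)) * \<bar>V\<bar>"
          using rate(3) F v0 by (intro mult_right_mono mult_left_mono real_sqrt_le_mono) auto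
        finally show ?thesis .
      qed
      ultimately have "close n (\<zeta>, V)" using zV unfolding close_def inner fst_conv snd_conv by linarith
      then show ?thesis ..
    qed
    then have "\<forall>\<^sub>F n in sequentially. \<exists>z. close n z"
      unfolding eventually_sequentially by blast
    then obtain z where z: "\<forall>\<^sub>F n in sequentially. close n (z n)"
      unfolding eventually_ex by blast
    have union: "(\<lambda>n. 2 * ((4 * real n + P) * (2 * exp (- 4 * ln (real n))))) \<longlonglongrightarrow> 0" by real_asymp
    have "(\<lambda>n. real k * sqrt v * (1000000 * P ^ 3 * Y n) + 2 * ((4 * real n + P) * (2 * exp (- 4 * ln (real n)))))
        \<longlonglongrightarrow> real k * sqrt v * (1000000 * P ^ 3 * 0) + 0"
      by (intro tendsto_add union tendsto_mult_left Y_lim)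
    moreover have "(\<lambda>n. 2 * real k * v * (2 * Y n)) \<longlonglongrightarrow> 2 * real k * v * (2 * 0)"
      by (intro tendsto_mult_left Y_lim)
    moreover have "(\<lambda>n. (real k + 1) * sqrt (v * (2 * Y n))) \<longlonglongrightarrow> (real k + 1) * sqrt (v * (2 * 0))"
      by (intro tendsto_mult_left tendsto_real_sqrt Y_lim)
    ultimately have "(\<lambda>n. \<integral>\<omega>. iexp (t \<bullet> (inv_sqrt_mat (\<Sigma> n) *v D n \<omega>)) \<partial>M n) \<longlonglongrightarrow> complex_of_real (exp (- v / 2))"
      by (intro iexp_limit_of_approximation[OF z[unfolded close_def]]) simp_all
    then show ?thesis by (simp add: v_def)
  qed
  have "converges_in_distribution M (\<lambda>n \<omega>. inv_sqrt_mat (\<Sigma> n) *v D n \<omega>) std_normal_vec"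
    unfolding converges_in_distribution_def
  proof (intro allI impI)
    fix f :: "real^'k \<Rightarrow> real" assume f: "continuous_on UNIV f \<and> bounded (range f)"
    define \<mu> where "\<mu> n = distr (M n) borel (\<lambda>\<omega>. inv_sqrt_mat (\<Sigma> n) *v D n \<omega>)" for n
    \<comment> \<open>a shift of the index makes the estimators measurable for every \<open>n\<close>\<close>
    have "(\<lambda>n. integral\<^sup>L (\<mu> (n + N0)) f) \<longlonglongrightarrow> integral\<^sup>L std_normal_vec f"
    proof (rule levy_continuity_std_normal_vec)
      show "prob_space (\<mu> (n + N0))" for n
        unfolding \<mu>_def by (rule prob_space.prob_space_distr[OF prob meas]) simp_all
      show "sets (\<mu> (n + N0)) = sets borel" for n by (simp add: \<mu>_def)
      fix t
      have "(\<integral>x. iexp (t \<bullet> x) \<partial>\<mu> n) = (\<integral>\<omega>. iexp (t \<bullet> (inv_sqrt_mat (\<Sigma> n) *v D n \<omega>)) \<partial>M n)" if "N0 \<le> n" for n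
        unfolding \<mu>_def by (rule integral_distr[OF meas[OF that]]) measurable
      then show "(\<lambda>n. \<integral>x. iexp (t \<bullet> x) \<partial>\<mu> (n + N0)) \<longlonglongrightarrow> complex_of_real (exp (- (t \<bullet> t) / 2))"
        using LIMSEQ_ignore_initial_segment[OF char[of t], of N0] by simp
    qed (use f in auto)
    then show "(\<lambda>n. integral\<^sup>L (distr (M n) borel (\<lambda>\<omega>. inv_sqrt_mat (\<Sigma> n) *v D n \<omega>)) f) \<longlonglongrightarrow> integral\<^sup>L std_normal_vec f"
      unfolding \<mu>_def by (rule LIMSEQ_offset)
  qed
  moreover have "\<forall>\<^sub>F n in sequentially. pos_def_mat (\<Sigma> n)"
    using eventually_ge_at_top[of N0] by (rule eventually_mono) (rule \<Sigma>_pd)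
  ultimately show ?thesis
    unfolding asymptotically_normal_def \<Sigma>_def D_def by simp
qed

end
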